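(* Let $F$ be a compact surface (possibly with boundary, not necessarily orientable), let $(A,[\,])$ be a knot-theoretic ternary group, and let $D$ be a (relative) flat link diagram on $F$. Then the number of knot-theoretic ternary group colorings of $D$ is a (relative) flat link invariant; that is, it is the same for any two diagrams on $F$ representing the same (relative) flat link.
   Context: A ternary group $(A,[\,])$ is a non-empty set $A$ with an associative operation $[\,]\colon A^3\to A$ (that is, $[[abc]de]=[a[bcd]e]=[ab[cde]]$ for all $a,b,c,d,e$) such that for all $a,b,c\in A$ each of the equations $[zab]=c$, $[azb]=c$, $[abz]=c$ has a unique solution $z\in A$. A knot-theoretic ternary group is a ternary group such that, for all $a,b,c,d\in A$, $[[abc]cd]=[[ab[bcd]][bcd]d]$ and $[ab[bcd]]=[a[abc][[abc]cd]]$; such a group satisfies $[abc]=[cba]$ for all $a,b,c$. Let $f\colon\bigsqcup_i S^1_i\sqcup\bigsqcup_k I_k\to F$ be a local embedding (generic immersion) of finitely many disjoint circles and finitely many disjoint arcs in $F$ such that precisely the endpoints of the arcs are sent to the boundary of $F$ (if $F$ has no boundary, only circles are used), with $|f^{-1}(f(x))|<3$ for all $x$ (at most double points, called flat crossings) and $|f^{-1}(f(x))|=1$ if $x$ is an arc endpoint. The image of such a map is a diagram on $F$. Diagrams are considered up to isotopy on $F$ and the flat Reidemeister moves, performed locally in disks in $F$ in either direction: (I) adding a kink with one crossing to a strand; (II) passing one strand over an adjacent one so that two crossings and a bigon are created; (III) moving a strand across a crossing of two other strands through a triangle. Moreover, the images of arc endpoints may slide on the boundary of $F$ and pass one through another (two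 adjacent endpoints on the boundary exchange places, which creates or removes a crossing of the two strands near the boundary). An equivalence class is called a relative flat link on $F$ if it involves any arcs, and a flat link on $F$ if there are no arcs. A knot-theoretic ternary group coloring of a diagram $D$ is an assignment of elements of $A$ to the regions (connected components of $F\setminus D$) such that at every crossing, if the four regions (corners) around it, taken in cyclic order, have colors $a,b,c,d$, then $a=[bcd]$. (This condition does not depend on the choice of the starting corner or of the direction of the cyclic order.) *)

theory Defs
  imports "HOL-Analysis.Analysis"
begin

section \<open>Knot-theoretic ternary groups\<close>

definition ternary_group :: "'b set \<Rightarrow> ('b \<Rightarrow> 'b \<Rightarrow> 'b \<Rightarrow> 'b) \<Rightarrow> bool" where
  "ternary_group A t \<longleftrightarrow>
     A \<noteq> {} \<and>
     (\<forall>a\<in>A. \<forall>b\<in>A. \<forall>c\<in>A. t a b c \<in> A) \<and>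
     (\<forall>a\<in>A. \<forall>b\<in>A. \<forall>c\<in>A. \<forall>d\<in>A. \<forall>e\<in>A.
        t (t a b c) d e = t a (t b c d) e \<and> t a (t b c d) e = t a b (t c d e)) \<and>
     (\<forall>a\<in>A. \<forall>b\<in>A. \<forall>c\<in>A.
        (\<exists>!z. z \<in> A \<and> t z a b = c) \<and>
        (\<exists>!z. z \<in> A \<and> t a z b = c) \<and>
        (\<exists>!z. z \<in> A \<and> t a b z = c))"

definition knot_theoretic_ternary_group :: "'b set \<Rightarrow> ('b \<Rightarrow> 'b \<Rightarrow> 'b \<Rightarrow> 'b) \<Rightarrow> bool" where
  "knot_theoretic_ternary_group A t \<longleftrightarrow>
     ternary_group A t \<and>
     (\<forall>a\<in>A. \<forall>b\<in>A. \<forall>c\<in>A. \<forall>d\<in>A.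
        t (t a b c) c d = t (t a b (t b c d)) (t b c d) d \<and>
        t a b (t b c d) = t a (t a b c) (t (t a b c) c d))"


section \<open>Compact surfaces\<close>

type_synonym plane = "real \<times> real"

definition half_plane :: "plane set" where
  "half_plane = {(x, y). 0 \<le> y}"

text \<open>An inverse chart: a homeomorphism from a plane set \<open>X\<close> (below always \<open>UNIV\<close> or
  \<open>half_plane\<close>) onto an open subset of \<open>F\<close>. With \<open>X = UNIV\<close> its image is an open disk in \<open>F\<close>,
  with \<open>X = half_plane\<close> it is an open half-disk at the boundary of \<open>F\<close>.\<close>

definition open_embedding :: "plane set \<Rightarrow> 'a topology \<Rightarrow> (plane \<Rightarrow> 'a) \<Rightarrow> bool" where
  "open_embedding X F e \<longleftrightarrow> embedding_map (top_of_set X) F e \<and> openin F (e ` X)"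

text \<open>Second countability follows from compactness. Neither connectedness nor orientability
  is required.\<close>

definition compact_surface :: "'a topology \<Rightarrow> bool" where
  "compact_surface F \<longleftrightarrow>
     compact_space F \<and> Hausdorff_space F \<and>
     (\<forall>p \<in> topspace F.
        (\<exists>e. open_embedding UNIV F e \<and> p \<in> range e) \<or>
        (\<exists>e. open_embedding half_plane F e \<and> p \<in> e ` half_plane))"

definition surface_boundary :: "'a topology \<Rightarrow> 'a set" where
  "surface_boundary F = {e (x, 0) | e x. open_embedding half_plane F e}"


section \<open>Diagrams\<close>

text \<open>The disjoint union of \<open>n\<close> circles and \<open>m\<close> arcs; the first coordinate (with the discrete
  topology of \<open>nat\<close>) numbers the components.\<close>

definition link_source :: "nat \<Rightarrow> nat \<Rightarrow> (nat \<times> plane) set" where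
  "link_source n m = {..<n} \<times> sphere 0 1 \<union> {n..<n + m} \<times> ({0..1} \<times> {0})"

definition arc_endpoints :: "nat \<Rightarrow> nat \<Rightarrow> (nat \<times> plane) set" where
  "arc_endpoints n m = {n..<n + m} \<times> {(0, 0), (1, 0)}"

text \<open>A chart in which \<open>D\<close> is the union of the coordinate axes. For a diagram \<open>D\<close> the flat
  crossings are exactly the points \<open>e (0, 0)\<close> of such charts, because \<open>D\<close> is locally an arc at
  each of its other points.\<close>

definition crossing_chart :: "'a topology \<Rightarrow> 'a set \<Rightarrow> (plane \<Rightarrow> 'a) \<Rightarrow> bool" where
  "crossing_chart F D e \<longleftrightarrow>
     open_embedding UNIV F e \<and> {z. e z \<in> D} = {(x, y). x = 0 \<or> y = 0}"

text \<open>The last conjunct is genericity: at a double point the two strands cross transversally,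
  that is, in a suitable chart one strand is the horizontal axis and the other the vertical axis.\<close>

definition generic_immersion ::
  "'a topology \<Rightarrow> nat \<Rightarrow> nat \<Rightarrow> (nat \<times> plane \<Rightarrow> 'a) \<Rightarrow> bool" where
  "generic_immersion F n m f \<longleftrightarrow>
     (let S = link_source n m in
       continuous_map (top_of_set S) F f \<and>
       (\<forall>x\<in>S. \<exists>U. openin (top_of_set S) U \<and> x \<in> U \<and> embedding_map (top_of_set U) F f) \<and>
       (\<forall>x\<in>S. f x \<in> surface_boundary F \<longleftrightarrow> x \<in> arc_endpoints n m) \<and>
       (\<forall>x\<in>S. finite {y\<in>S. f y = f x} \<and> card {y\<in>S. f y = f x} < 3) \<and>
       (\<forall>x\<in>arc_endpoints n m. {y\<in>S. f y = f x} = {x}) \<and>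
       (\<forall>x\<in>S. \<forall>y\<in>S. x \<noteq> y \<and> f x = f y \<longrightarrow>
          (\<exists>e U V. crossing_chart F (f ` S) e \<and> e (0, 0) = f x \<and>
             openin (top_of_set S) U \<and> x \<in> U \<and> f ` U = e ` {(s, t). t = 0} \<and>
             openin (top_of_set S) V \<and> y \<in> V \<and> f ` V = e ` {(s, t). s = 0})))"

text \<open>Diagrams of relative flat links (\<open>m > 0\<close>) and of flat links (\<open>m = 0\<close>).\<close>

definition diagram :: "'a topology \<Rightarrow> 'a set \<Rightarrow> bool" where
  "diagram F D \<longleftrightarrow> (\<exists>n m f. generic_immersion F n m f \<and> D = f ` link_source n m)"


section \<open>Isotopy and moves\<close>

definition isotopic_in :: "'a topology \<Rightarrow> 'a set \<Rightarrow> 'a set \<Rightarrow> bool" where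
  "isotopic_in F D D' \<longleftrightarrow>
     (\<exists>h. homotopic_with (homeomorphic_map F F) F F id h \<and> D' = h ` D)"

text \<open>\<open>D'\<close> arises from \<open>D\<close> by replacing the local picture \<open>P\<close> by \<open>Q\<close> in a disk or half-disk. In
  every use below \<open>P\<close> and \<open>Q\<close> agree outside a compact subset of \<open>X\<close>, so \<open>D\<close> and \<open>D'\<close> agree outside
  a compact part of that disk.\<close>

definition local_move ::
  "plane set \<Rightarrow> plane set \<Rightarrow> plane set \<Rightarrow> 'a topology \<Rightarrow> 'a set \<Rightarrow> 'a set \<Rightarrow> bool" where
  "local_move X P Q F D D' \<longleftrightarrow>
     (\<exists>e. open_embedding X F e \<and>
          {z\<in>X. e z \<in> D} = P \<and> {z\<in>X. e z \<in> D'} = Q \<and>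
          D - e ` X = D' - e ` X)"

text \<open>Since charts may reverse orientation, mirror images of these pictures are included.\<close>

text \<open>(I) A horizontal strand acquires a kink: it runs from \<open>(-1,0)\<close> straight to \<open>(1,2)\<close>, then
  to \<open>(-1,2)\<close>, then straight to \<open>(1,0)\<close>, and has its crossing at \<open>(0,1)\<close>.\<close>

definition R1_before :: "plane set" where
  "R1_before = {(x, y). y = 0}"

definition R1_after :: "plane set" where
  "R1_after = {(x, y). y = max 0 (1 - \<bar>x\<bar>)} \<union>
              {(x, y). \<bar>x\<bar> \<le> 1 \<and> (y = 1 + \<bar>x\<bar> \<or> y = 2)}"

text \<open>(II) The lower of two parallel strands is pushed over the upper one; the crossings are
  \<open>(-1,1)\<close> and \<open>(1,1)\<close>.\<close>

definition R2_before :: "plane set" where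
  "R2_before = {(x, y). y = 0 \<or> y = 1}"

definition R2_after :: "plane set" where
  "R2_after = {(x, y). y = max 0 (2 - \<bar>x\<bar>) \<or> y = 1}"

text \<open>(III) A third strand moves across the crossing \<open>(0,0)\<close> of the two diagonals; the other two
  crossings move from \<open>(-1/2,1/2)\<close> and \<open>(1/2,1/2)\<close> to \<open>(-1/2,-1/2)\<close> and \<open>(1/2,-1/2)\<close>.\<close>

definition R3_before :: "plane set" where
  "R3_before = {(x, y). \<bar>y\<bar> = \<bar>x\<bar> \<or> y = max 0 (1 - \<bar>x\<bar>)}"

definition R3_after :: "plane set" where
  "R3_after = {(x, y). \<bar>y\<bar> = \<bar>x\<bar> \<or> y = - max 0 (1 - \<bar>x\<bar>)}"

text \<open>Boundary exchange: two strands ending at the adjacent boundary points \<open>(-1,0)\<close> and \<open>(1,0)\<close>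
  exchange their endpoints and thereby cross at \<open>(0,1)\<close>.\<close>

definition boundary_before :: "plane set" where
  "boundary_before = {(x, y). 0 \<le> y \<and> \<bar>x\<bar> = 1}"

definition boundary_after :: "plane set" where
  "boundary_after = {(x, y). 0 \<le> y \<and> \<bar>x\<bar> = min 1 \<bar>y - 1\<bar>}"

text \<open>Sliding endpoints along the boundary without passing one another is an isotopy of \<open>F\<close>.\<close>

definition diagram_step :: "'a topology \<Rightarrow> 'a set \<Rightarrow> 'a set \<Rightarrow> bool" where
  "diagram_step F D D' \<longleftrightarrow>
     diagram F D \<and> diagram F D' \<and>
     (isotopic_in F D D' \<or>
      local_move UNIV R1_before R1_after F D D' \<or>
      local_move UNIV R2_before R2_after F D D' \<or>
      local_move UNIV R3_before R3_after F D D' \<or>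
      local_move half_plane boundary_before boundary_after F D D')"

text \<open>Two diagrams represent the same (relative) flat link.\<close>

definition same_flat_link :: "'a topology \<Rightarrow> 'a set \<Rightarrow> 'a set \<Rightarrow> bool" where
  "same_flat_link F = equivclp (diagram_step F)"


section \<open>Colorings\<close>

definition regions :: "'a topology \<Rightarrow> 'a set \<Rightarrow> 'a set set" where
  "regions F D = connected_components_of (subtopology F (topspace F - D))"

definition region_of :: "'a topology \<Rightarrow> 'a set \<Rightarrow> 'a \<Rightarrow> 'a set" where
  "region_of F D p = connected_component_of_set (subtopology F (topspace F - D)) p"

text \<open>In a crossing chart the four corners are the images of the open quadrants; each of these is
  connected and disjoint from \<open>D\<close>, so it lies in the region of any one of its points. The condition
  is imposed for all charts, hence for every starting corner and both cyclic orders.\<close>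

definition colorings ::
  "'a topology \<Rightarrow> 'b set \<Rightarrow> ('b \<Rightarrow> 'b \<Rightarrow> 'b \<Rightarrow> 'b) \<Rightarrow> 'a set \<Rightarrow> ('a set \<Rightarrow> 'b) set" where
  "colorings F A t D =
     {c \<in> regions F D \<rightarrow>\<^sub>E A.
        \<forall>e. crossing_chart F D e \<longrightarrow>
          c (region_of F D (e (1, 1))) =
            t (c (region_of F D (e (-1, 1))))
              (c (region_of F D (e (-1, -1))))
              (c (region_of F D (e (1, -1))))}"

end

theory Submission
  imports Defs
begin

text \<open>A coloring amounts to a locally constant function on the complement of the diagram. Such
  functions can be glued: outside a compact part of the chart of a move nothing changes, and inside
  it the picture is a finite union of explicit plane curves. It therefore suffices to compare, for
  each move, the colorings of the two plane pictures that agree far away. Every region that is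
  bounded in the plane has its color determined by a crossing, and the axioms of a knot-theoretic
  ternary group make the remaining crossing conditions of the two pictures equivalent.

  The crossing condition refers to all crossing charts of the diagram. Two crossing
  charts with the same center differ by a symmetry of the square on their corners, and a point near
  which the diagram is the graph of a function is not the center of a crossing chart because its small
  neighborhoods are cut into two pieces only. Hence one chart at each visible crossing is enough.\<close>

section \<open>Algebra of knot-theoretic ternary groups\<close>

text \<open>Two obstacles shape the argument. A region of the surface may leave and re-enter the
  disk of a move many times, so the regions of the two diagrams cannot be matched by looking at the
  disk alone; functions on points need no matching, because whatever lies outside the disk simply
  keeps its value. And charts carry no orientation, so the crossing condition must survive
  reflections: the symmetry \<open>t a b c = t c b a\<close> is derived from the two exchange laws.
  The colorings are compared by two injections instead of an explicit bijection, which also covers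
  infinite sets of colorings. Each move then poses two questions about plane pictures: does every
  coloring of one picture have a partner on the other that agrees with it outside a large square,
  and is a coloring determined by its values out there? Algebraically, the existence of partners
  rests on solving a crossing equation for any of its corners, in move (II) also on cancellation,
  and in move (III) on the fact that a repeated entry may be exchanged for another one.\<close>

locale kt_ternary =
  fixes A :: "'b set" and t :: "'b \<Rightarrow> 'b \<Rightarrow> 'b \<Rightarrow> 'b"
  assumes kt: "knot_theoretic_ternary_group A t"
begin

lemma closed [simp]: "a \<in> A \<Longrightarrow> b \<in> A \<Longrightarrow> c \<in> A \<Longrightarrow> t a b c \<in> A"
  using kt unfolding knot_theoretic_ternary_group_def ternary_group_def by (elim conjE) simp

lemma assoc:
  assumes "a \<in> A" "b \<in> A" "c \<in> A" "d \<in> A" "e \<in> A"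
  shows "t (t a b c) d e = t a (t b c d) e" and "t a (t b c d) e = t a b (t c d e)"
  using kt assms unfolding knot_theoretic_ternary_group_def ternary_group_def
  by (elim conjE, simp)+

lemma solve:
  assumes "a \<in> A" "b \<in> A" "c \<in> A"
  shows "\<exists>!z. z \<in> A \<and> t z a b = c" and "\<exists>!z. z \<in> A \<and> t a b z = c"
  using kt assms unfolding knot_theoretic_ternary_group_def ternary_group_def
  by (elim conjE, simp)+

lemma left_cancel: "t a b z = t a b z' \<Longrightarrow> a \<in> A \<Longrightarrow> b \<in> A \<Longrightarrow> z \<in> A \<Longrightarrow> z' \<in> A \<Longrightarrow> z = z'"
  using solve(2)[of a b "t a b z"] by (metis closed)

lemma right_cancel: "t z a b = t z' a b \<Longrightarrow> a \<in> A \<Longrightarrow> b \<in> A \<Longrightarrow> z \<in> A \<Longrightarrow> z' \<in> A \<Longrightarrow> z = z'"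
  using solve(1)[of a b "t z a b"] by (metis closed)

lemma kt_laws:
  assumes "a \<in> A" "b \<in> A" "c \<in> A" "d \<in> A"
  shows "t (t a b c) c d = t (t a b (t b c d)) (t b c d) d"
    and "t a b (t b c d) = t a (t a b c) (t (t a b c) c d)"
  using kt[unfolded knot_theoretic_ternary_group_def, THEN conjunct2, rule_format, OF assms]
  by (rule conjunct1, rule conjunct2)

text \<open>Every \<open>e\<close> is \<open>t b c d\<close> for a suitable \<open>b\<close>. In the
  first exchange law with \<open>a = b\<close>, reassociation makes both sides begin with
  \<open>b\<close>, \<open>b\<close>, and this prefix cancels.\<close>

lemma left_square:
  assumes "c \<in> A" "d \<in> A" "e \<in> A"
  shows "t c c d = t e e d"
proof -
  obtain b where b: "b \<in> A" "t b c d = e"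
    using solve(1)[OF assms] by blast
  have "t b b (t c c d) = t b b (t e e d)"
    using kt_laws(1)[of b b c d] b assms by (simp add: assoc)
  then show ?thesis
    by (rule left_cancel) (use b assms in auto)
qed

text \<open>Mirror image of \<open>left_square\<close>: \<open>e\<close> is written as
  \<open>t a b c\<close>, the second law is taken at \<open>a\<close>, \<open>b\<close>,
  \<open>c\<close>, \<open>c\<close>, and the common tail \<open>c\<close>, \<open>c\<close>
  cancels.\<close>

lemma right_square:
  assumes "a \<in> A" "b \<in> A" "e \<in> A"
  shows "t a b b = t a e e"
proof -
  obtain c where c: "c \<in> A" "t a b c = e"
    using solve(2)[OF assms] by blast
  have "t (t a b b) c c = t (t a e e) c c"
    using kt_laws(2)[of a b c c] c assms by (simp add: assoc)
  then show ?thesis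
    by (rule right_cancel) (use c assms in auto)
qed

text \<open>Let \<open>s\<close> be the skew element of \<open>x\<close>, the solution of \<open>t x x s = x\<close>. The map
  \<open>d \<mapsto> t c c d\<close>, which does not depend on \<open>c\<close>, sends \<open>s\<close> to \<open>x\<close> by definition and \<open>x\<close> to \<open>s\<close>
  because \<open>t y s x = y\<close> for all \<open>y\<close>.\<close>

lemma square_square:
  assumes "c \<in> A" "x \<in> A"
  shows "t c c (t c c x) = x"
proof -
  obtain s where s: "s \<in> A" "t x x s = x"
    using solve(2)[OF assms(2) assms(2) assms(2)] by blast
  obtain u where u: "u \<in> A" "t u x x = s"
    using solve(1)[OF assms(2) assms(2) s(1)] by blast
  have "t s s x = t u (t x x s) x"
    using u s assms assoc(1)[of u x x s x] by simp
  then have "t s s x = s"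
    using s u by simp
  then show ?thesis
    using left_square[of c x s] left_square[of c s x] s assms by simp
qed

text \<open>The maps \<open>t c b\<close> and \<open>t b c\<close> are mutually inverse:
  reassociation brings the square \<open>t c c b\<close> into the middle, \<open>left_square\<close>
  turns it into \<open>t b b b\<close>, and what remains is the involution of
  \<open>square_square\<close>.\<close>

lemma zigzag:
  assumes "a \<in> A" "b \<in> A" "c \<in> A"
  shows "t b c (t c b a) = a"
proof -
  have "t b c (t c b a) = t b (t c c b) a"
    using assms by (simp add: assoc)
  also have "\<dots> = t b (t b b b) a"
    using left_square[of c b b] assms by simp
  also have "\<dots> = a"
    using assms by (simp add: assoc square_square)
  finally show ?thesis .
qed

text \<open>With \<open>?x\<close> and \<open>?y\<close> the two sides, expanding the middle factor
  of \<open>t ?x ?x ?y\<close> collapses it by \<open>zigzag\<close> to \<open>t ?x a a\<close>,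
  which equals \<open>t ?x ?x ?x\<close> by \<open>right_square\<close>. Cancelling
  \<open>?x\<close>, \<open>?x\<close> identifies the two sides.\<close>

lemma reverse:
  assumes "a \<in> A" "b \<in> A" "c \<in> A"
  shows "t a b c = t c b a"
proof -
  let ?x = "t a b c" and ?y = "t c b a"
  have xy: "?x \<in> A" "?y \<in> A"
    using assms by auto
  have "t ?x ?x ?y = t ?x a (t b c ?y)"
    using assoc(2)[of ?x a b c ?y] assms xy by simp
  also have "\<dots> = t ?x a a"
    using assms zigzag by simp
  also have "\<dots> = t ?x ?x ?x"
    using assms xy by (intro right_square)
  finally show ?thesis
    by (rule left_cancel[symmetric]) (use xy in auto)
qed

text \<open>Independence of the crossing condition from the starting corner: after
  \<open>reverse\<close>, applying \<open>t c d\<close> undoes \<open>t d c\<close> by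
  \<open>zigzag\<close>. Iterating it solves a crossing equation for any of the four
  corners.\<close>

lemma rotate:
  assumes "a = t b c d" "b \<in> A" "c \<in> A" "d \<in> A"
  shows "b = t c d a"
  using assms zigzag[of b c d] reverse[of b c d] by simp

text \<open>Both sides reassociate to \<open>t (t p q q) x z\<close>, respectively with
  \<open>q'\<close>, and \<open>t p q q\<close> does not depend on \<open>q\<close>.\<close>

lemma pull_square:
  assumes "p \<in> A" "q \<in> A" "q' \<in> A" "x \<in> A" "z \<in> A"
  shows "t p q (t q x z) = t p q' (t q' x z)"
  using assms right_square[of p q q'] by (simp flip: assoc)

text \<open>The colors around the triangle before move (III) are, in cyclic order,
  \<open>b, l, u, tt, v, r\<close>; \<open>x\<close> is the color of the triangle.\<close>

lemma triangle:
  assumes A: "b \<in> A" "l \<in> A" "u \<in> A" "tt \<in> A" "v \<in> A" "r \<in> A"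
    and x: "x = t l b r" "x = t tt u l" "x = t tt v r"
  shows "t u l b = t v r b" "t u l b = t u tt v"
proof -
  have xA: "x \<in> A"
    using A x by simp
  \<comment> \<open>\<open>u\<close>, \<open>v\<close> and \<open>b\<close> meet the triangle only
    at its vertices. Each crossing expresses the one opposite \<open>x\<close> by \<open>x\<close>
    and the two regions along the edges.\<close>
  have u: "u = t l x tt"
    using rotate[OF rotate[OF x(2)]] A xA by blast
  have v: "v = t r x tt"
    using rotate[OF rotate[OF x(3)]] A xA by blast
  have b: "b = t r x l"
    using rotate[OF rotate[OF x(1)]] A xA by blast
  \<comment> \<open>\<open>t u l b\<close>, \<open>t v r b\<close> and \<open>t u tt v\<close> are
    the colors that the three crossings after the move demand for the new triangle. In each
    comparison \<open>pull_square\<close> exchanges the repeated edge color.\<close>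
  have "t u l b = t b l (t l x tt)"
    using reverse[of u l b] A u by simp
  also have "\<dots> = t b r (t r x tt)"
    using A xA by (intro pull_square)
  also have "\<dots> = t v r b"
    using reverse[of b r v] A v by simp
  finally show "t u l b = t v r b" .
  have "t u l b = t u l (t l x r)"
    using reverse[of r x l] A xA b by simp
  also have "\<dots> = t u tt (t tt x r)"
    using A xA by (intro pull_square)
  also have "\<dots> = t u tt v"
    using reverse[of r x tt] A xA v by simp
  finally show "t u l b = t u tt v" .
qed

end

section \<open>Colorings as locally constant functions\<close>

text \<open>Continuity into the discrete topology, stated without a topology on the type of
  colors.\<close>

definition locally_constant :: "'a topology \<Rightarrow> ('a \<Rightarrow> 'b) \<Rightarrow> bool" where
  "locally_constant T k \<longleftrightarrow> (\<forall>p\<in>topspace T. \<exists>U. openin T U \<and> p \<in> U \<and> k constant_on U)"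

lemma locally_constant_connectedin:
  assumes k: "locally_constant T k" and S: "connectedin T S" "p \<in> S" "q \<in> S"
  shows "k p = k q"
proof (rule ccontr)
  assume ne: "k p \<noteq> k q"
  have op: "openin T {x \<in> topspace T. Q (k x)}" for Q :: "'b \<Rightarrow> bool"
  proof (subst openin_subopen, intro ballI)
    fix x assume x: "x \<in> {x \<in> topspace T. Q (k x)}"
    then obtain U v where U: "openin T U" "x \<in> U" "\<forall>q\<in>U. k q = v"
      using k unfolding locally_constant_def constant_on_def by blast
    then have "U \<subseteq> {x \<in> topspace T. Q (k x)}"
      using x openin_subset[OF U(1)] by auto
    then show "\<exists>U. openin T U \<and> x \<in> U \<and> U \<subseteq> {x \<in> topspace T. Q (k x)}"
      using U by blast
  qed
  let ?E1 = "{x \<in> topspace T. k x = k p}" and ?E2 = "{x \<in> topspace T. k x \<noteq> k p}"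
  have "S \<subseteq> topspace T"
    using S(1) connectedin_subset_topspace by blast
  then have "S \<subseteq> ?E1 \<union> ?E2" "?E1 \<inter> ?E2 \<inter> S = {}" "?E1 \<inter> S \<noteq> {}" "?E2 \<inter> S \<noteq> {}"
    using S ne by auto
  then show False
    using S(1) op[of "\<lambda>v. v = k p"] op[of "\<lambda>v. v \<noteq> k p"] unfolding connectedin by blast
qed

section \<open>Inverse charts as open embeddings\<close>

context
  fixes X :: "plane set" and F :: "'a topology" and e :: "plane \<Rightarrow> 'a"
  assumes e: "open_embedding X F e"
begin

lemma open_embedding_openin: "openin F (e ` X)"
  using e by (simp add: open_embedding_def)

lemma open_embedding_homeomorphic: "homeomorphic_map (top_of_set X) (subtopology F (e ` X)) e"
  using e by (simp add: open_embedding_def embedding_map_def)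

lemma open_embedding_continuous: "continuous_map (top_of_set X) F e"
  using homeomorphic_imp_continuous_map[OF open_embedding_homeomorphic]
  by (simp add: continuous_map_in_subtopology)

lemma open_embedding_inj: "inj_on e X"
  using homeomorphic_imp_injective_map[OF open_embedding_homeomorphic] by simp

lemma open_embedding_eq: "x \<in> X \<Longrightarrow> y \<in> X \<Longrightarrow> e x = e y \<longleftrightarrow> x = y"
  using open_embedding_inj by (auto dest: inj_onD)

lemma open_embedding_topspace: "x \<in> X \<Longrightarrow> e x \<in> topspace F"
  using openin_subset[OF open_embedding_openin] by blast

lemma open_embedding_image_openin:
  assumes "openin (top_of_set X) U"
  shows "openin F (e ` U)"
proof -
  have "openin (subtopology F (e ` X)) (e ` U)"
    using homeomorphic_imp_open_map[OF open_embedding_homeomorphic] assms by (simp add: open_map_def)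
  then show ?thesis
    using openin_trans_full open_embedding_openin by blast
qed

lemma open_embedding_preimage_openin:
  assumes "openin F U"
  shows "openin (top_of_set X) {z \<in> X. e z \<in> U}"
  using openin_continuous_map_preimage[OF open_embedding_continuous assms] by simp

lemma open_embedding_connectedin:
  assumes "connected S" "S \<subseteq> X"
  shows "connectedin F (e ` S)"
  by (rule connectedin_continuous_map_image[OF open_embedding_continuous])
     (simp add: connectedin_subtopology assms)

lemma open_embedding_compactin:
  assumes "compact S" "S \<subseteq> X"
  shows "compactin F (e ` S)"
  by (rule image_compactin[OF _ open_embedding_continuous])
     (simp add: compactin_subtopology assms)

lemma open_embedding_inverse:
  obtains g where "continuous_map (subtopology F (e ` X)) (top_of_set X) g" "\<And>z. z \<in> X \<Longrightarrow> g (e z) = z"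
  using open_embedding_homeomorphic unfolding homeomorphic_map_maps homeomorphic_maps_def by force

text \<open>Invariance of domain makes a continuous injection of the plane open, so the image of
  such a map inside the chart is again the image of a chart defined on the whole plane.\<close>

lemma open_embedding_compose:
  assumes "continuous_on UNIV f" "inj f" "range f \<subseteq> X"
  shows "open_embedding UNIV F (e \<circ> f)"
proof -
  have op: "open (f ` U)" if "open U" for U
    using invariance_of_domain_gen[of U f] assms that
    by (metis continuous_on_subset inj_on_subset order_refl subset_UNIV)
  have "embedding_map euclidean (top_of_set X) f"
  proof (rule injective_open_imp_embedding_map)
    show "open_map euclidean (top_of_set X) f"
      unfolding open_map_def using op assms(3) by (auto intro!: open_subset)
  qed (use assms in \<open>auto simp: continuous_map_in_subtopology\<close>)
  then have "embedding_map euclidean F (e \<circ> f)"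
    using e embedding_map_compose by (auto simp: open_embedding_def)
  moreover have "openin F (e ` range f)"
    using op[of UNIV] assms(3) by (intro open_embedding_image_openin open_subset) auto
  ultimately show ?thesis
    by (simp add: open_embedding_def image_comp)
qed

end

lemma crossing_chart_iff: "crossing_chart F D e \<Longrightarrow> e z \<in> D \<longleftrightarrow> fst z = 0 \<or> snd z = 0"
  by (cases z) (simp add: crossing_chart_def set_eq_iff)

lemma crossing_chart_embedding: "crossing_chart F D e \<Longrightarrow> open_embedding UNIV F e"
  by (simp add: crossing_chart_def)

definition corner_equation :: "('b \<Rightarrow> 'b \<Rightarrow> 'b \<Rightarrow> 'b) \<Rightarrow> (plane \<Rightarrow> 'b) \<Rightarrow> bool" where
  "corner_equation t k \<longleftrightarrow> k (1, 1) = t (k (-1, 1)) (k (-1, -1)) (k (1, -1))"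

text \<open>Colorings of different diagrams live on different sets of regions; as functions on
  points they can be compared wherever the diagrams agree. Extensionality makes a coloring
  determined by its values off \<open>D\<close>.\<close>

definition point_colorings ::
  "'a topology \<Rightarrow> 'b set \<Rightarrow> ('b \<Rightarrow> 'b \<Rightarrow> 'b \<Rightarrow> 'b) \<Rightarrow> 'a set \<Rightarrow> ('a \<Rightarrow> 'b) set" where
  "point_colorings F A t D =
     {k \<in> (topspace F - D) \<rightarrow>\<^sub>E A.
        locally_constant (subtopology F (topspace F - D)) k \<and>
        (\<forall>e. crossing_chart F D e \<longrightarrow> corner_equation t (k \<circ> e))}"

lemma crossing_chart_complement:
  assumes "crossing_chart F D e" "fst z \<noteq> 0" "snd z \<noteq> 0"
  shows "e z \<in> topspace F - D"
  using crossing_chart_iff[OF assms(1)] assms open_embedding_topspace[OF crossing_chart_embedding[OF assms(1)]]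
  by auto

text \<open>Local connectedness makes the regions open, so a function of the region is locally
  constant on points; conversely a locally constant function is constant on each region because
  regions are connected.\<close>

lemma colorings_eqpoll:
  assumes F: "locally_connected_space F" and D: "closedin F D"
  shows "colorings F A t D \<approx> point_colorings F A t D"
proof -
  let ?Y = "subtopology F (topspace F - D)"
  let ?f = "\<lambda>c. \<lambda>p\<in>topspace F - D. c (region_of F D p)"
  have top: "topspace ?Y = topspace F - D" by auto
  have lc: "locally_connected_space ?Y"
    using F D by (intro locally_connected_space_open_subset) auto
  have reg: "region_of F D p \<in> regions F D" if "p \<in> topspace F - D" for p
    using that unfolding regions_def region_of_def connected_components_of_def top by blast
  have reg_eq: "region_of F D p = region_of F D q" if "q \<in> region_of F D p" for p q
    using that connected_component_of_equiv[of ?Y p q] unfolding region_of_def mem_Collect_eq by simp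
  have self: "p \<in> region_of F D p" if "p \<in> topspace F - D" for p
    using that connected_component_of_refl[of ?Y p] by (simp add: region_of_def)
  have "bij_betw ?f (colorings F A t D) (point_colorings F A t D)"
  proof (rule bij_betwI')
    fix c c' assume c: "c \<in> colorings F A t D" "c' \<in> colorings F A t D"
    show "?f c = ?f c' \<longleftrightarrow> c = c'"
    proof
      assume eq: "?f c = ?f c'"
      show "c = c'"
      proof (rule PiE_ext[of c "regions F D" "\<lambda>_. A" c'])
        fix R assume "R \<in> regions F D"
        then obtain p where p: "p \<in> topspace F - D" "R = region_of F D p"
          unfolding regions_def region_of_def connected_components_of_def top by blast
        then show "c R = c' R" using fun_cong[OF eq, of p] by simp
      qed (use c in \<open>simp_all add: colorings_def\<close>)
    qed auto
  next
    fix c assume c: "c \<in> colorings F A t D"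
    have "?f c \<in> topspace F - D \<rightarrow>\<^sub>E A"
      using c reg by (auto simp: colorings_def)
    moreover have "locally_constant ?Y (?f c)"
      unfolding locally_constant_def top
    proof
      fix p assume p: "p \<in> topspace F - D"
      have op: "openin ?Y (region_of F D p)"
        unfolding region_of_def by (rule openin_connected_component_of_locally_connected_space[OF lc])
      have sub: "q \<in> topspace F - D" if "q \<in> region_of F D p" for q
        using that connected_component_in_topspace[of ?Y p q] by (auto simp: region_of_def)
      have "?f c q = c (region_of F D p)" if "q \<in> region_of F D p" for q
        using sub[OF that] reg_eq[OF that, symmetric] by simp
      then have "?f c constant_on region_of F D p"
        by (auto simp: constant_on_def simp del: restrict_apply)
      then show "\<exists>U. openin ?Y U \<and> p \<in> U \<and> ?f c constant_on U"
        using op self[OF p] by blast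
    qed
    moreover have "corner_equation t (?f c \<circ> e)" if "crossing_chart F D e" for e
      using c that crossing_chart_complement[OF that]
      by (simp add: corner_equation_def colorings_def)
    ultimately show "?f c \<in> point_colorings F A t D"
      by (simp add: point_colorings_def)
  next
    fix k assume k: "k \<in> point_colorings F A t D"
    define c where "c = (\<lambda>R\<in>regions F D. k (SOME p. p \<in> R))"
    have cp: "c (region_of F D p) = k p" if p: "p \<in> topspace F - D" for p
    proof -
      let ?q = "SOME q. q \<in> region_of F D p"
      have q: "?q \<in> region_of F D p"
        using self[OF p] by (rule someI)
      have conn: "connectedin ?Y (region_of F D p)"
        by (simp add: region_of_def connectedin_connected_component_of)
      have "locally_constant ?Y k"
        using k by (simp add: point_colorings_def)
      then have "k ?q = k p"
        using conn q self[OF p] by (rule locally_constant_connectedin)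
      then show ?thesis using reg[OF p] by (simp add: c_def)
    qed
    have "c \<in> regions F D \<rightarrow>\<^sub>E A"
    proof (rule PiE_I)
      fix R assume "R \<in> regions F D"
      then obtain p where p: "p \<in> topspace F - D" "R = region_of F D p"
        unfolding regions_def region_of_def connected_components_of_def top by blast
      then show "c R \<in> A" using cp k by (auto simp: point_colorings_def PiE_iff)
    qed (simp add: c_def)
    moreover have "c (region_of F D (e (1, 1))) = t (c (region_of F D (e (-1, 1))))
        (c (region_of F D (e (-1, -1)))) (c (region_of F D (e (1, -1))))"
      if e: "crossing_chart F D e" for e
    proof -
      have "corner_equation t (k \<circ> e)"
        using k e by (simp add: point_colorings_def)
      then show ?thesis
        using crossing_chart_complement[OF e] by (simp add: corner_equation_def cp)
    qed
    ultimately have "c \<in> colorings F A t D"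
      by (simp add: colorings_def)
    moreover have "k = ?f c"
    proof (rule PiE_ext[of k "topspace F - D" "\<lambda>_. A"])
      show "k \<in> topspace F - D \<rightarrow>\<^sub>E A"
        using k by (simp add: point_colorings_def)
      then show "?f c \<in> topspace F - D \<rightarrow>\<^sub>E A"
        using cp by (auto simp: PiE_iff simp del: Diff_iff)
    qed (simp add: cp)
    ultimately show "\<exists>c\<in>colorings F A t D. k = ?f c" by blast
  qed
  then show ?thesis by (auto simp: eqpoll_def)
qed

text \<open>Both chart domains are convex, so the trace of a ball on the domain is connected and its
  image is a small connected open set.\<close>

lemma compact_surface_locally_connected:
  assumes "compact_surface F"
  shows "locally_connected_space F"
  unfolding locally_connected_space
proof (intro allI impI, elim conjE)
  fix V p assume V: "openin F V" and p: "p \<in> V"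
  have "p \<in> topspace F"
    using openin_subset[OF V] p by blast
  then have "(\<exists>e. open_embedding UNIV F e \<and> p \<in> range e) \<or>
      (\<exists>e. open_embedding half_plane F e \<and> p \<in> e ` half_plane)"
    using assms by (simp add: compact_surface_def)
  then obtain X e z where X: "X = UNIV \<or> X = half_plane" and e: "open_embedding X F e" and z: "z \<in> X" "p = e z"
    by blast
  have "convex half_plane"
    by (auto simp: half_plane_def convex_def)
  then have cX: "convex X" using X by auto
  have "openin (top_of_set X) {x \<in> X. e x \<in> V}"
    using open_embedding_preimage_openin[OF e V] .
  then obtain r where r: "r > 0" "ball z r \<inter> X \<subseteq> {x \<in> X. e x \<in> V}"
    using z p unfolding openin_contains_ball by blast
  let ?N = "ball z r \<inter> X"
  have "connectedin F (e ` ?N)"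
    using cX by (intro open_embedding_connectedin[OF e] convex_connected convex_Int) auto
  moreover have "openin F (e ` ?N)"
    by (intro open_embedding_image_openin[OF e]) (simp add: Int_commute openin_open_Int)
  ultimately show "\<exists>U. openin F U \<and> connectedin F U \<and> p \<in> U \<and> U \<subseteq> V"
    using r z by (intro exI[of _ "e ` ?N"]) auto
qed

lemma diagram_closedin:
  assumes "compact_surface F" "diagram F D"
  shows "closedin F D"
proof -
  obtain n m f where f: "generic_immersion F n m f" and D: "D = f ` link_source n m"
    using assms(2) by (auto simp: diagram_def)
  have "compact (link_source n m)"
    unfolding link_source_def
    by (intro compact_Un compact_Times) (auto intro: finite_imp_compact)
  moreover have "continuous_map (top_of_set (link_source n m)) F f"
    using f by (simp add: generic_immersion_def Let_def)
  ultimately have "compactin F D"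
    unfolding D by (intro image_compactin[of "top_of_set (link_source n m)"]) (auto simp: compactin_subtopology)
  then show ?thesis
    using assms(1) compactin_imp_closedin by (auto simp: compact_surface_def)
qed

section \<open>Quadrants, boxes and localization of crossing charts\<close>

section \<open>Crossing charts\<close>

lemma connected_same_sign:
  fixes T :: "real set"
  assumes "connected T" "a \<in> T" "b \<in> T" "0 \<notin> T"
  shows "0 < a \<longleftrightarrow> 0 < b"
  using connectedD_interval[OF assms(1), of a b 0] connectedD_interval[OF assms(1), of b a 0] assms
  by (metis linorder_not_le order_less_imp_le)

text \<open>Pulled back through the chart, \<open>S\<close> is connected and avoids both axes, so
  neither coordinate changes sign on it.\<close>

lemma same_quadrant:
  assumes e: "crossing_chart F D e"
    and S: "connectedin F S" "S \<subseteq> range e" "S \<inter> D = {}" "e w \<in> S" "e w' \<in> S"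
  shows "(0 < fst w \<longleftrightarrow> 0 < fst w') \<and> (0 < snd w \<longleftrightarrow> 0 < snd w')"
proof -
  obtain g where g: "continuous_map (subtopology F (range e)) (top_of_set UNIV) g" "\<And>z. g (e z) = z"
    using open_embedding_inverse[OF crossing_chart_embedding[OF e]] by (metis UNIV_I)
  have "connectedin (top_of_set UNIV) (g ` S)"
    by (rule connectedin_continuous_map_image[OF g(1)]) (simp add: connectedin_subtopology S)
  then have conn: "connected (g ` S)"
    by simp
  have ne: "fst z \<noteq> 0 \<and> snd z \<noteq> 0" if "z \<in> g ` S" for z
  proof -
    obtain p where p: "p \<in> S" "z = g p" using \<open>z \<in> g ` S\<close> by blast
    then obtain y where "p = e y" using S(2) by blast
    then have "p = e z" using p g(2) by simp
    with p(1) S(3) have "e z \<notin> D" by blast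
    then show ?thesis using crossing_chart_iff[OF e, of z] by simp
  qed
  have w: "w \<in> g ` S" "w' \<in> g ` S"
    using S g(2) by (metis imageI)+
  have "connected (fst ` g ` S)" "connected (snd ` g ` S)"
    using conn by (intro connected_continuous_image continuous_intros; simp)+
  moreover have "0 \<notin> fst ` g ` S" "0 \<notin> snd ` g ` S"
    using ne by (metis imageE)+
  ultimately show ?thesis
    using w connected_same_sign[of "fst ` g ` S" "fst w" "fst w'"]
      connected_same_sign[of "snd ` g ` S" "snd w" "snd w'"] by blast
qed

lemma locally_constant_chart:
  assumes k: "locally_constant (subtopology F (topspace F - D)) k"
    and e: "open_embedding X F e"
    and S: "connected S" "S \<subseteq> X" "\<And>z. z \<in> S \<Longrightarrow> e z \<notin> D" "w \<in> S" "w' \<in> S"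
  shows "k (e w) = k (e w')"
proof (rule locally_constant_connectedin[OF k])
  show "connectedin (subtopology F (topspace F - D)) (e ` S)"
    using open_embedding_connectedin[OF e S(1,2)] open_embedding_topspace[OF e] S
    by (auto simp: connectedin_subtopology)
qed (use S in auto)

text \<open>The signs of \<open>a\<close> and \<open>b\<close> select the quadrant, so one statement
  serves all four.\<close>

lemma convex_quadrant: "convex {z :: plane. 0 < a * fst z \<and> 0 < b * snd z}"
proof -
  have "{z :: plane. 0 < a * fst z \<and> 0 < b * snd z} = {z. inner (a, 0) z > 0} \<inter> {z. inner (0, b) z > 0}"
    by auto
  then show ?thesis
    by (simp add: convex_Int convex_halfspace_gt)
qed

lemma locally_constant_quadrant:
  assumes k: "locally_constant (subtopology F (topspace F - D)) k"
    and e: "crossing_chart F D e"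
    and w: "0 < fst w * fst w'" "0 < snd w * snd w'"
  shows "k (e w) = k (e w')"
proof (rule locally_constant_chart[OF k crossing_chart_embedding[OF e] convex_connected[OF convex_quadrant]])
  show "w \<in> {z. 0 < fst w * fst z \<and> 0 < snd w * snd z}" "w' \<in> {z. 0 < fst w * fst z \<and> 0 < snd w * snd z}"
    using w by (auto simp: zero_less_mult_iff)
  show "e z \<notin> D" if "z \<in> {z. 0 < fst w * fst z \<and> 0 < snd w * snd z}" for z
    using that crossing_chart_iff[OF e] by auto
qed simp

text \<open>Turns bounded boxes into charts defined on the whole plane.\<close>

definition squash :: "real \<Rightarrow> real" where
  "squash x = x / (1 + \<bar>x\<bar>)"

lemma squash_continuous [continuous_intros]:
  "continuous_on S f \<Longrightarrow> continuous_on S (\<lambda>x. squash (f x))"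
  unfolding squash_def by (intro continuous_intros) (auto simp: add_nonneg_eq_0_iff)

lemma squash_bound: "\<bar>squash x\<bar> < 1"
proof -
  have "0 < 1 + \<bar>x\<bar>" by linarith
  then show ?thesis by (simp add: squash_def)
qed

lemma squash_simps [simp]: "squash 0 = 0" "squash 1 = 1 / 2" "squash (-1) = - (1 / 2)" "squash x = 0 \<longleftrightarrow> x = 0"
  by (auto simp: squash_def add_nonneg_eq_0_iff)

lemma squash_inj: "squash x = squash y \<longleftrightarrow> x = y"
proof
  assume eq: "squash x = squash y"
  have "x = squash x / (1 - \<bar>squash x\<bar>)" for x
  proof -
    have pos: "0 < 1 + \<bar>x\<bar>" by linarith
    then have "1 - \<bar>squash x\<bar> = 1 / (1 + \<bar>x\<bar>)"
      by (simp add: squash_def field_simps)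
    then show ?thesis
      using pos by (simp add: squash_def)
  qed
  then show "x = y" using eq by metis
qed simp

definition det2 :: "plane \<Rightarrow> plane \<Rightarrow> real" where
  "det2 u v = fst u * snd v - snd u * fst v"

lemma det2_unique:
  fixes s r s' r' :: real
  assumes "det2 u v \<noteq> 0" "s *\<^sub>R u + r *\<^sub>R v = s' *\<^sub>R u + r' *\<^sub>R v"
  shows "s = s' \<and> r = r'"
proof -
  have 1: "(s - s') * fst u + (r - r') * fst v = 0" and 2: "(s - s') * snd u + (r - r') * snd v = 0"
    using arg_cong[OF assms(2), of fst] arg_cong[OF assms(2), of snd] by (simp_all add: algebra_simps)
  have "(s - s') * det2 u v = 0" "(r - r') * det2 u v = 0"
    using 1 2 unfolding det2_def by algebra+
  then show ?thesis using assms(1) by simp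
qed

text \<open>A parametrization by the whole plane of the open parallelogram with center
  \<open>z\<close> and half-edges \<open>u\<close>, \<open>v\<close>. The axes go to the two
  midlines, and since \<open>squash 1 = 1 / 2\<close> the corner samples of
  \<open>corner_equation\<close> land halfway out.\<close>

definition squash_box :: "plane \<Rightarrow> plane \<Rightarrow> plane \<Rightarrow> plane \<Rightarrow> plane" where
  "squash_box z u v p = z + squash (fst p) *\<^sub>R u + squash (snd p) *\<^sub>R v"

lemma squash_box_continuous: "continuous_on UNIV (squash_box z u v)"
  unfolding squash_box_def by (intro continuous_intros)

lemma squash_box_inj:
  assumes "det2 u v \<noteq> 0"
  shows "inj (squash_box z u v)"
proof (rule injI)
  fix p q assume "squash_box z u v p = squash_box z u v q"
  then have "squash (fst p) *\<^sub>R u + squash (snd p) *\<^sub>R v = squash (fst q) *\<^sub>R u + squash (snd q) *\<^sub>R v"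
    by (simp only: squash_box_def add.assoc add_left_cancel)
  from det2_unique[OF assms this] show "p = q"
    by (simp add: squash_inj prod_eq_iff)
qed

text \<open>Inside the parallelogram \<open>P\<close> consists of the two midlines. This reduces
  finding a crossing chart for an explicit picture to real arithmetic in \<open>s\<close> and
  \<open>r\<close>.\<close>

definition crossing_box :: "plane set \<Rightarrow> plane set \<Rightarrow> plane \<times> plane \<times> plane \<Rightarrow> bool" where
  "crossing_box X P = (\<lambda>(z, u, v). det2 u v \<noteq> 0 \<and>
     (\<forall>s r. \<bar>s\<bar> < 1 \<longrightarrow> \<bar>r\<bar> < 1 \<longrightarrow>
        z + s *\<^sub>R u + r *\<^sub>R v \<in> X \<and> (z + s *\<^sub>R u + r *\<^sub>R v \<in> P \<longleftrightarrow> s = 0 \<or> r = 0)))"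

lemma crossing_box_chart:
  assumes e: "open_embedding X F e" and P: "{z \<in> X. e z \<in> D} = P" and box: "crossing_box X P (z, u, v)"
  shows "crossing_chart F D (e \<circ> squash_box z u v)"
proof -
  have X: "squash_box z u v p \<in> X" and iff: "squash_box z u v p \<in> P \<longleftrightarrow> fst p = 0 \<or> snd p = 0" for p
    using box squash_bound[of "fst p"] squash_bound[of "snd p"] by (auto simp: crossing_box_def squash_box_def)
  have "open_embedding UNIV F (e \<circ> squash_box z u v)"
    using box X squash_box_continuous squash_box_inj
    by (intro open_embedding_compose[OF e]) (auto simp: crossing_box_def)
  moreover have "e (squash_box z u v p) \<in> D \<longleftrightarrow> fst p = 0 \<or> snd p = 0" for p
    using X iff P by blast
  ultimately show ?thesis
    by (auto simp: crossing_chart_def)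
qed

lemma squash_box_simps:
  "squash_box z u v (0, 0) = z" "squash_box z u v (1, 1) = z + (1/2) *\<^sub>R u + (1/2) *\<^sub>R v"
  "squash_box z u v (-1, 1) = z - (1/2) *\<^sub>R u + (1/2) *\<^sub>R v"
  "squash_box z u v (-1, -1) = z - (1/2) *\<^sub>R u - (1/2) *\<^sub>R v"
  "squash_box z u v (1, -1) = z + (1/2) *\<^sub>R u - (1/2) *\<^sub>R v"
  by (simp_all add: squash_box_def)

lemma ball_square: "\<bar>x\<bar> < r / 2 \<Longrightarrow> \<bar>y\<bar> < r / 2 \<Longrightarrow> (x, y) \<in> ball (0 :: plane) r"
  using norm_Pair_le[of x y] by simp

text \<open>A chart shrunk into an open set where two diagrams agree becomes a crossing chart of the
  other diagram. This carries crossing equations between \<open>D\<close> and \<open>D'\<close> away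
  from the move.\<close>

lemma crossing_chart_localize:
  assumes e: "crossing_chart F D e" and W: "openin F W" "e (0, 0) \<in> W" "D \<inter> W = D' \<inter> W"
  obtains d where "0 < d" "crossing_chart F D' (e \<circ> squash_box 0 (d, 0) (0, d))"
    "\<And>p. e (squash_box 0 (d, 0) (0, d) p) \<in> W"
proof -
  note oe = crossing_chart_embedding[OF e]
  have "open {z. e z \<in> W}"
    using open_embedding_preimage_openin[OF oe W(1)] by simp
  then obtain r where r: "r > 0" "ball 0 r \<subseteq> {z. e z \<in> W}"
    using W(2) openE[of "{z. e z \<in> W}" 0] by (auto simp: zero_prod_def)
  define d where "d = r / 2"
  have d: "d > 0" "d \<noteq> 0" using r by (auto simp: d_def)
  have sq: "\<bar>squash s * d\<bar> < d" for s
    using squash_bound[of s] d by (simp add: abs_mult)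
  have in_W: "e (squash_box 0 (d, 0) (0, d) p) \<in> W" for p
    using r(2) ball_square[of "squash (fst p) * d" r "squash (snd p) * d"] sq
    by (auto simp: squash_box_def d_def)
  have "open_embedding UNIV F (e \<circ> squash_box 0 (d, 0) (0, d))"
    using d by (intro open_embedding_compose[OF oe] squash_box_continuous squash_box_inj) (auto simp: det2_def)
  moreover have "e (squash_box 0 (d, 0) (0, d) p) \<in> D' \<longleftrightarrow> fst p = 0 \<or> snd p = 0" for p
  proof -
    have "e (squash_box 0 (d, 0) (0, d) p) \<in> D' \<longleftrightarrow> e (squash_box 0 (d, 0) (0, d) p) \<in> D"
      using in_W W(3) by blast
    also have "\<dots> \<longleftrightarrow> fst p = 0 \<or> snd p = 0"
      using crossing_chart_iff[OF e] d by (simp add: squash_box_def)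
    finally show ?thesis .
  qed
  ultimately have "crossing_chart F D' (e \<circ> squash_box 0 (d, 0) (0, d))"
    by (auto simp: crossing_chart_def)
  then show ?thesis using that d in_W by blast
qed

lemma crossing_chart_neighborhood:
  assumes e: "crossing_chart F D e" and U: "openin F U" "e (0, 0) \<in> U"
  obtains r where "0 < r" "\<And>x y. \<bar>x\<bar> < r \<Longrightarrow> \<bar>y\<bar> < r \<Longrightarrow> e (x, y) \<in> U"
proof -
  have "open {z. e z \<in> U}"
    using open_embedding_preimage_openin[OF crossing_chart_embedding[OF e] U(1)] by simp
  then obtain r where r: "r > 0" "ball 0 r \<subseteq> {z. e z \<in> U}"
    using U(2) openE[of "{z. e z \<in> U}" 0] by (auto simp: zero_prod_def)
  then have "e (x, y) \<in> U" if "\<bar>x\<bar> < r / 2" "\<bar>y\<bar> < r / 2" for x y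
    using ball_square[OF that] by blast
  then show ?thesis
    using that[of "r / 2"] r(1) by simp
qed

section \<open>Comparing two crossing charts with the same center\<close>

lemma opposite_signs_vanish:
  fixes f :: "real \<Rightarrow> real"
  assumes f: "isCont f 0" and c: "0 < c"
    and pos: "\<And>s. 0 < s \<Longrightarrow> s < c \<Longrightarrow> 0 < f s \<longleftrightarrow> a"
    and neg: "\<And>s. 0 < s \<Longrightarrow> s < c \<Longrightarrow> 0 < f (- s) \<longleftrightarrow> \<not> a"
  shows "f 0 = 0"
proof (rule ccontr)
  assume "f 0 \<noteq> 0"
  then obtain d where d: "d > 0" "\<And>s. \<bar>s\<bar> < d \<Longrightarrow> \<bar>f s - f 0\<bar> < \<bar>f 0\<bar>"
    using f unfolding continuous_at_eps_delta dist_real_def by (metis diff_zero zero_less_abs_iff)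
  define s where "s = min c d / 2"
  have s: "0 < s" "s < c" "s < d" using c d(1) by (auto simp: s_def)
  have "\<bar>f s - f 0\<bar> < \<bar>f 0\<bar>" "\<bar>f (- s) - f 0\<bar> < \<bar>f 0\<bar>"
    using d(2)[of s] d(2)[of "- s"] s by auto
  then have "0 < f s \<longleftrightarrow> 0 < f (- s)" by linarith
  then show False using pos[OF s(1,2)] neg[OF s(1,2)] by simp
qed

text \<open>\<open>(p, q)\<close> with index \<open>i\<close> is the pair of signs assigned to the
  \<open>i\<close>-th corner in cyclic order. The last premise makes the assignment onto, hence
  bijective; the others forbid neighbours to become opposite. The eight cases are the four rotations
  followed by the four reflections.\<close>

lemma square_symmetry:
  assumes "\<not> ((p1 \<longleftrightarrow> \<not> p2) \<and> (q1 \<longleftrightarrow> \<not> q2))" "\<not> ((p2 \<longleftrightarrow> \<not> p3) \<and> (q2 \<longleftrightarrow> \<not> q3))"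
    "\<not> ((p3 \<longleftrightarrow> \<not> p4) \<and> (q3 \<longleftrightarrow> \<not> q4))" "\<not> ((p4 \<longleftrightarrow> \<not> p1) \<and> (q4 \<longleftrightarrow> \<not> q1))"
    and "\<And>a b. ((p1 \<longleftrightarrow> a) \<and> (q1 \<longleftrightarrow> b)) \<or> ((p2 \<longleftrightarrow> a) \<and> (q2 \<longleftrightarrow> b)) \<or>
      ((p3 \<longleftrightarrow> a) \<and> (q3 \<longleftrightarrow> b)) \<or> ((p4 \<longleftrightarrow> a) \<and> (q4 \<longleftrightarrow> b))"
  shows "p1 \<and> q1 \<and> \<not> p2 \<and> q2 \<and> \<not> p3 \<and> \<not> q3 \<and> p4 \<and> \<not> q4 \<or>
    \<not> p1 \<and> q1 \<and> \<not> p2 \<and> \<not> q2 \<and> p3 \<and> \<not> q3 \<and> p4 \<and> q4 \<or>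
    \<not> p1 \<and> \<not> q1 \<and> p2 \<and> \<not> q2 \<and> p3 \<and> q3 \<and> \<not> p4 \<and> q4 \<or>
    p1 \<and> \<not> q1 \<and> p2 \<and> q2 \<and> \<not> p3 \<and> q3 \<and> \<not> p4 \<and> \<not> q4 \<or>
    p1 \<and> q1 \<and> p2 \<and> \<not> q2 \<and> \<not> p3 \<and> \<not> q3 \<and> \<not> p4 \<and> q4 \<or>
    \<not> p1 \<and> q1 \<and> p2 \<and> q2 \<and> p3 \<and> \<not> q3 \<and> \<not> p4 \<and> \<not> q4 \<or>
    \<not> p1 \<and> \<not> q1 \<and> \<not> p2 \<and> q2 \<and> p3 \<and> q3 \<and> p4 \<and> \<not> q4 \<or>
    p1 \<and> \<not> q1 \<and> \<not> p2 \<and> \<not> q2 \<and> \<not> p3 \<and> q3 \<and> p4 \<and> q4"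
  using assms(1-4) assms(5)[of True True] assms(5)[of True False] assms(5)[of False True] assms(5)[of False False]
  by (cases p1; cases q1; cases p2; cases q2; simp; cases p3; cases q3; simp)

text \<open>The chart \<open>e'\<close> assigns to every quadrant of \<open>e\<close> the quadrant containing its germ at the
  crossing. This is a bijection, and it preserves adjacency because two opposite quadrants have
  only the crossing in common in their closures. Hence it is one of the eight symmetries
  of a square.\<close>

lemma crossing_corners:
  fixes k :: "'a \<Rightarrow> 'b"
  assumes e: "crossing_chart F D e" and e': "crossing_chart F D e'" and center: "e' (0, 0) = e (0, 0)"
    and k: "locally_constant (subtopology F (topspace F - D)) k"
  defines "c \<equiv> \<lambda>x y. k (e (x, y))" and "c' \<equiv> \<lambda>x y. k (e' (x, y))"
  shows "(c' 1 1, c' (-1) 1, c' (-1) (-1), c' 1 (-1)) \<in>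
    {(c 1 1, c (-1) 1, c (-1) (-1), c 1 (-1)), (c (-1) 1, c (-1) (-1), c 1 (-1), c 1 1),
     (c (-1) (-1), c 1 (-1), c 1 1, c (-1) 1), (c 1 (-1), c 1 1, c (-1) 1, c (-1) (-1)),
     (c 1 (-1), c (-1) (-1), c (-1) 1, c 1 1), (c (-1) (-1), c (-1) 1, c 1 1, c 1 (-1)),
     (c (-1) 1, c 1 1, c 1 (-1), c (-1) (-1)), (c 1 1, c 1 (-1), c (-1) (-1), c (-1) 1)}"
proof -
  note oe = crossing_chart_embedding[OF e] and oe' = crossing_chart_embedding[OF e']
  obtain r where r: "0 < r" "\<And>x y. \<bar>x\<bar> < r \<Longrightarrow> \<bar>y\<bar> < r \<Longrightarrow> e (x, y) \<in> range e'"
    using crossing_chart_neighborhood[OF e open_embedding_openin[OF oe']] center by (metis rangeI)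
  let ?B = "{-r<..<r} \<times> {-r<..<r}"
  have "openin F (e ` ?B)"
    by (intro open_embedding_image_openin[OF oe]) (simp add: open_Times)
  moreover have "e' (0, 0) \<in> e ` ?B"
    using r(1) center by auto
  ultimately obtain d where d: "0 < d" "\<And>x y. \<bar>x\<bar> < d \<Longrightarrow> \<bar>y\<bar> < d \<Longrightarrow> e' (x, y) \<in> e ` ?B"
    using crossing_chart_neighborhood[OF e'] by blast
  obtain g where g: "continuous_map (subtopology F (range e')) (top_of_set UNIV) g" "\<And>z. g (e' z) = z"
    using open_embedding_inverse[OF oe'] by (metis UNIV_I)
  \<comment> \<open>The change of coordinates from \<open>e\<close> to \<open>e'\<close>; it is
    meaningful on \<open>?B\<close>, where \<open>e\<close> stays in the range of
    \<open>e'\<close>.\<close>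
  define h where "h = g \<circ> e"
  have e'h: "e' (h z) = e z" if "z \<in> ?B" for z
    using r(2)[of "fst z" "snd z"] that g(2) unfolding h_def by (cases z) fastforce
  have h_cont: "continuous_on ?B h"
  proof -
    have "continuous_map (top_of_set ?B) (subtopology F (range e')) e"
      unfolding continuous_map_in_subtopology
      using continuous_map_from_subtopology[OF open_embedding_continuous[OF oe], of ?B] r(2) by fastforce
    then have "continuous_map (top_of_set ?B) (top_of_set UNIV) h"
      unfolding h_def using g(1) continuous_map_compose by blast
    then show ?thesis by simp
  qed
  have same: "(0 < fst (h z) \<longleftrightarrow> 0 < fst (h w)) \<and> (0 < snd (h z) \<longleftrightarrow> 0 < snd (h w))"
    if zw: "z \<in> ?B" "w \<in> ?B" "0 < fst z * fst w" "0 < snd z * snd w" for z w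
  proof -
    let ?S = "?B \<inter> {p. 0 < fst z * fst p \<and> 0 < snd z * snd p}"
    have "connected ?S"
      by (intro convex_connected convex_Int convex_quadrant convex_Times) auto
    then have "connectedin F (e ` ?S)"
      by (intro open_embedding_connectedin[OF oe]) auto
    moreover have "e ` ?S \<subseteq> range e'"
      using r(2) by fastforce
    moreover have "e ` ?S \<inter> D = {}"
      using crossing_chart_iff[OF e] by auto
    moreover have "z \<in> ?S" "w \<in> ?S"
      using zw by (auto simp: zero_less_mult_iff)
    then have "e' (h z) \<in> e ` ?S" "e' (h w) \<in> e ` ?S"
      using e'h zw by auto
    ultimately show ?thesis
      by (rule same_quadrant[OF e'])
  qed
  define q where "q = r / 2"
  have q: "0 < q" "q < r" using r(1) by (auto simp: q_def)
  \<comment> \<open>\<open>X x y\<close> and \<open>Y x y\<close> record the signs of the two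
    coordinates in \<open>e'\<close> of the quadrant of \<open>e\<close> with signs
    \<open>x\<close>, \<open>y\<close>. By \<open>same\<close> the sample point at distance
    \<open>q\<close> from the axes stands for the whole quadrant within \<open>?B\<close>.\<close>
  define X where "X = (\<lambda>x y. 0 < fst (h (x * q, y * q)))"
  define Y where "Y = (\<lambda>x y. 0 < snd (h (x * q, y * q)))"
  have h_ne: "fst (h z) \<noteq> 0 \<and> snd (h z) \<noteq> 0 \<longleftrightarrow> fst z \<noteq> 0 \<and> snd z \<noteq> 0" if "z \<in> ?B" for z
    using crossing_chart_iff[OF e'] crossing_chart_iff[OF e] e'h[OF that] by metis
  have XY: "(0 < fst (h z) \<longleftrightarrow> X (sgn (fst z)) (sgn (snd z))) \<and> (0 < snd (h z) \<longleftrightarrow> Y (sgn (fst z)) (sgn (snd z)))"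
    if "z \<in> ?B" "fst z \<noteq> 0" "snd z \<noteq> 0" for z
  proof -
    have "(sgn (fst z) * q, sgn (snd z) * q) \<in> ?B"
      using q by (auto simp: sgn_if)
    then show ?thesis
      unfolding X_def Y_def using q that by (intro same) (auto simp: sgn_if linorder_neq_iff mult_neg_pos)
  qed
  have col: "c' x' y' = c x y"
    if "\<bar>x\<bar> = 1" "\<bar>y\<bar> = 1" "\<bar>x'\<bar> = 1" "\<bar>y'\<bar> = 1" "0 < x' \<longleftrightarrow> X x y" "0 < y' \<longleftrightarrow> Y x y" for x y x' y'
  proof -
    let ?z = "(x * q, y * q)"
    have z: "?z \<in> ?B" "fst ?z \<noteq> 0" "snd ?z \<noteq> 0"
      using q that by (auto simp: abs_if split: if_splits)
    have "k (e (x, y)) = k (e ?z)"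
      using q that by (intro locally_constant_quadrant[OF k e]) (auto simp: abs_if split: if_splits)
    also have "\<dots> = k (e' (h ?z))"
      using e'h[OF z(1)] by simp
    also have "\<dots> = k (e' (x', y'))"
      using that z h_ne[OF z(1)] unfolding X_def Y_def
      by (intro locally_constant_quadrant[OF k e']) (auto simp: abs_if zero_less_mult_iff not_less split: if_splits)
    finally show ?thesis by (simp add: c_def c'_def)
  qed
  have surj: "\<exists>x\<in>{1, -1}. \<exists>y\<in>{1, -1}. (X x y \<longleftrightarrow> a) \<and> (Y x y \<longleftrightarrow> b)" for a b
  proof -
    \<comment> \<open>A point of the prescribed quadrant of \<open>e'\<close>, close enough to the
      crossing to lie in the image of \<open>?B\<close>; the quadrant of \<open>e\<close> containing
      it is the one sought.\<close>
    define w where "w = ((if a then d / 2 else - d / 2), (if b then d / 2 else - d / 2))"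
    have w: "0 < fst w \<longleftrightarrow> a" "0 < snd w \<longleftrightarrow> b" "fst w \<noteq> 0" "snd w \<noteq> 0" "e' w \<in> e ` ?B"
      using d(1) d(2)[of "fst w" "snd w"] by (auto simp: w_def)
    then obtain z where z: "z \<in> ?B" "e' w = e z" by blast
    then have "h z = w" using g(2) by (simp add: h_def flip: z(2))
    with w h_ne[OF z(1)] have "fst z \<noteq> 0" "snd z \<noteq> 0" by auto
    moreover from this have "sgn (fst z) \<in> {1, -1}" "sgn (snd z) \<in> {1, -1}"
      by (auto simp: sgn_if)
    ultimately show ?thesis
      using XY[OF z(1)] \<open>h z = w\<close> w by blast
  qed
  \<comment> \<open>\<open>(a1, a2)\<close> is a unit vector along a half-axis and
    \<open>(b1, b2)\<close> one perpendicular to it, so the signs of the two quadrants beside that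
    half-axis are the sum and the difference. The path \<open>?p\<close> crosses the half-axis at
    distance \<open>q\<close> from the center.\<close>
  have adj: "\<not> ((X (a1 + b1) (a2 + b2) \<longleftrightarrow> \<not> X (a1 - b1) (a2 - b2)) \<and> (Y (a1 + b1) (a2 + b2) \<longleftrightarrow> \<not> Y (a1 - b1) (a2 - b2)))"
    if ab: "\<bar>a1\<bar> + \<bar>b1\<bar> = 1" "\<bar>a2\<bar> + \<bar>b2\<bar> = 1" "\<bar>a1\<bar> + \<bar>a2\<bar> = 1" "a1 = 0 \<or> b1 = 0" "a2 = 0 \<or> b2 = 0"
    for a1 a2 b1 b2 :: real
  proof
    assume opp: "(X (a1 + b1) (a2 + b2) \<longleftrightarrow> \<not> X (a1 - b1) (a2 - b2)) \<and> (Y (a1 + b1) (a2 + b2) \<longleftrightarrow> \<not> Y (a1 - b1) (a2 - b2))"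
    let ?p = "\<lambda>s. (q * a1 + s * b1, q * a2 + s * b2)"
    have pB: "?p s \<in> ?B" if "\<bar>s\<bar> < q" for s
      using that ab q by (auto simp: abs_if split: if_splits)
    have hp: "isCont (\<lambda>s. h (?p s)) 0"
    proof (rule isCont_o2[where g = h])
      have "open ?B" by (simp add: open_Times)
      then show "isCont h (?p 0)"
        using h_cont pB[of 0] q continuous_on_eq_continuous_at by fastforce
    qed (intro continuous_intros)
    have sg: "(0 < fst (h (?p s)) \<longleftrightarrow> X (a1 + sgn s * b1) (a2 + sgn s * b2)) \<and>
              (0 < snd (h (?p s)) \<longleftrightarrow> Y (a1 + sgn s * b1) (a2 + sgn s * b2))" if s: "\<bar>s\<bar> < q" "s \<noteq> 0" for s
    proof -
      have "fst (?p s) \<noteq> 0" "snd (?p s) \<noteq> 0" "sgn (fst (?p s)) = a1 + sgn s * b1" "sgn (snd (?p s)) = a2 + sgn s * b2"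
        using ab s q by (auto simp: sgn_if abs_if split: if_splits)
      then show ?thesis using XY[OF pB[OF s(1)]] by simp
    qed
    have sg1: "(0 < fst (h (?p s)) \<longleftrightarrow> X (a1 + b1) (a2 + b2)) \<and> (0 < snd (h (?p s)) \<longleftrightarrow> Y (a1 + b1) (a2 + b2))"
      if "0 < s" "s < q" for s
      using sg[of s] that by simp
    have sg2: "(0 < fst (h (?p (- s))) \<longleftrightarrow> X (a1 - b1) (a2 - b2)) \<and> (0 < snd (h (?p (- s))) \<longleftrightarrow> Y (a1 - b1) (a2 - b2))"
      if "0 < s" "s < q" for s
      using sg[of "- s"] that by simp
    have "fst (h (?p 0)) = 0"
    proof (rule opposite_signs_vanish[where f = "\<lambda>s. fst (h (?p s))" and a = "X (a1 + b1) (a2 + b2)"])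
      show "isCont (\<lambda>s. fst (h (?p s))) 0" using hp by (intro continuous_intros)
    qed (use q(1) sg1 sg2 opp in blast)+
    moreover have "snd (h (?p 0)) = 0"
    proof (rule opposite_signs_vanish[where f = "\<lambda>s. snd (h (?p s))" and a = "Y (a1 + b1) (a2 + b2)"])
      show "isCont (\<lambda>s. snd (h (?p s))) 0" using hp by (intro continuous_intros)
    qed (use q(1) sg1 sg2 opp in blast)+
    \<comment> \<open>Both coordinates change sign along the path, so a point of the half-axis away
      from the center would be sent to the crossing itself, against injectivity of
      \<open>e\<close>.\<close>
    ultimately have "h (?p 0) = (0, 0)" by (simp add: prod_eq_iff)
    then have "e (?p 0) = e (0, 0)"
      using e'h[OF pB[of 0]] q center by simp
    then have "?p 0 = (0, 0)"
      using open_embedding_eq[OF oe] by blast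
    then show False using ab q by auto
  qed
  have sym: "X 1 1 \<and> Y 1 1 \<and> \<not> X (-1) 1 \<and> Y (-1) 1 \<and> \<not> X (-1) (-1) \<and> \<not> Y (-1) (-1) \<and> X 1 (-1) \<and> \<not> Y 1 (-1) \<or>
    \<not> X 1 1 \<and> Y 1 1 \<and> \<not> X (-1) 1 \<and> \<not> Y (-1) 1 \<and> X (-1) (-1) \<and> \<not> Y (-1) (-1) \<and> X 1 (-1) \<and> Y 1 (-1) \<or>
    \<not> X 1 1 \<and> \<not> Y 1 1 \<and> X (-1) 1 \<and> \<not> Y (-1) 1 \<and> X (-1) (-1) \<and> Y (-1) (-1) \<and> \<not> X 1 (-1) \<and> Y 1 (-1) \<or>
    X 1 1 \<and> \<not> Y 1 1 \<and> X (-1) 1 \<and> Y (-1) 1 \<and> \<not> X (-1) (-1) \<and> Y (-1) (-1) \<and> \<not> X 1 (-1) \<and> \<not> Y 1 (-1) \<or>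
    X 1 1 \<and> Y 1 1 \<and> X (-1) 1 \<and> \<not> Y (-1) 1 \<and> \<not> X (-1) (-1) \<and> \<not> Y (-1) (-1) \<and> \<not> X 1 (-1) \<and> Y 1 (-1) \<or>
    \<not> X 1 1 \<and> Y 1 1 \<and> X (-1) 1 \<and> Y (-1) 1 \<and> X (-1) (-1) \<and> \<not> Y (-1) (-1) \<and> \<not> X 1 (-1) \<and> \<not> Y 1 (-1) \<or>
    \<not> X 1 1 \<and> \<not> Y 1 1 \<and> \<not> X (-1) 1 \<and> Y (-1) 1 \<and> X (-1) (-1) \<and> Y (-1) (-1) \<and> X 1 (-1) \<and> \<not> Y 1 (-1) \<or>
    X 1 1 \<and> \<not> Y 1 1 \<and> \<not> X (-1) 1 \<and> \<not> Y (-1) 1 \<and> \<not> X (-1) (-1) \<and> Y (-1) (-1) \<and> X 1 (-1) \<and> Y 1 (-1)"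
  proof (rule square_symmetry)
    show "\<not> ((X 1 1 \<longleftrightarrow> \<not> X (-1) 1) \<and> (Y 1 1 \<longleftrightarrow> \<not> Y (-1) 1))" "\<not> ((X (-1) 1 \<longleftrightarrow> \<not> X (-1) (-1)) \<and> (Y (-1) 1 \<longleftrightarrow> \<not> Y (-1) (-1)))"
      "\<not> ((X (-1) (-1) \<longleftrightarrow> \<not> X 1 (-1)) \<and> (Y (-1) (-1) \<longleftrightarrow> \<not> Y 1 (-1)))" "\<not> ((X 1 (-1) \<longleftrightarrow> \<not> X 1 1) \<and> (Y 1 (-1) \<longleftrightarrow> \<not> Y 1 1))"
      using adj[of 0 1 1 0] adj[of "-1" 0 0 1] adj[of 0 "-1" "-1" 0] adj[of 1 0 0 "-1"] by simp_all
    show "((X 1 1 \<longleftrightarrow> a) \<and> (Y 1 1 \<longleftrightarrow> b)) \<or> ((X (-1) 1 \<longleftrightarrow> a) \<and> (Y (-1) 1 \<longleftrightarrow> b)) \<or>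
      ((X (-1) (-1) \<longleftrightarrow> a) \<and> (Y (-1) (-1) \<longleftrightarrow> b)) \<or> ((X 1 (-1) \<longleftrightarrow> a) \<and> (Y 1 (-1) \<longleftrightarrow> b))" for a b
      using surj[of a b] by blast
  qed
  have colors: "c' (if X x y then 1 else -1) (if Y x y then 1 else -1) = c x y"
    if "x \<in> {1, -1}" "y \<in> {1, -1}" for x y
    using that by (intro col) auto
  note cs = colors[of 1 1] colors[of 1 "-1"] colors[of "-1" 1] colors[of "-1" "-1"]
  from sym show ?thesis
    by (elim disjE; use cs in simp)
qed

text \<open>All eight arrangements of the corner colors left open by \<open>crossing_corners\<close>
  satisfy the equation: \<open>rotate\<close> supplies the four cyclic orders and
  \<open>reverse\<close> reads each of them backwards.\<close>

lemma (in kt_ternary) corner_equation_chart: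
  assumes e: "crossing_chart F D e" and e': "crossing_chart F D e'" and center: "e' (0, 0) = e (0, 0)"
    and k: "locally_constant (subtopology F (topspace F - D)) k" "\<And>p. p \<in> topspace F - D \<Longrightarrow> k p \<in> A"
    and eq: "corner_equation t (k \<circ> e)"
  shows "corner_equation t (k \<circ> e')"
proof -
  define a b c d where abcd: "a = k (e (1, 1))" "b = k (e (-1, 1))" "c = k (e (-1, -1))" "d = k (e (1, -1))"
  have in_A: "a \<in> A" "b \<in> A" "c \<in> A" "d \<in> A"
    using k(2) crossing_chart_complement[OF e] by (simp_all add: abcd)
  have 1: "a = t b c d"
    using eq by (simp add: corner_equation_def abcd)
  have 2: "b = t c d a"
    using rotate[OF 1] in_A by blast
  have 3: "c = t d a b"
    using rotate[OF 2] in_A by blast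
  have 4: "d = t a b c"
    using rotate[OF 3] in_A by blast
  have rev: "a = t d c b" "b = t a d c" "c = t b a d" "d = t c b a"
    using 1 2 3 4 reverse in_A by metis+
  show ?thesis
    using crossing_corners[OF e e' center k(1), folded abcd]
    unfolding insert_iff empty_iff prod.inject corner_equation_def comp_def
    by (elim disjE conjE FalseE) (simp_all only:, (rule 1 2 3 4 rev)+)
qed

section \<open>Smooth points are not centers of crossing charts\<close>

text \<open>A pigeonhole argument: the graph has two connected sides in a thin strip around it,
  while a crossing chart shows points of different quadrants arbitrarily close to the center, and no
  side can meet two quadrants. Letting \<open>T\<close> be any convex set includes half-lines, hence
  endpoints of strands on the boundary.\<close>

lemma graph_point_not_crossing:
  assumes e: "open_embedding (UNIV \<times> T) F e" and T: "convex T" and g: "continuous_on T g" and y0: "y0 \<in> T"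
    and W: "open W" "(g y0, y0) \<in> W"
    and D: "\<And>x y. y \<in> T \<Longrightarrow> (x, y) \<in> W \<Longrightarrow> e (x, y) \<in> D \<longleftrightarrow> x = g y"
    and e': "crossing_chart F D e'" and center: "e' (0, 0) = e (g y0, y0)"
  shows False
proof -
  let ?X = "UNIV \<times> T"
  have "openin (top_of_set ?X) {z \<in> ?X. e z \<in> range e'}"
    by (rule open_embedding_preimage_openin[OF e open_embedding_openin[OF crossing_chart_embedding[OF e']]])
  then obtain V where V: "open V" "{z \<in> ?X. e z \<in> range e'} = ?X \<inter> V"
    unfolding openin_open by blast
  have "open (V \<inter> W)" "(g y0, y0) \<in> V \<inter> W"
    using V W y0 center by (auto simp: set_eq_iff intro: rangeI)
       (metis (no_types, lifting) rangeI)
  then obtain r where r: "r > 0" "ball (g y0, y0) r \<subseteq> V \<inter> W"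
    by (meson openE)
  obtain d where d: "d > 0" "\<And>y. y \<in> T \<Longrightarrow> \<bar>y - y0\<bar> < d \<Longrightarrow> \<bar>g y - g y0\<bar> < r / 4"
    using g y0 r(1) unfolding continuous_on_iff dist_real_def by (metis zero_less_divide_iff zero_less_numeral)
  \<comment> \<open>With this bound a point of the strip has both coordinates within
    \<open>r / 2\<close> of the base point, as \<open>ball_square\<close> asks: less than
    \<open>s\<close> from the graph plus less than \<open>r / 4\<close> along it.\<close>
  define s where "s = min d (r / 4)"
  have s: "s > 0" "s \<le> d" "s \<le> r / 4" using d(1) r(1) by (auto simp: s_def)
  define N where "N = {z \<in> ?X. \<bar>snd z - y0\<bar> < s \<and> \<bar>fst z - g (snd z)\<bar> < s}"
  have N: "z \<in> V \<inter> W" if z: "z \<in> N" for z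
  proof -
    obtain x y where xy: "z = (x, y)" "y \<in> T" "\<bar>y - y0\<bar> < s" "\<bar>x - g y\<bar> < s"
      using z by (cases z) (auto simp: N_def)
    then have "\<bar>x - g y0\<bar> < r / 2" "\<bar>y - y0\<bar> < r / 2"
      using d(2)[of y] s r(1) by linarith+
    then have "(x - g y0, y - y0) \<in> ball 0 r"
      by (rule ball_square)
    then have "z \<in> ball (g y0, y0) r"
      by (simp add: xy dist_norm norm_minus_commute)
    then show ?thesis using r(2) by blast
  qed
  have "openin (top_of_set ?X) N"
  proof -
    have "continuous_on ?X (\<lambda>z. (snd z - y0, fst z - g (snd z)))"
      by (intro continuous_intros continuous_on_compose2[OF g]) auto
    from continuous_openin_preimage_gen[OF this, of "{-s<..<s} \<times> {-s<..<s}"]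
    have "openin (top_of_set ?X) (?X \<inter> (\<lambda>z. (snd z - y0, fst z - g (snd z))) -` ({-s<..<s} \<times> {-s<..<s}))"
      by (simp add: open_Times)
    moreover have "?X \<inter> (\<lambda>z. (snd z - y0, fst z - g (snd z))) -` ({-s<..<s} \<times> {-s<..<s}) = N"
      unfolding N_def by (auto simp: abs_less_iff)
    ultimately show ?thesis by simp
  qed
  then have "openin F (e ` N)"
    by (rule open_embedding_image_openin[OF e])
  moreover have "e' (0, 0) \<in> e ` N"
    unfolding center using y0 s(1) by (intro imageI) (simp add: N_def)
  ultimately obtain c where c: "0 < c" "\<And>x y. \<bar>x\<bar> < c \<Longrightarrow> \<bar>y\<bar> < c \<Longrightarrow> e' (x, y) \<in> e ` N"
    using crossing_chart_neighborhood[OF e'] by blast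
  \<comment> \<open>The two sides of the graph within the strip, written as sheared rectangles so
    that their connectedness is evident.\<close>
  define H where "H = (\<lambda>b. e ` (\<lambda>(y, x). (g y + x, y)) ` ((T \<inter> {y0 - s<..<y0 + s}) \<times> (if b then {0<..<s} else {-s<..<0})))"
  have H: "connectedin F (H b)" "H b \<subseteq> range e'" "H b \<inter> D = {}" for b
  proof -
    let ?R = "(T \<inter> {y0 - s<..<y0 + s}) \<times> (if b then {0<..<s} else {-s<..<0})"
    let ?f = "\<lambda>(y, x). (g y + x, y)"
    have "connected ?R"
      using T by (intro convex_connected convex_Times convex_Int) auto
    moreover have "continuous_on ?R ?f"
      unfolding case_prod_unfold by (intro continuous_intros continuous_on_compose2[OF g]) auto
    ultimately have "connected (?f ` ?R)"
      by (rule connected_continuous_image[rotated])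
    then show "connectedin F (H b)"
      unfolding H_def by (intro open_embedding_connectedin[OF e]) auto
    have sub: "z \<in> N \<and> fst z \<noteq> g (snd z)" if "z \<in> ?f ` ?R" for z
      using that by (auto simp: N_def split: if_splits)
    have "e z \<in> range e' \<and> e z \<notin> D" if "z \<in> ?f ` ?R" for z
    proof
      have z: "z \<in> N" "fst z \<noteq> g (snd z)" using sub[OF that] by blast+
      then have "z \<in> ?X" by (simp add: N_def)
      then show "e z \<in> range e'" using N[OF z(1)] V(2) by blast
      show "e z \<notin> D"
        using D[of "snd z" "fst z"] \<open>z \<in> ?X\<close> N[OF z(1)] z(2) by auto
    qed
    then show "H b \<subseteq> range e'" "H b \<inter> D = {}"
      unfolding H_def by blast+
  qed
  have in_H: "\<exists>b. e' w \<in> H b" if w: "\<bar>fst w\<bar> = c / 2" "\<bar>snd w\<bar> = c / 2" for w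
  proof -
    have "e' w \<in> e ` N"
      using c(1) w c(2)[of "fst w" "snd w"] by simp
    then obtain x y where xy: "(x, y) \<in> N" "e' w = e (x, y)" by force
    moreover have "e' w \<notin> D"
      using crossing_chart_iff[OF e', of w] w c(1) by auto
    ultimately have "x \<noteq> g y"
      using D[of y x] N[of "(x, y)"] by (auto simp: N_def)
    then have "(x, y) = (\<lambda>(y, x). (g y + x, y)) (y, x - g y)"
      "(y, x - g y) \<in> (T \<inter> {y0 - s<..<y0 + s}) \<times> (if 0 < x - g y then {0<..<s} else {-s<..<0})"
      using xy(1) by (auto simp: N_def abs_less_iff)
    then show ?thesis
      unfolding xy(2) H_def by (intro exI[of _ "0 < x - g y"]) blast
  qed
  have sep: "\<not> (e' w \<in> H b \<and> e' w' \<in> H b)" if "0 < fst w \<and> \<not> 0 < fst w' \<or> 0 < snd w \<and> \<not> 0 < snd w'" for w w' b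
    using same_quadrant[OF e' H] that by blast
  \<comment> \<open>Three points in pairwise different quadrants, but only two sides to hold
    them.\<close>
  obtain b1 b2 b3 where "e' (c/2, c/2) \<in> H b1" "e' (c/2, -c/2) \<in> H b2" "e' (-c/2, c/2) \<in> H b3"
    using in_H[of "(c/2, c/2)"] in_H[of "(c/2, -c/2)"] in_H[of "(-c/2, c/2)"] c(1) by auto
  moreover have "b1 = b2 \<or> b1 = b3 \<or> b2 = b3" by blast
  ultimately show False
    using sep[of "(c/2, c/2)" "(c/2, -c/2)"] sep[of "(c/2, c/2)" "(-c/2, c/2)"]
      sep[of "(c/2, -c/2)" "(-c/2, c/2)"] c(1) by auto
qed

text \<open>In suitable linear coordinates on \<open>X\<close> (the plane or a half-plane), \<open>P\<close> is near \<open>z\<close> the graph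
  of a function.\<close>

definition smooth_at :: "plane set \<Rightarrow> plane set \<Rightarrow> plane \<Rightarrow> bool" where
  "smooth_at X P z \<longleftrightarrow> (\<exists>u v T g y W. det2 u v \<noteq> 0 \<and> convex T \<and> X = (\<lambda>p. fst p *\<^sub>R u + snd p *\<^sub>R v) ` (UNIV \<times> T) \<and>
     continuous_on T g \<and> y \<in> T \<and> z = g y *\<^sub>R u + y *\<^sub>R v \<and> open W \<and> z \<in> W \<and>
     (\<forall>x. \<forall>y\<in>T. x *\<^sub>R u + y *\<^sub>R v \<in> W \<longrightarrow> (x *\<^sub>R u + y *\<^sub>R v \<in> P \<longleftrightarrow> x = g y)))"

lemma open_embedding_homeomorphism:
  assumes e: "open_embedding X F e" and f: "homeomorphism Y X f f'"
  shows "open_embedding Y F (e \<circ> f)"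
proof -
  have "homeomorphic_map (top_of_set Y) (top_of_set X) f"
    using f unfolding homeomorphic_map_maps homeomorphism_def homeomorphic_maps_def
    by (intro exI[of _ f']) (auto simp: continuous_map_in_subtopology)
  then have "embedding_map (top_of_set Y) (top_of_set X) f"
    using surjective_embedding_map by blast
  moreover have "f ` Y = X"
    using f by (simp add: homeomorphism_def)
  ultimately show ?thesis
    using e embedding_map_compose by (auto simp: open_embedding_def image_comp simp del: image_image)
qed

lemma smooth_not_crossing:
  assumes e: "open_embedding X F e" and P: "{z \<in> X. e z \<in> D} = P" and z: "smooth_at X P z"
    and e': "crossing_chart F D e'" and center: "e' (0, 0) = e z"
  shows False
proof -
  obtain u v T g y W where uv: "det2 u v \<noteq> 0" and T: "convex T" "X = (\<lambda>p. fst p *\<^sub>R u + snd p *\<^sub>R v) ` (UNIV \<times> T)"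
    and g: "continuous_on T g" "y \<in> T" "z = g y *\<^sub>R u + y *\<^sub>R v"
    and W: "open W" "z \<in> W" "\<And>x y. y \<in> T \<Longrightarrow> x *\<^sub>R u + y *\<^sub>R v \<in> W \<Longrightarrow> x *\<^sub>R u + y *\<^sub>R v \<in> P \<longleftrightarrow> x = g y"
    using z unfolding smooth_at_def by blast
  let ?f = "\<lambda>p. fst p *\<^sub>R u + snd p *\<^sub>R v"
  \<comment> \<open>Cramer's rule inverts the linear map \<open>?f\<close>.\<close>
  let ?f' = "\<lambda>p. (det2 p v / det2 u v, det2 u p / det2 u v)"
  have inv: "?f' (?f p) = p" for p
  proof -
    have "det2 (?f p) v = fst p * det2 u v" "det2 u (?f p) = snd p * det2 u v"
      by (simp_all add: det2_def algebra_simps)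
    then show ?thesis using uv by simp
  qed
  have "homeomorphism (UNIV \<times> T) X ?f ?f'"
    unfolding T(2)
  proof (rule homeomorphismI)
    show "continuous_on (?f ` (UNIV \<times> T)) ?f'"
      unfolding det2_def using uv by (intro continuous_intros) (simp_all add: det2_def)
  qed (use inv in \<open>auto intro!: continuous_intros\<close>)
  then have e_f: "open_embedding (UNIV \<times> T) F (e \<circ> ?f)"
    by (rule open_embedding_homeomorphism[OF e])
  show False
  proof (rule graph_point_not_crossing[OF e_f T(1) g(1,2) _ _ _ e'])
    show "open (?f -` W)"
      using W(1) by (intro open_vimage continuous_intros)
    show "(g y, y) \<in> ?f -` W"
      using W(2) g(3) by simp
    show "(e \<circ> ?f) (x, y') \<in> D \<longleftrightarrow> x = g y'" if "y' \<in> T" "(x, y') \<in> ?f -` W" for x y'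
    proof -
      have "?f (x, y') \<in> X" unfolding T(2) using that by blast
      then show ?thesis using W(3)[of y' x] P that by auto
    qed
    show "e' (0, 0) = (e \<circ> ?f) (g y, y)"
      using center g(3) by simp
  qed
qed

section \<open>Gluing along a local picture\<close>

text \<open>A triple \<open>(z, u, v)\<close> in \<open>C\<close> stands for a crossing at \<open>z\<close> whose strands have directions \<open>u\<close> and \<open>v\<close>.\<close>

definition picture :: "plane set \<Rightarrow> plane set \<Rightarrow> (plane \<times> plane \<times> plane) set \<Rightarrow> bool" where
  "picture X P C \<longleftrightarrow> (\<forall>c\<in>C. crossing_box X P c) \<and> (\<forall>z\<in>P. smooth_at X P z \<or> z \<in> fst ` C)"

text \<open>One equation per listed box replaces the condition on all charts. Values on
  \<open>P\<close> are left free, so such colorings are compared off \<open>P\<close>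
  throughout.\<close>

definition picture_colorings ::
  "'b set \<Rightarrow> ('b \<Rightarrow> 'b \<Rightarrow> 'b \<Rightarrow> 'b) \<Rightarrow> plane set \<Rightarrow> plane set \<Rightarrow> (plane \<times> plane \<times> plane) set \<Rightarrow> (plane \<Rightarrow> 'b) set" where
  "picture_colorings A t X P C =
     {\<kappa>. (\<forall>z\<in>X - P. \<kappa> z \<in> A) \<and> locally_constant (top_of_set (X - P)) \<kappa> \<and>
         (\<forall>(z, u, v)\<in>C. corner_equation t (\<kappa> \<circ> squash_box z u v))}"

lemma point_coloring_mem: "k \<in> point_colorings F A t D \<Longrightarrow> p \<in> topspace F - D \<Longrightarrow> k p \<in> A"
  unfolding point_colorings_def by blast

lemma point_coloring_restrict:
  assumes k: "k \<in> point_colorings F A t D" and e: "open_embedding X F e" and P: "{z \<in> X. e z \<in> D} = P"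
    and C: "\<And>c. c \<in> C \<Longrightarrow> crossing_box X P c"
  shows "k \<circ> e \<in> picture_colorings A t X P C"
proof -
  have in_Y: "e z \<in> topspace F - D" if "z \<in> X - P" for z
    using that P open_embedding_topspace[OF e] by blast
  have "(k \<circ> e) z \<in> A" if "z \<in> X - P" for z
    using point_coloring_mem[OF k in_Y[OF that]] by simp
  moreover have "locally_constant (top_of_set (X - P)) (k \<circ> e)"
    unfolding locally_constant_def topspace_euclidean_subtopology
  proof
    fix z assume z: "z \<in> X - P"
    have "locally_constant (subtopology F (topspace F - D)) k"
      using k by (simp add: point_colorings_def)
    then obtain U where U: "openin (subtopology F (topspace F - D)) U" "e z \<in> U" "k constant_on U"
      using in_Y[OF z] unfolding locally_constant_def by auto
    obtain U' where U': "openin F U'" "U = U' \<inter> (topspace F - D)"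
      using U(1) unfolding openin_subtopology by blast
    obtain V where V: "open V" "{w \<in> X. e w \<in> U'} = X \<inter> V"
      using open_embedding_preimage_openin[OF e U'(1)] unfolding openin_open by blast
    let ?N = "(X - P) \<inter> V"
    have "openin (top_of_set (X - P)) ?N"
      using V(1) by (simp add: openin_open_Int)
    moreover have "z \<in> ?N"
      using z U(2) U'(2) V(2) by blast
    moreover have "e w \<in> U" if "w \<in> ?N" for w
      using that in_Y[of w] U'(2) V(2) by blast
    then have "(k \<circ> e) constant_on ?N"
      using U(3) unfolding constant_on_def by (metis comp_apply)
    ultimately show "\<exists>U. openin (top_of_set (X - P)) U \<and> z \<in> U \<and> (k \<circ> e) constant_on U"
      by blast
  qed
  moreover have "corner_equation t ((k \<circ> e) \<circ> squash_box z u v)" if "(z, u, v) \<in> C" for z u v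
    using k crossing_box_chart[OF e P C[OF that]] by (simp add: point_colorings_def comp_assoc)
  ultimately show ?thesis
    unfolding picture_colorings_def by blast
qed

lemma corner_equation_cong:
  "k (e (1, 1)) = k' (e' (1, 1)) \<Longrightarrow> k (e (-1, 1)) = k' (e' (-1, 1)) \<Longrightarrow>
   k (e (-1, -1)) = k' (e' (-1, -1)) \<Longrightarrow> k (e (1, -1)) = k' (e' (1, -1)) \<Longrightarrow>
   corner_equation t (k \<circ> e) \<longleftrightarrow> corner_equation t (k' \<circ> e')"
  by (simp add: corner_equation_def)

text \<open>\<open>K\<close> carries the change. Its image is compact, hence closed in the Hausdorff
  space \<open>F\<close>, so two open sets cover the surface: the image of the chart, and the
  complement of the image of \<open>K\<close>, on which \<open>D\<close> and \<open>D'\<close>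
  coincide.\<close>

locale local_picture = kt_ternary A t
  for A :: "'b set" and t +
  fixes F :: "'a topology" and D D' :: "'a set" and X K P Q :: "plane set" and e :: "plane \<Rightarrow> 'a"
  assumes F: "Hausdorff_space F" and D: "closedin F D" "closedin F D'"
    and e: "open_embedding X F e"
    and K: "compact K" "K \<subseteq> X" "P - K = Q - K"
    and P: "{z \<in> X. e z \<in> D} = P" and Q: "{z \<in> X. e z \<in> D'} = Q"
    and off: "D - e ` X = D' - e ` X"
begin

definition glue :: "('a \<Rightarrow> 'b) \<Rightarrow> (plane \<Rightarrow> 'b) \<Rightarrow> 'a \<Rightarrow> 'b" where
  "glue k \<kappa> = (\<lambda>p\<in>topspace F - D'. if p \<in> e ` X then \<kappa> (inv_into X e p) else k p)"

lemma glue_inside: "z \<in> X - Q \<Longrightarrow> glue k \<kappa> (e z) = \<kappa> z"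
  using Q open_embedding_topspace[OF e, of z] inv_into_f_f[OF open_embedding_inj[OF e], of z]
  by (auto simp: glue_def)

lemma glue_outside: "p \<in> topspace F - D' \<Longrightarrow> p \<notin> e ` X \<Longrightarrow> glue k \<kappa> p = k p"
  by (simp add: glue_def)

lemma unchanged_iff:
  assumes "p \<in> topspace F - e ` K"
  shows "p \<in> D \<longleftrightarrow> p \<in> D'"
proof (cases "p \<in> e ` X")
  case True
  then obtain z where z: "z \<in> X" "p = e z" by blast
  then have "z \<notin> K" using assms by blast
  then show ?thesis using z P Q K(3) by blast
next
  case False
  then show ?thesis using off by blast
qed

lemma unchanged_openin: "openin F (topspace F - e ` K)"
  using compactin_imp_closedin[OF F open_embedding_compactin[OF e K(1,2)]] by blast

lemma glue_unchanged:
  assumes "\<And>z. z \<in> X - K - Q \<Longrightarrow> \<kappa> z = k (e z)" and p: "p \<in> topspace F - D'" "p \<notin> e ` K"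
  shows "glue k \<kappa> p = k p"
proof (cases "p \<in> e ` X")
  case True
  then obtain z where z: "z \<in> X" "p = e z" by blast
  then have "z \<in> X - K - Q" using p Q by blast
  then show ?thesis using assms(1) glue_inside z by simp
qed (use glue_outside p in simp)

text \<open>Local constancy and the crossing equations are local. Off the image of \<open>K\<close>
  the glued function is \<open>k\<close> and the diagram is \<open>D\<close>; in the chart they are
  \<open>\<kappa>\<close> and \<open>Q\<close>. The hypothesis \<open>agree\<close> reconciles the
  two descriptions on the overlap.\<close>

lemma glue_coloring:
  assumes k: "k \<in> point_colorings F A t D" and \<kappa>: "\<kappa> \<in> picture_colorings A t X Q C"
    and agree: "\<And>z. z \<in> X - K - Q \<Longrightarrow> \<kappa> z = k (e z)" and pic: "picture X Q C"
  shows "glue k \<kappa> \<in> point_colorings F A t D'"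
proof -
  let ?k = "glue k \<kappa>" and ?Y = "topspace F - D'" and ?W = "topspace F - e ` K"
  note unchanged = glue_unchanged[of \<kappa> k, OF agree]
  note k_A = point_coloring_mem[OF k]
  have in_A: "?k p \<in> A" if p: "p \<in> ?Y" for p
  proof (cases "p \<in> e ` X")
    case True
    then obtain z where "z \<in> X - Q" "p = e z" using p Q by blast
    then show ?thesis using glue_inside[of z] \<kappa> by (simp add: picture_colorings_def)
  next
    case False
    then show ?thesis using p off k_A[of p] glue_outside[OF p] by auto
  qed
  have open_Y: "openin F ?Y"
    using D(2) by blast
  have lc: "locally_constant (subtopology F ?Y) ?k"
    unfolding locally_constant_def
  proof
    fix p assume "p \<in> topspace (subtopology F ?Y)"
    then have p: "p \<in> ?Y" by simp
    show "\<exists>U. openin (subtopology F ?Y) U \<and> p \<in> U \<and> ?k constant_on U"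
    proof (cases "p \<in> e ` K")
      case False
      then have "p \<in> topspace F - D" using p unchanged_iff by blast
      moreover have "locally_constant (subtopology F (topspace F - D)) k"
        using k by (simp add: point_colorings_def)
      ultimately obtain U where U: "openin (subtopology F (topspace F - D)) U" "p \<in> U" "k constant_on U"
        unfolding locally_constant_def by auto
      have "openin F (topspace F - D)" using D(1) by blast
      with U(1) have U': "openin F U" "U \<subseteq> topspace F - D"
        by (simp_all add: openin_open_subtopology)
      let ?U = "U \<inter> ?W"
      have sub: "?U \<subseteq> ?Y"
        using U'(2) unchanged_iff by blast
      then have "openin (subtopology F ?Y) ?U"
        using open_Y U'(1) unchanged_openin by (simp add: openin_open_subtopology openin_Int)
      moreover have "p \<in> ?U" using U(2) p False by blast
      moreover have "?k q = k q" if "q \<in> ?U" for q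
        using unchanged[of q] that sub by blast
      then have "?k constant_on ?U"
        using U(3) unfolding constant_on_def by (metis IntE)
      ultimately show ?thesis by blast
    next
      case True
      then obtain z where z: "z \<in> X - Q" "p = e z" using p Q K(2) by blast
      have "locally_constant (top_of_set (X - Q)) \<kappa>"
        using \<kappa> by (simp add: picture_colorings_def)
      then obtain N where N: "openin (top_of_set (X - Q)) N" "z \<in> N" "\<kappa> constant_on N"
        using z(1) unfolding locally_constant_def by auto
      have "openin (top_of_set X) {w \<in> X. e w \<in> ?Y}"
        by (rule open_embedding_preimage_openin[OF e open_Y])
      moreover have "{w \<in> X. e w \<in> ?Y} = X - Q"
        using Q open_embedding_topspace[OF e] by blast
      ultimately have "openin (top_of_set X) N"
        using N(1) openin_trans by fastforce
      then have "openin F (e ` N)"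
        by (rule open_embedding_image_openin[OF e])
      moreover have NX: "N \<subseteq> X - Q"
        using N(1) openin_imp_subset by blast
      then have "e ` N \<subseteq> ?Y"
        using Q open_embedding_topspace[OF e] by blast
      ultimately have "openin (subtopology F ?Y) (e ` N)"
        using open_Y by (simp add: openin_open_subtopology)
      moreover have "?k (e w) = \<kappa> w" if "w \<in> N" for w
        using glue_inside NX that by blast
      then have "?k constant_on e ` N"
        using N(3) unfolding constant_on_def by (metis imageE)
      ultimately show ?thesis using N(2) z(2) by blast
    qed
  qed
  have "corner_equation t (?k \<circ> e')" if e': "crossing_chart F D' e'" for e'
  proof (cases "e' (0, 0) \<in> e ` K")
    case False
    have "e' (0, 0) \<in> topspace F"
      using open_embedding_topspace[OF crossing_chart_embedding[OF e']] by simp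
    with False have W: "e' (0, 0) \<in> ?W" by blast
    have "D' \<inter> ?W = D \<inter> ?W" using unchanged_iff by blast
    from crossing_chart_localize[OF e' unchanged_openin W this]
    obtain d where d: "0 < d" "crossing_chart F D (e' \<circ> squash_box 0 (d, 0) (0, d))"
      "\<And>p. e' (squash_box 0 (d, 0) (0, d) p) \<in> ?W" by blast
    let ?e = "squash_box 0 (d, 0) (0, d)"
    \<comment> \<open>Shrinking a chart moves each of the four samples within its quadrant, so the
      corner colors are unchanged.\<close>
    have "k (e' (?e q)) = ?k (e' q)" if q: "q \<in> {(1, 1), (-1, 1), (-1, -1), (1, -1)}" for q
    proof -
      have "fst (?e q) \<noteq> 0" "snd (?e q) \<noteq> 0" "0 < fst (?e q) * fst q" "0 < snd (?e q) * snd q"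
        using q d(1) by (auto simp: squash_box_def)
      then have "?k (e' (?e q)) = ?k (e' q)" "e' (?e q) \<in> ?Y"
        using locally_constant_quadrant[OF lc e'] crossing_chart_complement[OF e'] by auto
      then show ?thesis using unchanged d(3)[of q] by auto
    qed
    moreover have "corner_equation t (k \<circ> (e' \<circ> ?e))"
      using k d(2) by (simp add: point_colorings_def)
    ultimately show ?thesis
      using corner_equation_cong[of k "e' \<circ> ?e" ?k e' t] by simp
  next
    case True
    then obtain z where z: "z \<in> X" "e' (0, 0) = e z" using K(2) by blast
    \<comment> \<open>The center lies on \<open>Q\<close> and cannot be a smooth point, so it is a
      listed crossing, whose box provides a chart to compare \<open>e'\<close> with.\<close>
    have "e' (0, 0) \<in> D'" using crossing_chart_iff[OF e'] by simp
    then have "z \<in> Q" using z Q by auto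
    moreover have "\<not> smooth_at X Q z"
      using smooth_not_crossing[OF e Q _ e' z(2)] by blast
    ultimately obtain u v where uv: "(z, u, v) \<in> C"
      using pic unfolding picture_def by force
    then have box: "crossing_box X Q (z, u, v)"
      using pic by (simp add: picture_def)
    note chart = crossing_box_chart[OF e Q box]
    have "?k (e (squash_box z u v q)) = \<kappa> (squash_box z u v q)" if "fst q \<noteq> 0" "snd q \<noteq> 0" for q
    proof (rule glue_inside)
      show "squash_box z u v q \<in> X - Q"
        using box that squash_bound[of "fst q"] squash_bound[of "snd q"]
        by (simp add: crossing_box_def squash_box_def)
    qed
    moreover have "corner_equation t (\<kappa> \<circ> squash_box z u v)"
      using \<kappa> uv by (auto simp: picture_colorings_def)
    ultimately have "corner_equation t (?k \<circ> (e \<circ> squash_box z u v))"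
      using corner_equation_cong[of ?k "e \<circ> squash_box z u v" \<kappa> "squash_box z u v" t] by simp
    then show ?thesis
      using z(2) in_A by (intro corner_equation_chart[OF chart e' _ lc]) (simp_all add: squash_box_simps)
  qed
  moreover have "?k \<in> ?Y \<rightarrow>\<^sub>E A"
    using in_A by (auto simp: glue_def)
  ultimately show ?thesis
    using lc by (simp add: point_colorings_def)
qed

text \<open>Gluing a chosen partner \<open>ext k\<close> into \<open>k\<close> is injective: the
  result still shows \<open>k\<close> off the image of \<open>K\<close>, and \<open>uniq\<close>
  recovers the rest. On the source side boxes suffice, since restriction merely reads off their
  equations; the target has to be a full \<open>picture\<close>, since gluing must check every
  crossing chart.\<close>

lemma lepoll:
  assumes C: "\<And>c. c \<in> C \<Longrightarrow> crossing_box X P c" and pic: "picture X Q C'"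
    and ex: "\<And>\<kappa>. \<kappa> \<in> picture_colorings A t X P C \<Longrightarrow>
      \<exists>\<kappa>'\<in>picture_colorings A t X Q C'. \<forall>z\<in>X - K - Q. \<kappa>' z = \<kappa> z"
    and uniq: "\<And>\<kappa> \<kappa>' z. \<kappa> \<in> picture_colorings A t X P C \<Longrightarrow> \<kappa>' \<in> picture_colorings A t X P C \<Longrightarrow>
      (\<And>z. z \<in> X - K - P \<Longrightarrow> \<kappa> z = \<kappa>' z) \<Longrightarrow> z \<in> X - P \<Longrightarrow> \<kappa> z = \<kappa>' z"
  shows "point_colorings F A t D \<lesssim> point_colorings F A t D'"
proof -
  let ?R = "\<lambda>k. k \<circ> e"
  have R: "?R k \<in> picture_colorings A t X P C" if "k \<in> point_colorings F A t D" for k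
    using point_coloring_restrict[OF that e P C] .
  define ext where "ext k = (SOME \<kappa>. \<kappa> \<in> picture_colorings A t X Q C' \<and> (\<forall>z\<in>X - K - Q. \<kappa> z = k (e z)))" for k
  have ext: "ext k \<in> picture_colorings A t X Q C'" "\<And>z. z \<in> X - K - Q \<Longrightarrow> ext k z = k (e z)"
    if k: "k \<in> point_colorings F A t D" for k
  proof -
    have "\<exists>\<kappa>. \<kappa> \<in> picture_colorings A t X Q C' \<and> (\<forall>z\<in>X - K - Q. \<kappa> z = k (e z))"
      using ex[OF R[OF k]] by auto
    from someI_ex[OF this] show "ext k \<in> picture_colorings A t X Q C'"
      "\<And>z. z \<in> X - K - Q \<Longrightarrow> ext k z = k (e z)"
      unfolding ext_def by blast+
  qed
  have "inj_on (\<lambda>k. glue k (ext k)) (point_colorings F A t D)"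
  proof (rule inj_onI)
    fix k k' assume k: "k \<in> point_colorings F A t D" and k': "k' \<in> point_colorings F A t D"
      and eq: "glue k (ext k) = glue k' (ext k')"
    have same: "k p = k' p" if p: "p \<in> topspace F - D" "p \<notin> e ` K" for p
    proof -
      have "p \<in> topspace F - D'" using p unchanged_iff by blast
      then show ?thesis
        using glue_unchanged[of "ext k" k, OF ext(2)[OF k]] glue_unchanged[of "ext k'" k', OF ext(2)[OF k']] eq p
        by metis
    qed
    show "k = k'"
    proof (rule PiE_ext[of k "topspace F - D" "\<lambda>_. A" k'])
      fix p assume p: "p \<in> topspace F - D"
      show "k p = k' p"
      proof (cases "p \<in> e ` X")
        case True
        then obtain z where z: "z \<in> X - P" "p = e z" using p P by blast
        have "?R k w = ?R k' w" if "w \<in> X - K - P" for w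
        proof -
          have w: "w \<in> X" "w \<notin> K" "w \<notin> P" using that by auto
          have "e w \<notin> e ` K"
            using w open_embedding_eq[OF e w(1)] K(2) by blast
          then show ?thesis
            using same[of "e w"] w P open_embedding_topspace[OF e w(1)] by auto
        qed
        then show ?thesis
          using uniq[OF R[OF k] R[OF k'] _ z(1)] z(2) by simp
      next
        case False
        then show ?thesis using same p K(2) by blast
      qed
    qed (use k k' in \<open>simp_all add: point_colorings_def\<close>)
  qed
  moreover have "glue k (ext k) \<in> point_colorings F A t D'" if "k \<in> point_colorings F A t D" for k
    using glue_coloring[OF that ext[OF that] pic] .
  ultimately show ?thesis
    unfolding lepoll_def by blast
qed

end

section \<open>Plane pictures\<close>

text \<open>In the pictures below a few axis-parallel segments join any point of a region to a fixed
  sample point, and that such a segment avoids \<open>P\<close> is a statement about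
  inequalities.\<close>

lemma locally_constant_vertical:
  fixes \<kappa> :: "plane \<Rightarrow> 'b"
  assumes "locally_constant (top_of_set (X - P)) \<kappa>"
    and "\<And>s. y \<le> s \<and> s \<le> y' \<or> y' \<le> s \<and> s \<le> y \<Longrightarrow> (x, s) \<in> X \<and> (x, s) \<notin> P"
  shows "\<kappa> (x, y) = \<kappa> (x, y')"
proof (rule locally_constant_connectedin[OF assms(1)])
  have "connected ({x} \<times> closed_segment y y')"
    by (intro connected_Times) auto
  then show "connectedin (top_of_set (X - P)) ({x} \<times> closed_segment y y')"
    using assms(2) by (auto simp: connectedin_subtopology closed_segment_eq_real_ivl split: if_splits)
qed auto

lemma locally_constant_horizontal:
  fixes \<kappa> :: "plane \<Rightarrow> 'b"
  assumes "locally_constant (top_of_set (X - P)) \<kappa>"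
    and "\<And>s. x \<le> s \<and> s \<le> x' \<or> x' \<le> s \<and> s \<le> x \<Longrightarrow> (s, y) \<in> X \<and> (s, y) \<notin> P"
  shows "\<kappa> (x, y) = \<kappa> (x', y)"
proof (rule locally_constant_connectedin[OF assms(1)])
  have "connected (closed_segment x x' \<times> {y})"
    by (intro connected_Times) auto
  then show "connectedin (top_of_set (X - P)) (closed_segment x x' \<times> {y})"
    using assms(2) by (auto simp: connectedin_subtopology closed_segment_eq_real_ivl split: if_splits)
qed auto

lemma locally_constant_const: "locally_constant T (\<lambda>_. c)"
  unfolding locally_constant_def constant_on_def by (auto intro: openin_topspace)

text \<open>Off \<open>P\<close> a strict inequality \<open>U\<close> and its strict opposite
  \<open>V\<close> are complementary, and both are open. Nested applications yield the piecewise
  constant colorings of the pictures.\<close>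

lemma locally_constant_if:
  assumes "open {z. U z}" "open {z. V z}"
    and cover: "\<And>z. z \<in> X \<Longrightarrow> z \<notin> P \<Longrightarrow> \<not> U z \<longleftrightarrow> V z"
    and f: "locally_constant (top_of_set (X - P)) f" and g: "locally_constant (top_of_set (X - P)) g"
  shows "locally_constant (top_of_set (X - P)) (\<lambda>z. if U z then f z else g z)"
  unfolding locally_constant_def topspace_euclidean_subtopology
proof
  have piece: "\<exists>N. openin (top_of_set (X - P)) N \<and> z \<in> N \<and> (\<lambda>z. if U z then f z else g z) constant_on N"
    if W: "open {z. W z}" "W z" "z \<in> X - P" "locally_constant (top_of_set (X - P)) h"
      and eq: "\<And>w. w \<in> X - P \<Longrightarrow> W w \<Longrightarrow> (if U w then f w else g w) = h w" for W z h
  proof -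
    obtain N where N: "openin (top_of_set (X - P)) N" "z \<in> N" "h constant_on N"
      using W(3,4) unfolding locally_constant_def by auto
    have "openin (top_of_set (X - P)) (N \<inter> {z. W z})"
      using N(1) W(1) by (rule openin_Int_open)
    moreover have "N \<subseteq> X - P"
      using N(1) openin_imp_subset by blast
    then have "(if U w then f w else g w) = h w" if "w \<in> N \<inter> {z. W z}" for w
      using eq[of w] that by blast
    then have "(\<lambda>z. if U z then f z else g z) constant_on N \<inter> {z. W z}"
      using N(3) unfolding constant_on_def by (metis IntE)
    ultimately show ?thesis using N(2) W(2) by blast
  qed
  fix z assume z: "z \<in> X - P"
  show "\<exists>N. openin (top_of_set (X - P)) N \<and> z \<in> N \<and> (\<lambda>z. if U z then f z else g z) constant_on N"
  proof (cases "U z")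
    case True
    show ?thesis by (rule piece[of U, OF assms(1) True z f]) simp
  next
    case False
    then have "V z" using cover z by blast
    show ?thesis by (rule piece[of V, OF assms(2) \<open>V z\<close> z g]) (use cover in auto)
  qed
qed

section \<open>Criteria for smooth points and for crossing boxes\<close>

lemma det2_surj:
  assumes "det2 u v \<noteq> 0"
  shows "(\<lambda>p. fst p *\<^sub>R u + snd p *\<^sub>R v) ` (UNIV \<times> UNIV) = UNIV"
proof -
  have "p \<in> (\<lambda>p. fst p *\<^sub>R u + snd p *\<^sub>R v) ` (UNIV \<times> UNIV)" for p
  proof (rule image_eqI)
    show "p = fst (det2 p v / det2 u v, det2 u p / det2 u v) *\<^sub>R u + snd (det2 p v / det2 u v, det2 u p / det2 u v) *\<^sub>R v"
    proof (rule prod_eqI)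
      have "fst p * det2 u v = det2 p v * fst u + det2 u p * fst v" "snd p * det2 u v = det2 p v * snd u + det2 u p * snd v"
        by (simp_all add: det2_def algebra_simps)
      then show "fst p = fst (fst (det2 p v / det2 u v, det2 u p / det2 u v) *\<^sub>R u + snd (det2 p v / det2 u v, det2 u p / det2 u v) *\<^sub>R v)"
        "snd p = snd (fst (det2 p v / det2 u v, det2 u p / det2 u v) *\<^sub>R u + snd (det2 p v / det2 u v, det2 u p / det2 u v) *\<^sub>R v)"
        using assms by (simp_all add: add_divide_distrib[symmetric] eq_divide_eq)
    qed
  qed simp
  then show ?thesis by blast
qed

lemma smooth_graph_coordinates:
  assumes "det2 u v \<noteq> 0" "continuous_on UNIV g" "open W" "z \<in> W" "z = g y *\<^sub>R u + y *\<^sub>R v"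
    and "\<And>x y. x *\<^sub>R u + y *\<^sub>R v \<in> W \<Longrightarrow> x *\<^sub>R u + y *\<^sub>R v \<in> P \<longleftrightarrow> x = g y"
  shows "smooth_at UNIV P z"
  unfolding smooth_at_def
  by (intro exI[of _ u] exI[of _ v] exI[of _ UNIV] exI[of _ g] exI[of _ y] exI[of _ W])
     (use assms det2_surj in auto)

lemma smooth_graph:
  assumes "continuous_on UNIV g" "open W" "(x, g x) \<in> W"
    and "\<And>x y. (x, y) \<in> W \<Longrightarrow> (x, y) \<in> P \<longleftrightarrow> y = g x"
  shows "smooth_at UNIV P (x, g x)"
  \<comment> \<open>\<open>smooth_at\<close> wants the first coordinate as a function of the second,
    so the basis vectors are swapped.\<close>
  by (rule smooth_graph_coordinates[of "(0, 1)" "(1, 0)" g W _ x])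
     (use assms in \<open>simp_all add: det2_def\<close>)

text \<open>The complement of the remaining part \<open>R\<close> of the picture serves as the
  neighborhood.\<close>

lemma smooth_graph_off:
  assumes "continuous_on UNIV g" "closed R" "P = {(x, y). y = g x} \<union> R" "(x, y) \<notin> R" "y = g x"
  shows "smooth_at UNIV P (x, y)"
  using smooth_graph[of g "- R" x P] assms by auto

text \<open>Along diagonal strands the box becomes the diamond
  \<open>\<bar>a\<bar> + \<bar>b\<bar> < 2 * h\<close> about \<open>(x, y)\<close>, and the four
  corner samples are the points at distance \<open>h\<close> above, left of, below and right of the
  crossing.\<close>

definition diagonal_crossing :: "real \<Rightarrow> real \<Rightarrow> real \<Rightarrow> plane \<times> plane \<times> plane" where
  "diagonal_crossing x y h = ((x, y), (h, h), (- h, h))"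

lemma diagonal_crossing_box:
  assumes "0 < h"
    and "\<And>a b. \<bar>a\<bar> + \<bar>b\<bar> < 2 * h \<Longrightarrow> (x + a, y + b) \<in> X \<and> ((x + a, y + b) \<in> P \<longleftrightarrow> \<bar>a\<bar> = \<bar>b\<bar>)"
  shows "crossing_box X P (diagonal_crossing x y h)"
proof -
  have "(x, y) + s *\<^sub>R (h, h) + r *\<^sub>R (- h, h) \<in> X \<and>
        ((x, y) + s *\<^sub>R (h, h) + r *\<^sub>R (- h, h) \<in> P \<longleftrightarrow> s = 0 \<or> r = 0)"
    if "\<bar>s\<bar> < 1" "\<bar>r\<bar> < 1" for s r
  proof -
    have "\<bar>h * c\<bar> = h * \<bar>c\<bar>" for c
      using assms(1) by (simp add: abs_mult)
    \<comment> \<open>In the diamond \<open>\<bar>s - r\<bar> + \<bar>s + r\<bar>\<close> is twice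
      the larger of \<open>\<bar>s\<bar>\<close> and \<open>\<bar>r\<bar>\<close>, hence below
      2.\<close>
    then have "\<bar>h * (s - r)\<bar> + \<bar>h * (s + r)\<bar> = h * (\<bar>s - r\<bar> + \<bar>s + r\<bar>)"
      unfolding distrib_left[of h "\<bar>s - r\<bar>"] by metis
    also have "\<dots> < h * 2"
      using that assms(1) by (intro mult_strict_left_mono) auto
    finally have "\<bar>h * (s - r)\<bar> + \<bar>h * (s + r)\<bar> < 2 * h" by simp
    moreover have "\<bar>h * (s - r)\<bar> = \<bar>h * (s + r)\<bar> \<longleftrightarrow> s = 0 \<or> r = 0"
      using assms(1) by (auto simp: abs_mult)
    moreover have "(x, y) + s *\<^sub>R (h, h) + r *\<^sub>R (- h, h) = (x + h * (s - r), y + h * (s + r))"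
      by (simp add: algebra_simps)
    ultimately show ?thesis using assms(2) by metis
  qed
  moreover have "h * h \<noteq> - (h * h)" using assms(1) by (simp add: eq_neg_iff_add_eq_0)
  ultimately show ?thesis
    unfolding diagonal_crossing_def crossing_box_def by (simp add: det2_def)
qed

lemma corner_equation_diagonal:
  assumes "(z, u, v) = diagonal_crossing x y h"
  shows "corner_equation t (\<kappa> \<circ> squash_box z u v) \<longleftrightarrow>
    \<kappa> (x, y + h) = t (\<kappa> (x - h, y)) (\<kappa> (x, y - h)) (\<kappa> (x + h, y))"
  using assms by (simp add: diagonal_crossing_def corner_equation_def squash_box_simps add.commute)

lemma picture_coloringsD:
  assumes "\<kappa> \<in> picture_colorings A t X P C"
  shows "locally_constant (top_of_set (X - P)) \<kappa>" "\<And>z. z \<in> X \<Longrightarrow> z \<notin> P \<Longrightarrow> \<kappa> z \<in> A"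
    "\<And>z u v. (z, u, v) \<in> C \<Longrightarrow> corner_equation t (\<kappa> \<circ> squash_box z u v)"
  using assms unfolding picture_colorings_def by auto

text \<open>Large enough to contain all differences between the two pictures of each move. The outer
  sample points used below have a coordinate 9 or -9 and so lie outside it.\<close>

definition big_square :: "plane set" where
  "big_square = {-4..4} \<times> {-4..4}"

lemma compact_big_square: "compact big_square"
  by (simp add: big_square_def compact_Times)

lemma graph_closed:
  fixes g :: "real \<Rightarrow> real"
  assumes "continuous_on UNIV g"
  shows "closed {(x, y). y = g x}"
proof -
  have "continuous_on UNIV (\<lambda>z :: plane. g (fst z))"
    using continuous_on_compose2[OF assms continuous_on_fst[OF continuous_on_id]] by simp
  then show ?thesis
    unfolding case_prod_unfold by (intro closed_Collect_eq continuous_intros)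
qed

section \<open>Move (I)\<close>

definition R1_crossings :: "(plane \<times> plane \<times> plane) set" where
  "R1_crossings = {diagonal_crossing 0 1 (1/2)}"

lemma R1_before_picture: "picture UNIV R1_before {}"
proof -
  have "smooth_at UNIV R1_before (x, y)" if "(x, y) \<in> R1_before" for x y
    using that by (intro smooth_graph_off[of "\<lambda>_. 0" "{}"]) (auto simp: R1_before_def)
  then show ?thesis by (auto simp: picture_def)
qed

lemma R1_after_picture: "picture UNIV R1_after R1_crossings"
proof -
  let ?R = "{(x :: real, y :: real). \<bar>x\<bar> \<le> 1 \<and> (y = 1 + \<bar>x\<bar> \<or> y = 2)}"
  have "crossing_box UNIV R1_after (diagonal_crossing 0 1 (1/2))"
  proof (rule diagonal_crossing_box)
    show "(0 + a, 1 + b) \<in> UNIV \<and> ((0 + a, 1 + b) \<in> R1_after \<longleftrightarrow> \<bar>a\<bar> = \<bar>b\<bar>)"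
      if "\<bar>a\<bar> + \<bar>b\<bar> < 2 * (1/2)" for a b :: real
      using that by (auto simp: R1_after_def max_def abs_if split: if_splits)
  qed simp
  moreover have "smooth_at UNIV R1_after (x, y)" if xy: "(x, y) \<in> R1_after" "(x, y) \<noteq> (0, 1)" for x y
  proof -
    have "y = max 0 (1 - \<bar>x\<bar>) \<and> x \<noteq> 0 \<or> y = 1 + \<bar>x\<bar> \<and> \<bar>x\<bar> < 1 \<and> x \<noteq> 0 \<or> y = 2 \<and> \<bar>x\<bar> < 1 \<or>
        (x, y) = (1, 2) \<or> (x, y) = (-1, 2)"
      using xy by (auto simp: R1_after_def)
    then consider "y = max 0 (1 - \<bar>x\<bar>)" "x \<noteq> 0" | "y = 1 + \<bar>x\<bar>" "\<bar>x\<bar> < 1" "x \<noteq> 0" | "y = 2" "\<bar>x\<bar> < 1"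
      | "(x, y) = (1, 2)" | "(x, y) = (-1, 2)"
      by blast
    then show ?thesis
    proof cases
      case 1
      have "?R = {z. \<bar>fst z\<bar> \<le> 1} \<inter> ({z. snd z = 1 + \<bar>fst z\<bar>} \<union> {z. snd z = 2})"
        by auto
      moreover have "closed ({z :: plane. \<bar>fst z\<bar> \<le> 1} \<inter> ({z. snd z = 1 + \<bar>fst z\<bar>} \<union> {z. snd z = 2}))"
        by (intro closed_Int closed_Un closed_Collect_eq closed_Collect_le continuous_intros)
      ultimately have "closed ?R" by simp
      moreover have "(x, y) \<notin> ?R"
        using 1 by auto
      ultimately show ?thesis
        using 1(1) by (intro smooth_graph_off[of "\<lambda>x. max 0 (1 - \<bar>x\<bar>)" ?R] continuous_intros)
          (simp_all add: R1_after_def)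
    next
      case 2
      show ?thesis unfolding 2(1)
      proof (rule smooth_graph)
        show "open ({-1<..<1} \<times> {1<..<2} :: plane set)" by (simp add: open_Times)
      qed (use 2 in \<open>auto simp: R1_after_def max_def intro!: continuous_intros\<close>)
    next
      case 3
      show ?thesis unfolding 3(1)
      proof (rule smooth_graph[where g = "\<lambda>_. 2"])
        have "open ({z :: plane. \<bar>fst z\<bar> < 1} \<inter> {z. 1 + \<bar>fst z\<bar> < snd z})"
          by (intro open_Int open_Collect_less continuous_intros)
        then show "open {z :: plane. \<bar>fst z\<bar> < 1 \<and> 1 + \<bar>fst z\<bar> < snd z}"
          by (simp add: Collect_conj_eq)
      qed (use 3 in \<open>auto simp: R1_after_def max_def\<close>)
    next
      case 4
      show ?thesis unfolding 4
      \<comment> \<open>At the upper right corner of the kink neither standard coordinate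
        parametrizes the strand, but abscissa minus twice the ordinate increases along the top edge
        up to the corner and on down the slanted edge. In terms of it, with value -3 at the corner,
        the strand is a graph with peak 1; the other corner is the mirror image.\<close>
      proof (rule smooth_graph_coordinates[of "(1, 1/2)" "(0, -1/2)" "\<lambda>a. 1 - \<bar>a + 3\<bar>" "{0<..} \<times> {1<..}" _ "-3"])
        show "x *\<^sub>R (1, 1/2) + y *\<^sub>R (0, -1/2) \<in> R1_after \<longleftrightarrow> x = 1 - \<bar>y + 3\<bar>"
          if "x *\<^sub>R (1, 1/2) + y *\<^sub>R (0, -1/2) \<in> ({0<..} \<times> {1<..} :: plane set)" for x y :: real
        proof -
          have eq: "x *\<^sub>R (1, 1/2) + y *\<^sub>R (0, -1/2) = (x, x / 2 - y / 2)" by simp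
          have "0 < x" "1 < x / 2 - y / 2"
            using that unfolding eq by auto
          then show ?thesis
            unfolding eq
            by (auto simp: R1_after_def max_def abs_if add_divide_distrib diff_divide_distrib split: if_splits)
        qed
      qed (auto simp: det2_def open_Times intro!: continuous_intros)
    next
      case 5
      show ?thesis unfolding 5
      proof (rule smooth_graph_coordinates[of "(-1, 1/2)" "(0, -1/2)" "\<lambda>a. 1 - \<bar>a + 3\<bar>" "{..<0} \<times> {1<..}" _ "-3"])
        show "x *\<^sub>R (-1, 1/2) + y *\<^sub>R (0, -1/2) \<in> R1_after \<longleftrightarrow> x = 1 - \<bar>y + 3\<bar>"
          if "x *\<^sub>R (-1, 1/2) + y *\<^sub>R (0, -1/2) \<in> ({..<0} \<times> {1<..} :: plane set)" for x y :: real
        proof -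
          have eq: "x *\<^sub>R (-1, 1/2) + y *\<^sub>R (0, -1/2) = (- x, x / 2 - y / 2)" by simp
          have "0 < x" "1 < x / 2 - y / 2"
            using that unfolding eq by auto
          then show ?thesis
            unfolding eq
            by (auto simp: R1_after_def max_def abs_if add_divide_distrib diff_divide_distrib split: if_splits)
        qed
      qed (auto simp: det2_def open_Times intro!: continuous_intros)
    qed
  qed
  ultimately show ?thesis
    by (auto simp: picture_def R1_crossings_def diagonal_crossing_def)
qed

context kt_ternary
begin

abbreviation "pcol X P C \<equiv> picture_colorings A t X P C"

lemma pcol_diagonal:
  assumes "\<kappa> \<in> pcol X P C" "diagonal_crossing x y h \<in> C"
  shows "\<kappa> (x, y + h) = t (\<kappa> (x - h, y)) (\<kappa> (x, y - h)) (\<kappa> (x + h, y))"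
  using picture_coloringsD(3)[OF assms(1), of "(x, y)" "(h, h)" "(- h, h)"] assms(2)
    corner_equation_diagonal[of "(x, y)" "(h, h)" "(- h, h)" x y h t \<kappa>]
  by (simp only: diagonal_crossing_def)

lemma pcolI:
  assumes "\<And>z. z \<in> X \<Longrightarrow> z \<notin> P \<Longrightarrow> \<kappa> z \<in> A" "locally_constant (top_of_set (X - P)) \<kappa>"
    and "\<And>z u v. (z, u, v) \<in> C \<Longrightarrow> corner_equation t (\<kappa> \<circ> squash_box z u v)"
  shows "\<kappa> \<in> pcol X P C"
  using assms unfolding picture_colorings_def by blast

lemma pcol_mem: "\<kappa> \<in> pcol X P C \<Longrightarrow> z \<in> X \<Longrightarrow> z \<notin> P \<Longrightarrow> \<kappa> z \<in> A"
  by (rule picture_coloringsD(2))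

lemmas pcol_vertical = locally_constant_vertical[OF picture_coloringsD(1)]
lemmas pcol_horizontal = locally_constant_horizontal[OF picture_coloringsD(1)]

lemma R1_before_regions:
  assumes "\<kappa> \<in> pcol UNIV R1_before C"
  shows "y < 0 \<Longrightarrow> \<kappa> (x, y) = \<kappa> (0, -9)" and "0 < y \<Longrightarrow> \<kappa> (x, y) = \<kappa> (0, 9)"
proof -
  show "\<kappa> (x, y) = \<kappa> (0, -9)" if "y < 0"
    using that pcol_horizontal[OF assms, of x 0 y] pcol_vertical[OF assms, of y "-9" 0]
    by (force simp: R1_before_def)
  show "\<kappa> (x, y) = \<kappa> (0, 9)" if "0 < y"
    using that pcol_horizontal[OF assms, of x 0 y] pcol_vertical[OF assms, of y 9 0]
    by (force simp: R1_before_def)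
qed

lemma R1_extend:
  assumes \<kappa>: "\<kappa> \<in> pcol UNIV R1_before {}"
  shows "\<exists>\<kappa>'\<in>pcol UNIV R1_after R1_crossings. \<forall>z\<in>UNIV - big_square - R1_after. \<kappa>' z = \<kappa> z"
proof -
  define U L where "U = \<kappa> (0, 9)" and "L = \<kappa> (0, -9)"
  have UL: "U \<in> A" "L \<in> A"
    using pcol_mem[OF \<kappa>] by (auto simp: U_def L_def R1_before_def)
  \<comment> \<open>The crossing at \<open>(0, 1)\<close> has \<open>U\<close> on both sides and
    \<open>L\<close> below, which forces \<open>t U L U\<close> on the loop above it.\<close>
  define \<kappa>' where "\<kappa>' = (\<lambda>z :: plane. if 1 + \<bar>fst z\<bar> < snd z \<and> snd z < 2 then t U L U
    else if snd z < max 0 (1 - \<bar>fst z\<bar>) then L else U)"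
  have "\<kappa>' \<in> pcol UNIV R1_after R1_crossings"
  proof (rule pcolI)
    show "locally_constant (top_of_set (UNIV - R1_after)) \<kappa>'"
      unfolding \<kappa>'_def
    proof (rule locally_constant_if[where V = "\<lambda>z. snd z < 1 + \<bar>fst z\<bar> \<or> 2 < snd z"])
      show "(\<not> (1 + \<bar>fst z\<bar> < snd z \<and> snd z < 2)) = (snd z < 1 + \<bar>fst z\<bar> \<or> 2 < snd z)"
        if "z \<notin> R1_after" for z
        using that by (cases z) (auto simp: R1_after_def)
      show "locally_constant (top_of_set (UNIV - R1_after)) (\<lambda>z. if snd z < max 0 (1 - \<bar>fst z\<bar>) then L else U)"
      proof (rule locally_constant_if[where V = "\<lambda>z. max 0 (1 - \<bar>fst z\<bar>) < snd z"])
        show "(\<not> snd z < max 0 (1 - \<bar>fst z\<bar>)) = (max 0 (1 - \<bar>fst z\<bar>) < snd z)"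
          if "z \<notin> R1_after" for z
          using that by (cases z) (auto simp: R1_after_def)
      qed (intro open_Collect_less continuous_intros locally_constant_const)+
    qed (intro open_Collect_conj open_Collect_disj open_Collect_less continuous_intros locally_constant_const)+
    show "corner_equation t (\<kappa>' \<circ> squash_box z u v)" if "(z, u, v) \<in> R1_crossings" for z u v
      using that corner_equation_diagonal[of z u v 0 1 "1/2" t \<kappa>']
      by (simp add: R1_crossings_def \<kappa>'_def)
  qed (use UL in \<open>auto simp: \<kappa>'_def\<close>)
  moreover have "\<kappa>' (x, y) = \<kappa> (x, y)" if "(x, y) \<notin> big_square" "(x, y) \<notin> R1_after" for x y
  proof -
    have "\<not> (1 + \<bar>x\<bar> < y \<and> y < 2)" "y < max 0 (1 - \<bar>x\<bar>) \<longleftrightarrow> y < 0" "y \<noteq> 0"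
      using that by (auto simp: big_square_def R1_after_def max_def abs_if split: if_splits)
    then show ?thesis
      using R1_before_regions[OF \<kappa>, of y x] by (cases "y < 0") (auto simp: \<kappa>'_def U_def L_def)
  qed
  ultimately show ?thesis
    by (intro bexI[of _ \<kappa>']) auto
qed

lemma R1_restrict:
  assumes \<kappa>: "\<kappa> \<in> pcol UNIV R1_after R1_crossings"
  shows "\<exists>\<kappa>'\<in>pcol UNIV R1_before {}. \<forall>z\<in>UNIV - big_square - R1_before. \<kappa>' z = \<kappa> z"
proof -
  define \<kappa>' where "\<kappa>' = (\<lambda>z :: plane. if snd z < 0 then \<kappa> (0, -9) else \<kappa> (0, 9))"
  have "\<kappa>' \<in> pcol UNIV R1_before {}"
  proof (rule pcolI)
    show "locally_constant (top_of_set (UNIV - R1_before)) \<kappa>'"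
      unfolding \<kappa>'_def
    proof (intro locally_constant_if[where V = "\<lambda>z. 0 < snd z"] locally_constant_const)
      show "(\<not> snd z < 0) = (0 < snd z)" if "z \<notin> R1_before" for z
        using that by (cases z) (auto simp: R1_before_def)
    qed (intro open_Collect_less continuous_intros)+
    show "\<kappa>' z \<in> A" for z
      using pcol_mem[OF \<kappa>, of "(0, -9)"] pcol_mem[OF \<kappa>, of "(0, 9)"] by (simp add: \<kappa>'_def R1_after_def)
  qed simp
  moreover have "\<kappa>' (x, y) = \<kappa> (x, y)" if "(x, y) \<notin> big_square" "(x, y) \<notin> R1_before" for x y
  proof -
    have xy: "4 < \<bar>x\<bar> \<or> 4 < \<bar>y\<bar>" "y \<noteq> 0"
      using that by (auto simp: big_square_def R1_before_def)
    show ?thesis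
    proof (cases "y < 0")
      case True
      have "\<kappa> (x, y) = \<kappa> (x, -9)"
        using True by (intro pcol_vertical[OF \<kappa>]) (auto simp: R1_after_def)
      also have "\<dots> = \<kappa> (0, -9)"
        by (intro pcol_horizontal[OF \<kappa>]) (auto simp: R1_after_def)
      finally show ?thesis using True by (simp add: \<kappa>'_def)
    next
      case False
      have "\<kappa> (x, y) = \<kappa> (x, 9)"
        using xy False by (intro pcol_vertical[OF \<kappa>]) (auto simp: R1_after_def)
      also have "\<dots> = \<kappa> (0, 9)"
        by (intro pcol_horizontal[OF \<kappa>]) (auto simp: R1_after_def)
      finally show ?thesis using False by (simp add: \<kappa>'_def)
    qed
  qed
  ultimately show ?thesis
    by (intro bexI[of _ \<kappa>']) auto
qed

text \<open>The segment carries agreement from a point outside the square to a point inside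
  it.\<close>

lemma agree_vertical:
  assumes "\<kappa> \<in> pcol X P C" "\<kappa>' \<in> pcol X P C" "\<And>z. z \<in> X - big_square - P \<Longrightarrow> \<kappa> z = \<kappa>' z"
    and "(x, y') \<notin> big_square" "\<And>s. y \<le> s \<and> s \<le> y' \<or> y' \<le> s \<and> s \<le> y \<Longrightarrow> (x, s) \<in> X \<and> (x, s) \<notin> P"
  shows "\<kappa> (x, y) = \<kappa>' (x, y)"
  using pcol_vertical[OF assms(1,5)] pcol_vertical[OF assms(2,5)] assms(3)[of "(x, y')"] assms(4) assms(5)[of y']
  by force

lemma agree_horizontal:
  assumes "\<kappa> \<in> pcol X P C" "\<kappa>' \<in> pcol X P C" "\<And>z. z \<in> X - big_square - P \<Longrightarrow> \<kappa> z = \<kappa>' z"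
    and "(x', y) \<notin> big_square" "\<And>s. x \<le> s \<and> s \<le> x' \<or> x' \<le> s \<and> s \<le> x \<Longrightarrow> (s, y) \<in> X \<and> (s, y) \<notin> P"
  shows "\<kappa> (x, y) = \<kappa>' (x, y)"
  using pcol_horizontal[OF assms(1,5)] pcol_horizontal[OF assms(2,5)] assms(3)[of "(x', y)"] assms(4) assms(5)[of x']
  by force

lemma R1_before_unique:
  assumes "\<kappa> \<in> pcol UNIV R1_before {}" "\<kappa>' \<in> pcol UNIV R1_before {}"
    and "\<And>z. z \<in> UNIV - big_square - R1_before \<Longrightarrow> \<kappa> z = \<kappa>' z" "z \<in> UNIV - R1_before"
  shows "\<kappa> z = \<kappa>' z"
proof -
  obtain x y where z: "z = (x, y)" by (cases z)
  show ?thesis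
  proof (cases "y < 0")
    case True
    then show ?thesis
      unfolding z by (intro agree_vertical[OF assms(1-3), where y' = "-9"]) (auto simp: big_square_def R1_before_def)
  next
    case False
    then show ?thesis using assms(4)
      unfolding z by (intro agree_vertical[OF assms(1-3), where y' = 9]) (auto simp: big_square_def R1_before_def)
  qed
qed

text \<open>Every region but the loop reaches beyond the square along a segment; the crossing
  expresses the color of the loop by three of the others.\<close>

lemma R1_after_unique:
  assumes \<kappa>: "\<kappa> \<in> pcol UNIV R1_after R1_crossings" "\<kappa>' \<in> pcol UNIV R1_after R1_crossings"
    and agree: "\<And>z. z \<in> UNIV - big_square - R1_after \<Longrightarrow> \<kappa> z = \<kappa>' z" and z: "z \<in> UNIV - R1_after"
  shows "\<kappa> z = \<kappa>' z"
proof -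
  note vert = agree_vertical[OF \<kappa> agree] and hori = agree_horizontal[OF \<kappa> agree]
  have below: "\<kappa> (x, y) = \<kappa>' (x, y)" if "y < max 0 (1 - \<bar>x\<bar>)" for x y
    using that by (intro vert[where y' = "-9"]) (auto simp: big_square_def R1_after_def)
  have above: "\<kappa> (x, y) = \<kappa>' (x, y)" if "2 < y" for x y
    using that by (intro vert[where y' = 9]) (auto simp: big_square_def R1_after_def)
  have right: "\<kappa> (x, y) = \<kappa>' (x, y)" if "max 0 (1 - \<bar>x\<bar>) < y" "y < 1 + \<bar>x\<bar>" "y \<le> 2" "0 < x" "(x, y) \<notin> R1_after" for x y
    using that by (intro hori[where x' = 9]) (auto simp: big_square_def R1_after_def)
  have left: "\<kappa> (x, y) = \<kappa>' (x, y)" if "max 0 (1 - \<bar>x\<bar>) < y" "y < 1 + \<bar>x\<bar>" "y \<le> 2" "x < 0" "(x, y) \<notin> R1_after" for x y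
    using that by (intro hori[where x' = "-9"]) (auto simp: big_square_def R1_after_def)
  have loop: "\<mu> (x, y) = t (\<mu> (-(1/2), 1)) (\<mu> (0, 1/2)) (\<mu> (1/2, 1))"
    if "1 + \<bar>x\<bar> < y" "y < 2" "\<mu> \<in> pcol UNIV R1_after R1_crossings" for x y \<mu>
  proof -
    have "\<mu> (x, y) = \<mu> (0, y)"
      using that by (intro pcol_horizontal[OF that(3)]) (auto simp: R1_after_def)
    also have "\<dots> = \<mu> (0, 3/2)"
      using that by (intro pcol_vertical[OF that(3)]) (auto simp: R1_after_def)
    finally show ?thesis
      using pcol_diagonal[OF that(3), of 0 1 "1/2"] by (simp add: R1_crossings_def)
  qed
  obtain x y where xy: "z = (x, y)" by (cases z)
  have "y < max 0 (1 - \<bar>x\<bar>) \<or> 2 < y \<or> max 0 (1 - \<bar>x\<bar>) < y \<and> y < 1 + \<bar>x\<bar> \<and> y \<le> 2 \<and> (0 < x \<or> x < 0) \<or>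
      1 + \<bar>x\<bar> < y \<and> y < 2"
    using z xy by (auto simp: R1_after_def)
  moreover have "\<kappa> (-(1/2), 1) = \<kappa>' (-(1/2), 1)" "\<kappa> (0, 1/2) = \<kappa>' (0, 1/2)" "\<kappa> (1/2, 1) = \<kappa>' (1/2, 1)"
    by (intro left below right; simp add: R1_after_def)+
  ultimately show ?thesis
    using below above right[of x y] left[of x y] loop[of x y \<kappa>] loop[of x y \<kappa>'] \<kappa> z xy by auto
qed

end

section \<open>Move (II) and the boundary exchange\<close>

text \<open>One strand is horizontal, the other has slope -1 or 1, so the boxes are slanted. The
  factor 1/2 keeps them within \<open>0 < \<bar>x\<bar> < 2\<close>, where the pushed strand is
  straight. The second box is the mirror image of the first, so both equations list upper region,
  bigon, lower region and side strip in this order.\<close>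

definition R2_crossings :: "(plane \<times> plane \<times> plane) set" where
  "R2_crossings = {((1, 1), (1/2, 0), (-1/2, 1/2)), ((-1, 1), (-1/2, 0), (1/2, 1/2))}"

lemma R2_before_picture: "picture UNIV R2_before {}"
proof -
  have "smooth_at UNIV R2_before (x, y)" if "(x, y) \<in> R2_before" for x y
  proof (cases "y = 0")
    case True
    then show ?thesis
      by (intro smooth_graph_off[of "\<lambda>_. 0" "{(x, y). y = 1}"] graph_closed) (auto simp: R2_before_def)
  next
    case False
    then show ?thesis using that
      by (intro smooth_graph_off[of "\<lambda>_. 1" "{(x, y). y = 0}"] graph_closed) (auto simp: R2_before_def)
  qed
  then show ?thesis by (auto simp: picture_def)
qed

lemma R2_after_picture: "picture UNIV R2_after R2_crossings"
proof -
  let ?g = "\<lambda>x :: real. max 0 (2 - \<bar>x\<bar>)"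
  have g: "continuous_on UNIV ?g"
    by (intro continuous_intros)
  have right: "crossing_box UNIV R2_after ((1, 1), (1/2, 0), (-1/2, 1/2))"
  proof -
    have "(1, 1) + s *\<^sub>R (1/2, 0) + r *\<^sub>R (-1/2, 1/2) \<in> R2_after \<longleftrightarrow> s = 0 \<or> r = 0"
      if "\<bar>s\<bar> < 1" "\<bar>r\<bar> < 1" for s r :: real
    proof -
      have "(1, 1) + s *\<^sub>R (1/2, 0) + r *\<^sub>R (-1/2, 1/2) = (1 + (s - r) / 2, 1 + r / 2)"
        by (simp add: diff_divide_distrib)
      moreover have "0 < 1 + (s - r) / 2" "0 < 2 - (1 + (s - r) / 2)"
        using that by (simp_all add: abs_less_iff field_simps)
      then have "?g (1 + (s - r) / 2) = 1 - (s - r) / 2"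
        by simp
      ultimately show ?thesis
        by (auto simp: R2_after_def diff_divide_distrib)
    qed
    then show ?thesis by (simp add: crossing_box_def det2_def)
  qed
  have left: "crossing_box UNIV R2_after ((-1, 1), (-1/2, 0), (1/2, 1/2))"
  proof -
    have "(-1, 1) + s *\<^sub>R (-1/2, 0) + r *\<^sub>R (1/2, 1/2) \<in> R2_after \<longleftrightarrow> s = 0 \<or> r = 0"
      if "\<bar>s\<bar> < 1" "\<bar>r\<bar> < 1" for s r :: real
    proof -
      have "(-1, 1) + s *\<^sub>R (-1/2, 0) + r *\<^sub>R (1/2, 1/2) = (- (1 + (s - r) / 2), 1 + r / 2)"
        by (simp add: diff_divide_distrib)
      moreover have "0 < 1 + (s - r) / 2" "0 < 2 - (1 + (s - r) / 2)"
        using that by (simp_all add: abs_less_iff field_simps)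
      then have "?g (- (1 + (s - r) / 2)) = 1 - (s - r) / 2"
        unfolding abs_minus_cancel by simp
      ultimately show ?thesis
        by (auto simp: R2_after_def diff_divide_distrib)
    qed
    then show ?thesis by (simp add: crossing_box_def det2_def)
  qed
  have "smooth_at UNIV R2_after (x, y)" if xy: "(x, y) \<in> R2_after" "(x, y) \<noteq> (1, 1)" "(x, y) \<noteq> (-1, 1)" for x y
  proof (cases "y = 1")
    case True
    then show ?thesis using xy
      by (intro smooth_graph_off[of "\<lambda>_. 1" "{(x, y). y = ?g x}"] graph_closed[OF g])
        (auto simp: R2_after_def max_def abs_if split: if_splits)
  next
    case False
    then show ?thesis using xy
      by (intro smooth_graph_off[of ?g "{(x, y). y = 1}"] graph_closed g) (auto simp: R2_after_def)
  qed
  then show ?thesis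
    using left right by (auto simp: picture_def R2_crossings_def)
qed

section \<open>Pictures of the boundary exchange\<close>

definition boundary_crossings :: "(plane \<times> plane \<times> plane) set" where
  "boundary_crossings = {diagonal_crossing 0 1 (1/2)}"

text \<open>Strands ending on the boundary are graphs over the half-line \<open>{0..}\<close> of
  heights, so their endpoints are treated like the other points.\<close>

lemma smooth_half_plane:
  assumes g: "continuous_on UNIV g" and "closed R" "P = {(x, y). 0 \<le> y \<and> x = g y} \<union> R" "(x, y) \<notin> R" "x = g y" "0 \<le> y"
  shows "smooth_at half_plane P (x, y)"
proof -
  have "half_plane = (\<lambda>p. fst p *\<^sub>R (1, 0) + snd p *\<^sub>R (0, 1)) ` (UNIV \<times> {0..})"
  proof -
    have "(\<lambda>p :: plane. fst p *\<^sub>R (1 :: real, 0 :: real) + snd p *\<^sub>R (0, 1)) = id"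
      by (auto simp: prod_eq_iff)
    then show ?thesis by (auto simp: half_plane_def)
  qed
  moreover have "continuous_on {0..} g"
    using g continuous_on_subset by blast
  ultimately show ?thesis
    unfolding smooth_at_def
    by (intro exI[of _ "(1, 0)"] exI[of _ "(0, 1)"] exI[of _ "{0..}"] exI[of _ g] exI[of _ y] exI[of _ "- R"])
       (use assms in \<open>auto simp: det2_def\<close>)
qed

lemma half_graph_closed:
  fixes g :: "real \<Rightarrow> real"
  assumes "continuous_on UNIV g"
  shows "closed {(x, y). 0 \<le> y \<and> x = g y}"
proof -
  have "continuous_on UNIV (\<lambda>z :: plane. g (snd z))"
    using continuous_on_compose2[OF assms continuous_on_snd[OF continuous_on_id]] by simp
  then show ?thesis
    unfolding case_prod_unfold Collect_conj_eq by (intro closed_Int closed_Collect_le closed_Collect_eq continuous_intros)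
qed

lemma boundary_before_picture: "picture half_plane boundary_before {}"
proof -
  have "smooth_at half_plane boundary_before (x, y)" if "(x, y) \<in> boundary_before" for x y
  proof (cases "x = 1")
    case True
    then show ?thesis using that
      by (intro smooth_half_plane[of "\<lambda>_. 1" "{(x, y). 0 \<le> y \<and> x = -1}"] half_graph_closed)
        (auto simp: boundary_before_def)
  next
    case False
    then show ?thesis using that
      by (intro smooth_half_plane[of "\<lambda>_. -1" "{(x, y). 0 \<le> y \<and> x = 1}"] half_graph_closed)
        (auto simp: boundary_before_def)
  qed
  then show ?thesis by (auto simp: picture_def)
qed

text \<open>The picture is divided into its right and left envelopes rather than into the two
  strands: both envelopes are graphs over the height, and they meet only at the crossing
  \<open>(0, 1)\<close>.\<close>

lemma boundary_after_picture: "picture half_plane boundary_after boundary_crossings"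
proof -
  let ?g = "\<lambda>y :: real. min 1 \<bar>y - 1\<bar>"
  have g: "continuous_on UNIV ?g" "continuous_on UNIV (\<lambda>y. - ?g y)"
    by (intro continuous_intros)+
  have graphs: "boundary_after = {(x, y). 0 \<le> y \<and> x = ?g y} \<union> {(x, y). 0 \<le> y \<and> x = - ?g y}"
    by (auto simp: boundary_after_def abs_eq_iff')
  have "crossing_box half_plane boundary_after (diagonal_crossing 0 1 (1/2))"
  proof (rule diagonal_crossing_box)
    show "(0 + a, 1 + b) \<in> half_plane \<and> ((0 + a, 1 + b) \<in> boundary_after \<longleftrightarrow> \<bar>a\<bar> = \<bar>b\<bar>)"
      if "\<bar>a\<bar> + \<bar>b\<bar> < 2 * (1/2)" for a b :: real
    proof -
      have "0 \<le> 1 + b" "min 1 \<bar>b\<bar> = \<bar>b\<bar>" using that by linarith+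
      then show ?thesis by (simp add: boundary_after_def half_plane_def)
    qed
  qed simp
  moreover have "smooth_at half_plane boundary_after (x, y)" if xy: "(x, y) \<in> boundary_after" "(x, y) \<noteq> (0, 1)" for x y
  proof (cases "x = ?g y")
    case True
    have "(x, y) \<notin> {(x, y). 0 \<le> y \<and> x = - ?g y}" using xy(2) True by auto
    then show ?thesis using xy(1) True
      by (intro smooth_half_plane[OF g(1) half_graph_closed[OF g(2)] graphs]) (simp_all add: boundary_after_def)
  next
    case False
    then show ?thesis using xy(1)
      by (intro smooth_half_plane[OF g(2) half_graph_closed[OF g(1)] trans[OF graphs Un_commute]])
        (auto simp: boundary_after_def abs_eq_iff')
  qed
  ultimately show ?thesis
    by (auto simp: picture_def boundary_crossings_def diagonal_crossing_def)
qed

context kt_ternary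
begin

lemma R2_before_regions:
  assumes \<kappa>: "\<kappa> \<in> pcol UNIV R2_before C"
  shows "y < 0 \<Longrightarrow> \<kappa> (x, y) = \<kappa> (0, -9)" and "1 < y \<Longrightarrow> \<kappa> (x, y) = \<kappa> (0, 9)"
    and "0 < y \<Longrightarrow> y < 1 \<Longrightarrow> \<kappa> (x, y) = \<kappa> (9, 1/2)"
proof -
  show "\<kappa> (x, y) = \<kappa> (0, -9)" if "y < 0"
    using that pcol_horizontal[OF \<kappa>, of x 0 y] pcol_vertical[OF \<kappa>, of y "-9" 0]
    by (force simp: R2_before_def)
  show "\<kappa> (x, y) = \<kappa> (0, 9)" if "1 < y"
    using that pcol_horizontal[OF \<kappa>, of x 0 y] pcol_vertical[OF \<kappa>, of y 9 0]
    by (force simp: R2_before_def)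
  show "\<kappa> (x, y) = \<kappa> (9, 1/2)" if "0 < y" "y < 1"
    using that pcol_horizontal[OF \<kappa>, of x 9 y] pcol_vertical[OF \<kappa>, of y "1/2" 9]
    by (force simp: R2_before_def)
qed

lemma R2_after_regions:
  assumes \<kappa>: "\<kappa> \<in> pcol UNIV R2_after C"
  shows "y < max 0 (2 - \<bar>x\<bar>) \<Longrightarrow> y < 1 \<Longrightarrow> \<kappa> (x, y) = \<kappa> (0, -9)"
    and "max 0 (2 - \<bar>x\<bar>) < y \<Longrightarrow> 1 < y \<Longrightarrow> \<kappa> (x, y) = \<kappa> (0, 9)"
    and "max 0 (2 - \<bar>x\<bar>) < y \<Longrightarrow> y < 1 \<Longrightarrow> 0 < x \<Longrightarrow> \<kappa> (x, y) = \<kappa> (9, 1/2)"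
    and "max 0 (2 - \<bar>x\<bar>) < y \<Longrightarrow> y < 1 \<Longrightarrow> x < 0 \<Longrightarrow> \<kappa> (x, y) = \<kappa> (-9, 1/2)"
    and "y < max 0 (2 - \<bar>x\<bar>) \<Longrightarrow> 1 < y \<Longrightarrow> \<kappa> (x, y) = \<kappa> (0, 3/2)"
proof -
  note vert = pcol_vertical[OF \<kappa>] and hori = pcol_horizontal[OF \<kappa>]
  show "\<kappa> (x, y) = \<kappa> (0, -9)" if "y < max 0 (2 - \<bar>x\<bar>)" "y < 1"
  proof -
    have "\<kappa> (x, y) = \<kappa> (x, min y (-9))"
      using that by (intro vert) (auto simp: R2_after_def)
    also have "\<dots> = \<kappa> (0, min y (-9))"
      by (intro hori) (auto simp: R2_after_def)
    also have "\<dots> = \<kappa> (0, -9)"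
      by (intro vert) (auto simp: R2_after_def)
    finally show ?thesis .
  qed
  show "\<kappa> (x, y) = \<kappa> (0, 9)" if "max 0 (2 - \<bar>x\<bar>) < y" "1 < y"
  proof -
    have "\<kappa> (x, y) = \<kappa> (x, max y 9)"
      using that by (intro vert) (auto simp: R2_after_def)
    also have "\<dots> = \<kappa> (0, max y 9)"
      by (intro hori) (auto simp: R2_after_def)
    also have "\<dots> = \<kappa> (0, 9)"
      by (intro vert) (auto simp: R2_after_def)
    finally show ?thesis .
  qed
  show "\<kappa> (x, y) = \<kappa> (9, 1/2)" if "max 0 (2 - \<bar>x\<bar>) < y" "y < 1" "0 < x"
  proof -
    have "\<kappa> (x, y) = \<kappa> (9, y)"
      using that by (intro hori) (auto simp: R2_after_def)
    also have "\<dots> = \<kappa> (9, 1/2)"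
      using that by (intro vert) (auto simp: R2_after_def)
    finally show ?thesis .
  qed
  show "\<kappa> (x, y) = \<kappa> (-9, 1/2)" if "max 0 (2 - \<bar>x\<bar>) < y" "y < 1" "x < 0"
  proof -
    have "\<kappa> (x, y) = \<kappa> (-9, y)"
      using that by (intro hori) (auto simp: R2_after_def)
    also have "\<dots> = \<kappa> (-9, 1/2)"
      using that by (intro vert) (auto simp: R2_after_def)
    finally show ?thesis .
  qed
  show "\<kappa> (x, y) = \<kappa> (0, 3/2)" if "y < max 0 (2 - \<bar>x\<bar>)" "1 < y"
  proof -
    have "\<kappa> (x, y) = \<kappa> (0, y)"
      using that by (intro hori) (auto simp: R2_after_def)
    also have "\<dots> = \<kappa> (0, 3/2)"
      using that by (intro vert) (auto simp: R2_after_def)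
    finally show ?thesis .
  qed
qed

lemma R2_corners:
  assumes \<kappa>: "\<kappa> \<in> pcol UNIV R2_after R2_crossings"
  shows "\<kappa> (0, 9) = t (\<kappa> (0, 3/2)) (\<kappa> (0, -9)) (\<kappa> (9, 1/2))"
    and "\<kappa> (0, 9) = t (\<kappa> (0, 3/2)) (\<kappa> (0, -9)) (\<kappa> (-9, 1/2))"
proof -
  have "\<kappa> (1, 5/4) = t (\<kappa> (1/2, 5/4)) (\<kappa> (1, 3/4)) (\<kappa> (3/2, 3/4))"
    using picture_coloringsD(3)[OF \<kappa>, of "(1, 1)" "(1/2, 0)" "(-1/2, 1/2)"]
    by (simp add: R2_crossings_def corner_equation_def squash_box_simps)
  then show "\<kappa> (0, 9) = t (\<kappa> (0, 3/2)) (\<kappa> (0, -9)) (\<kappa> (9, 1/2))"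
    using R2_after_regions(2)[OF \<kappa>, of 1 "5/4"] R2_after_regions(5)[OF \<kappa>, of "5/4" "1/2"]
      R2_after_regions(1)[OF \<kappa>, of "3/4" 1] R2_after_regions(3)[OF \<kappa>, of "3/2" "3/4"] by simp
  have "\<kappa> (-1, 5/4) = t (\<kappa> (-1/2, 5/4)) (\<kappa> (-1, 3/4)) (\<kappa> (-3/2, 3/4))"
    using picture_coloringsD(3)[OF \<kappa>, of "(-1, 1)" "(-1/2, 0)" "(1/2, 1/2)"]
    by (simp add: R2_crossings_def corner_equation_def squash_box_simps)
  then show "\<kappa> (0, 9) = t (\<kappa> (0, 3/2)) (\<kappa> (0, -9)) (\<kappa> (-9, 1/2))"
    using R2_after_regions(2)[OF \<kappa>, of "-1" "5/4"] R2_after_regions(5)[OF \<kappa>, of "5/4" "-1/2"]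
      R2_after_regions(1)[OF \<kappa>, of "3/4" "-1"] R2_after_regions(4)[OF \<kappa>, of "-3/2" "3/4"] by simp
qed

lemma R2_extend:
  assumes \<kappa>: "\<kappa> \<in> pcol UNIV R2_before {}"
  shows "\<exists>\<kappa>'\<in>pcol UNIV R2_after R2_crossings. \<forall>z\<in>UNIV - big_square - R2_after. \<kappa>' z = \<kappa> z"
proof -
  define T M B where "T = \<kappa> (0, 9)" and "M = \<kappa> (9, 1/2)" and "B = \<kappa> (0, -9)"
  have in_A: "T \<in> A" "M \<in> A" "B \<in> A"
    using pcol_mem[OF \<kappa>] by (auto simp: T_def M_def B_def R2_before_def)
  let ?g = "\<lambda>z :: plane. max 0 (2 - \<bar>fst z\<bar>)"
  \<comment> \<open>The bigon color solved from one crossing. The other crossing has the same colors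
    around it, because \<open>M\<close> lies on both sides of the bigon.\<close>
  define G where "G = t B M T"
  have eq: "T = t G B M"
    using rotate[OF rotate[OF rotate[OF G_def]]] in_A by (simp add: G_def)
  define \<kappa>' where "\<kappa>' = (\<lambda>z. if ?g z < snd z then (if snd z < 1 then M else T) else (if snd z < 1 then B else G))"
  have "\<kappa>' \<in> pcol UNIV R2_after R2_crossings"
  proof (rule pcolI)
    have low: "locally_constant (top_of_set (UNIV - R2_after)) (\<lambda>z. if snd z < 1 then a else b)" for a b :: 'b
    proof (rule locally_constant_if[where V = "\<lambda>z. 1 < snd z"])
      show "(\<not> snd z < 1) = (1 < snd z)" if "z \<notin> R2_after" for z
        using that by (cases z) (auto simp: R2_after_def)
    qed (intro open_Collect_less continuous_intros locally_constant_const)+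
    show "locally_constant (top_of_set (UNIV - R2_after)) \<kappa>'"
      unfolding \<kappa>'_def
    proof (rule locally_constant_if[where V = "\<lambda>z. snd z < ?g z"])
      show "(\<not> ?g z < snd z) = (snd z < ?g z)" if "z \<notin> R2_after" for z
        using that by (cases z) (auto simp: R2_after_def)
    qed (intro open_Collect_less continuous_intros low)+
    show "corner_equation t (\<kappa>' \<circ> squash_box z u v)" if "(z, u, v) \<in> R2_crossings" for z u v
      using that unfolding R2_crossings_def insert_iff empty_iff prod.inject
      by (elim disjE conjE FalseE)
         (simp_all add: corner_equation_def squash_box_simps \<kappa>'_def eq[symmetric])
  qed (use in_A in \<open>auto simp: \<kappa>'_def G_def\<close>)
  moreover have "\<kappa>' (x, y) = \<kappa> (x, y)" if "(x, y) \<notin> big_square" "(x, y) \<notin> R2_after" for x y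
  proof -
    have "max 0 (2 - \<bar>x\<bar>) < y \<longleftrightarrow> 0 < y" "y \<noteq> 0" "y \<noteq> 1"
      using that by (auto simp: big_square_def R2_after_def max_def abs_if split: if_splits)
    then show ?thesis
      using R2_before_regions[OF \<kappa>, of y x] by (auto simp: \<kappa>'_def T_def M_def B_def)
  qed
  ultimately show ?thesis
    by (intro bexI[of _ \<kappa>']) auto
qed

text \<open>After the move the strip is in two parts. The two crossings share the colors of the
  other three corners, so cancellation gives both parts the same color and the strip can be
  restored.\<close>

lemma R2_restrict:
  assumes \<kappa>: "\<kappa> \<in> pcol UNIV R2_after R2_crossings"
  shows "\<exists>\<kappa>'\<in>pcol UNIV R2_before {}. \<forall>z\<in>UNIV - big_square - R2_before. \<kappa>' z = \<kappa> z"
proof -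
  define T M B where "T = \<kappa> (0, 9)" and "M = \<kappa> (9, 1/2)" and "B = \<kappa> (0, -9)"
  have in_A: "T \<in> A" "M \<in> A" "B \<in> A" "\<kappa> (0, 3/2) \<in> A" "\<kappa> (-9, 1/2) \<in> A"
    using pcol_mem[OF \<kappa>] by (auto simp: T_def M_def B_def R2_after_def)
  have M: "\<kappa> (-9, 1/2) = M"
    using R2_corners[OF \<kappa>] in_A left_cancel[of "\<kappa> (0, 3/2)" B M "\<kappa> (-9, 1/2)"] by (simp add: M_def B_def)
  define \<kappa>' where "\<kappa>' = (\<lambda>z :: plane. if snd z < 0 then B else if snd z < 1 then M else T)"
  have "\<kappa>' \<in> pcol UNIV R2_before {}"
  proof (rule pcolI)
    show "locally_constant (top_of_set (UNIV - R2_before)) \<kappa>'"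
      unfolding \<kappa>'_def
    proof (rule locally_constant_if[where V = "\<lambda>z. 0 < snd z"])
      show "(\<not> snd z < 0) = (0 < snd z)" if "z \<notin> R2_before" for z
        using that by (cases z) (auto simp: R2_before_def)
      show "locally_constant (top_of_set (UNIV - R2_before)) (\<lambda>z. if snd z < 1 then M else T)"
      proof (rule locally_constant_if[where V = "\<lambda>z. 1 < snd z"])
        show "(\<not> snd z < 1) = (1 < snd z)" if "z \<notin> R2_before" for z
          using that by (cases z) (auto simp: R2_before_def)
      qed (intro open_Collect_less continuous_intros locally_constant_const)+
    qed (intro open_Collect_less continuous_intros locally_constant_const)+
  qed (use in_A in \<open>auto simp: \<kappa>'_def\<close>)
  moreover have "\<kappa>' (x, y) = \<kappa> (x, y)" if "(x, y) \<notin> big_square" "(x, y) \<notin> R2_before" for x y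
  proof -
    \<comment> \<open>Outside the square the pushed part of the strand is out of reach: points of
      the strip there have \<open>4 < \<bar>x\<bar>\<close>, and higher points lie above it.\<close>
    have *: "0 < y \<longleftrightarrow> max 0 (2 - \<bar>x\<bar>) < y" "y \<noteq> 0" "y \<noteq> 1" "0 < y \<and> y < 1 \<longrightarrow> 4 < \<bar>x\<bar>"
      using that by (auto simp: big_square_def R2_before_def max_def abs_if split: if_splits)
    have g: "max 0 (2 - \<bar>x\<bar>) < y" if "0 < y"
      using *(1) that by blast
    have "y < 0 \<or> 0 < y \<and> y < 1 \<and> 0 < x \<or> 0 < y \<and> y < 1 \<and> x < 0 \<or> 1 < y"
      using *(2-4) by linarith
    then consider "y < 0" | "0 < y" "y < 1" "0 < x" | "0 < y" "y < 1" "x < 0" | "1 < y"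
      by blast
    then show ?thesis
    proof cases
      case 1
      then show ?thesis
        using R2_after_regions(1)[OF \<kappa>, of y x] by (simp add: \<kappa>'_def B_def)
    next
      case 2
      then show ?thesis
        using R2_after_regions(3)[OF \<kappa> g] by (simp add: \<kappa>'_def M_def)
    next
      case 3
      then show ?thesis
        using R2_after_regions(4)[OF \<kappa> g] M by (simp add: \<kappa>'_def)
    next
      case 4
      then show ?thesis
        using R2_after_regions(2)[OF \<kappa> g] by (simp add: \<kappa>'_def T_def)
    qed
  qed
  ultimately show ?thesis
    by (intro bexI[of _ \<kappa>']) auto
qed

lemma R2_before_unique:
  assumes "\<kappa> \<in> pcol UNIV R2_before {}" "\<kappa>' \<in> pcol UNIV R2_before {}"
    and agree: "\<And>z. z \<in> UNIV - big_square - R2_before \<Longrightarrow> \<kappa> z = \<kappa>' z" and z: "z \<in> UNIV - R2_before"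
  shows "\<kappa> z = \<kappa>' z"
proof -
  obtain x y where xy: "z = (x, y)" by (cases z)
  have "y < 0 \<or> 0 < y \<and> y < 1 \<or> 1 < y"
    using z xy by (auto simp: R2_before_def)
  moreover have "\<kappa> (0, -9) = \<kappa>' (0, -9)" "\<kappa> (0, 9) = \<kappa>' (0, 9)" "\<kappa> (9, 1/2) = \<kappa>' (9, 1/2)"
    by (rule agree; simp add: big_square_def R2_before_def)+
  ultimately show ?thesis
    using R2_before_regions[OF assms(1), where x = x and y = y] R2_before_regions[OF assms(2), where x = x and y = y] xy by auto
qed

lemma R2_after_unique:
  assumes \<kappa>: "\<kappa> \<in> pcol UNIV R2_after R2_crossings" "\<kappa>' \<in> pcol UNIV R2_after R2_crossings"
    and agree: "\<And>z. z \<in> UNIV - big_square - R2_after \<Longrightarrow> \<kappa> z = \<kappa>' z" and z: "z \<in> UNIV - R2_after"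
  shows "\<kappa> z = \<kappa>' z"
proof -
  obtain x y where xy: "z = (x, y)" by (cases z)
  have cases: "max 0 (2 - \<bar>x\<bar>) < y \<and> 1 < y \<or> max 0 (2 - \<bar>x\<bar>) < y \<and> y < 1 \<and> 0 < x \<or>
      max 0 (2 - \<bar>x\<bar>) < y \<and> y < 1 \<and> x < 0 \<or> y < max 0 (2 - \<bar>x\<bar>) \<and> y < 1 \<or> y < max 0 (2 - \<bar>x\<bar>) \<and> 1 < y"
    using z xy by (auto simp: R2_after_def)
  have outer: "\<kappa> (0, -9) = \<kappa>' (0, -9)" "\<kappa> (0, 9) = \<kappa>' (0, 9)" "\<kappa> (9, 1/2) = \<kappa>' (9, 1/2)" "\<kappa> (-9, 1/2) = \<kappa>' (-9, 1/2)"
    by (rule agree; simp add: big_square_def R2_after_def)+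
  have bigon: "\<mu> (0, 3/2) = t (\<mu> (0, -9)) (\<mu> (9, 1/2)) (\<mu> (0, 9))" if "\<mu> \<in> pcol UNIV R2_after R2_crossings" for \<mu>
    using rotate[OF R2_corners(1)[OF that]] pcol_mem[OF that] by (simp add: R2_after_def)
  have "\<kappa> (0, 3/2) = \<kappa>' (0, 3/2)"
    unfolding bigon[OF \<kappa>(1)] bigon[OF \<kappa>(2)] using outer by simp
  with cases outer show ?thesis
    using R2_after_regions[OF \<kappa>(1), where x = x and y = y] R2_after_regions[OF \<kappa>(2), where x = x and y = y] xy by auto
qed

section \<open>Colorings at the boundary exchange\<close>

lemma boundary_before_regions:
  assumes \<kappa>: "\<kappa> \<in> pcol half_plane boundary_before C" and y: "0 \<le> y"
  shows "x < -1 \<Longrightarrow> \<kappa> (x, y) = \<kappa> (-9, 9)" and "1 < x \<Longrightarrow> \<kappa> (x, y) = \<kappa> (9, 9)"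
    and "-1 < x \<Longrightarrow> x < 1 \<Longrightarrow> \<kappa> (x, y) = \<kappa> (0, 9)"
proof -
  show "\<kappa> (x, y) = \<kappa> (-9, 9)" if "x < -1"
    using that y pcol_vertical[OF \<kappa>, of y 9 x] pcol_horizontal[OF \<kappa>, of x "-9" 9]
    by (force simp: boundary_before_def half_plane_def)
  show "\<kappa> (x, y) = \<kappa> (9, 9)" if "1 < x"
    using that y pcol_vertical[OF \<kappa>, of y 9 x] pcol_horizontal[OF \<kappa>, of x 9 9]
    by (force simp: boundary_before_def half_plane_def)
  show "\<kappa> (x, y) = \<kappa> (0, 9)" if "-1 < x" "x < 1"
    using that y pcol_vertical[OF \<kappa>, of y 9 x] pcol_horizontal[OF \<kappa>, of x 0 9]
    by (force simp: boundary_before_def half_plane_def)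
qed

lemma boundary_after_regions:
  assumes \<kappa>: "\<kappa> \<in> pcol half_plane boundary_after C" and y: "0 \<le> y"
  shows "x < - min 1 \<bar>y - 1\<bar> \<Longrightarrow> \<kappa> (x, y) = \<kappa> (-9, 9)" and "min 1 \<bar>y - 1\<bar> < x \<Longrightarrow> \<kappa> (x, y) = \<kappa> (9, 9)"
    and "\<bar>x\<bar> < min 1 \<bar>y - 1\<bar> \<Longrightarrow> 1 < y \<Longrightarrow> \<kappa> (x, y) = \<kappa> (0, 9)"
    and "\<bar>x\<bar> < min 1 \<bar>y - 1\<bar> \<Longrightarrow> y < 1 \<Longrightarrow> \<kappa> (x, y) = \<kappa> (0, 1/2)"
proof -
  note vert = pcol_vertical[OF \<kappa>] and hori = pcol_horizontal[OF \<kappa>]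
  show "\<kappa> (x, y) = \<kappa> (-9, 9)" if "x < - min 1 \<bar>y - 1\<bar>"
  proof -
    have "\<kappa> (x, y) = \<kappa> (min x (-9), y)"
      using that y by (intro hori) (auto simp: boundary_after_def half_plane_def)
    also have "\<dots> = \<kappa> (min x (-9), 9)"
      using y by (intro vert) (auto simp: boundary_after_def half_plane_def)
    also have "\<dots> = \<kappa> (-9, 9)"
      by (intro hori) (auto simp: boundary_after_def half_plane_def)
    finally show ?thesis .
  qed
  show "\<kappa> (x, y) = \<kappa> (9, 9)" if "min 1 \<bar>y - 1\<bar> < x"
  proof -
    have "\<kappa> (x, y) = \<kappa> (max x 9, y)"
      using that y by (intro hori) (auto simp: boundary_after_def half_plane_def)
    also have "\<dots> = \<kappa> (max x 9, 9)"
      using y by (intro vert) (auto simp: boundary_after_def half_plane_def)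
    also have "\<dots> = \<kappa> (9, 9)"
      by (intro hori) (auto simp: boundary_after_def half_plane_def)
    finally show ?thesis .
  qed
  show "\<kappa> (x, y) = \<kappa> (0, 9)" if "\<bar>x\<bar> < min 1 \<bar>y - 1\<bar>" "1 < y"
  proof -
    have "\<kappa> (x, y) = \<kappa> (0, y)"
      using that y by (intro hori) (auto simp: boundary_after_def half_plane_def)
    also have "\<dots> = \<kappa> (0, 9)"
      using that by (intro vert) (auto simp: boundary_after_def half_plane_def)
    finally show ?thesis .
  qed
  show "\<kappa> (x, y) = \<kappa> (0, 1/2)" if "\<bar>x\<bar> < min 1 \<bar>y - 1\<bar>" "y < 1"
  proof -
    have "\<kappa> (x, y) = \<kappa> (0, y)"
      using that y by (intro hori) (auto simp: boundary_after_def half_plane_def)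
    also have "\<dots> = \<kappa> (0, 1/2)"
      using that y by (intro vert) (auto simp: boundary_after_def half_plane_def)
    finally show ?thesis .
  qed
qed

lemma boundary_corner:
  assumes \<kappa>: "\<kappa> \<in> pcol half_plane boundary_after boundary_crossings"
  shows "\<kappa> (0, 9) = t (\<kappa> (-9, 9)) (\<kappa> (0, 1/2)) (\<kappa> (9, 9))"
  using pcol_diagonal[OF \<kappa>, of 0 1 "1/2"] boundary_after_regions(1)[OF \<kappa>, of 1 "-1/2"]
    boundary_after_regions(2)[OF \<kappa>, of 1 "1/2"] boundary_after_regions(3)[OF \<kappa>, of "3/2" 0]
  by (simp add: boundary_crossings_def)

lemma boundary_extend:
  assumes \<kappa>: "\<kappa> \<in> pcol half_plane boundary_before {}"
  shows "\<exists>\<kappa>'\<in>pcol half_plane boundary_after boundary_crossings.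
    \<forall>z\<in>half_plane - big_square - boundary_after. \<kappa>' z = \<kappa> z"
proof -
  define L T R where "L = \<kappa> (-9, 9)" and "T = \<kappa> (0, 9)" and "R = \<kappa> (9, 9)"
  have in_A: "L \<in> A" "T \<in> A" "R \<in> A"
    using pcol_mem[OF \<kappa>] by (auto simp: L_def T_def R_def boundary_before_def half_plane_def)
  let ?g = "\<lambda>z :: plane. min 1 \<bar>snd z - 1\<bar>"
  \<comment> \<open>The exchange cuts off a triangle between the crossing and the boundary. It lies
    opposite \<open>T\<close>, and the crossing equation is solved for its color.\<close>
  define B where "B = t R T L"
  have eq: "T = t L B R"
    using rotate[OF rotate[OF B_def]] in_A by (simp add: B_def)
  define \<kappa>' where "\<kappa>' = (\<lambda>z. if \<bar>fst z\<bar> < ?g z \<and> 1 < snd z then T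
    else if ?g z < fst z then R else if fst z < - ?g z then L else B)"
  have "\<kappa>' \<in> pcol half_plane boundary_after boundary_crossings"
  proof (rule pcolI)
    have left: "locally_constant (top_of_set (half_plane - boundary_after)) (\<lambda>z. if fst z < - ?g z then L else B)"
    proof (rule locally_constant_if[where V = "\<lambda>z. - ?g z < fst z"])
      show "(\<not> fst z < - ?g z) = (- ?g z < fst z)" if "z \<in> half_plane" "z \<notin> boundary_after" for z
        using that by (cases z) (auto simp: boundary_after_def half_plane_def)
    qed (intro open_Collect_less continuous_intros locally_constant_const)+
    have right: "locally_constant (top_of_set (half_plane - boundary_after))
      (\<lambda>z. if ?g z < fst z then R else if fst z < - ?g z then L else B)"
    proof (rule locally_constant_if[where V = "\<lambda>z. fst z < ?g z"])
      show "(\<not> ?g z < fst z) = (fst z < ?g z)" if "z \<in> half_plane" "z \<notin> boundary_after" for z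
        using that by (cases z) (auto simp: boundary_after_def half_plane_def)
    qed (intro open_Collect_less continuous_intros locally_constant_const left)+
    show "locally_constant (top_of_set (half_plane - boundary_after)) \<kappa>'"
      unfolding \<kappa>'_def
    proof (rule locally_constant_if[where V = "\<lambda>z. ?g z < \<bar>fst z\<bar> \<or> snd z < 1"])
      show "(\<not> (\<bar>fst z\<bar> < ?g z \<and> 1 < snd z)) = (?g z < \<bar>fst z\<bar> \<or> snd z < 1)"
        if "z \<in> half_plane" "z \<notin> boundary_after" for z
        using that by (cases z) (auto simp: boundary_after_def half_plane_def)
    qed (intro open_Collect_conj open_Collect_disj open_Collect_less continuous_intros locally_constant_const right)+
    show "corner_equation t (\<kappa>' \<circ> squash_box z u v)" if "(z, u, v) \<in> boundary_crossings" for z u v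
      using that corner_equation_diagonal[of z u v 0 1 "1/2" t \<kappa>']
      by (simp add: boundary_crossings_def \<kappa>'_def eq[symmetric])
  qed (use in_A in \<open>auto simp: \<kappa>'_def B_def\<close>)
  moreover have "\<kappa>' (x, y) = \<kappa> (x, y)"
    if "(x, y) \<in> half_plane" "(x, y) \<notin> big_square" "(x, y) \<notin> boundary_after" for x y
  proof -
    have y: "0 \<le> y" using that by (simp add: half_plane_def)
    have off: "4 < \<bar>x\<bar> \<or> 4 < y" using that y by (auto simp: big_square_def)
    have nx: "y > 4 \<longrightarrow> \<bar>x\<bar> \<noteq> 1" using that by (auto simp: boundary_after_def)
    consider "x < -1" | "1 < x" | "-1 < x" "x < 1" "4 < y"
      using off nx by linarith
    then show ?thesis
      using boundary_before_regions[OF \<kappa> y, of x]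
      by cases (auto simp: \<kappa>'_def L_def T_def R_def)
  qed
  ultimately show ?thesis
    by (intro bexI[of _ \<kappa>']) auto
qed

lemma boundary_restrict:
  assumes \<kappa>: "\<kappa> \<in> pcol half_plane boundary_after boundary_crossings"
  shows "\<exists>\<kappa>'\<in>pcol half_plane boundary_before {}. \<forall>z\<in>half_plane - big_square - boundary_before. \<kappa>' z = \<kappa> z"
proof -
  define L T R where "L = \<kappa> (-9, 9)" and "T = \<kappa> (0, 9)" and "R = \<kappa> (9, 9)"
  have in_A: "L \<in> A" "T \<in> A" "R \<in> A"
    using pcol_mem[OF \<kappa>] by (auto simp: L_def T_def R_def boundary_after_def half_plane_def)
  define \<kappa>' where "\<kappa>' = (\<lambda>z :: plane. if fst z < -1 then L else if fst z < 1 then T else R)"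
  have "\<kappa>' \<in> pcol half_plane boundary_before {}"
  proof (rule pcolI)
    show "locally_constant (top_of_set (half_plane - boundary_before)) \<kappa>'"
      unfolding \<kappa>'_def
    proof (rule locally_constant_if[where V = "\<lambda>z. -1 < fst z"])
      show "(\<not> fst z < -1) = (-1 < fst z)" if "z \<in> half_plane" "z \<notin> boundary_before" for z
        using that by (cases z) (auto simp: boundary_before_def half_plane_def)
      show "locally_constant (top_of_set (half_plane - boundary_before)) (\<lambda>z. if fst z < 1 then T else R)"
      proof (rule locally_constant_if[where V = "\<lambda>z. 1 < fst z"])
        show "(\<not> fst z < 1) = (1 < fst z)" if "z \<in> half_plane" "z \<notin> boundary_before" for z
          using that by (cases z) (auto simp: boundary_before_def half_plane_def)
      qed (intro open_Collect_less continuous_intros locally_constant_const)+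
    qed (intro open_Collect_less continuous_intros locally_constant_const)+
  qed (use in_A in \<open>auto simp: \<kappa>'_def\<close>)
  moreover have "\<kappa>' (x, y) = \<kappa> (x, y)"
    if "(x, y) \<in> half_plane" "(x, y) \<notin> big_square" "(x, y) \<notin> boundary_before" for x y
  proof -
    have y: "0 \<le> y" using that by (simp add: half_plane_def)
    have off: "4 < \<bar>x\<bar> \<or> 4 < y" using that y by (auto simp: big_square_def)
    have "\<bar>x\<bar> \<noteq> 1" using that y by (auto simp: boundary_before_def)
    then consider "x < -1" | "1 < x" | "-1 < x" "x < 1" "4 < y"
      using off by linarith
    then show ?thesis
      using boundary_after_regions(1-3)[OF \<kappa> y, of x]
      by cases (auto simp: \<kappa>'_def L_def T_def R_def)
  qed
  ultimately show ?thesis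
    by (intro bexI[of _ \<kappa>']) auto
qed

lemma boundary_before_unique:
  assumes "\<kappa> \<in> pcol half_plane boundary_before {}" "\<kappa>' \<in> pcol half_plane boundary_before {}"
    and agree: "\<And>z. z \<in> half_plane - big_square - boundary_before \<Longrightarrow> \<kappa> z = \<kappa>' z"
    and z: "z \<in> half_plane - boundary_before"
  shows "\<kappa> z = \<kappa>' z"
proof -
  obtain x y where xy: "z = (x, y)" by (cases z)
  have y: "0 \<le> y" using z xy by (simp add: half_plane_def)
  have "x < -1 \<or> 1 < x \<or> -1 < x \<and> x < 1"
    using z xy y by (auto simp: boundary_before_def)
  moreover have "\<kappa> (-9, 9) = \<kappa>' (-9, 9)" "\<kappa> (0, 9) = \<kappa>' (0, 9)" "\<kappa> (9, 9) = \<kappa>' (9, 9)"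
    by (rule agree; simp add: big_square_def boundary_before_def half_plane_def)+
  ultimately show ?thesis
    using boundary_before_regions[OF assms(1) y, of x] boundary_before_regions[OF assms(2) y, of x] xy by auto
qed

lemma boundary_after_unique:
  assumes \<kappa>: "\<kappa> \<in> pcol half_plane boundary_after boundary_crossings" "\<kappa>' \<in> pcol half_plane boundary_after boundary_crossings"
    and agree: "\<And>z. z \<in> half_plane - big_square - boundary_after \<Longrightarrow> \<kappa> z = \<kappa>' z"
    and z: "z \<in> half_plane - boundary_after"
  shows "\<kappa> z = \<kappa>' z"
proof -
  obtain x y where xy: "z = (x, y)" by (cases z)
  have y: "0 \<le> y" using z xy by (simp add: half_plane_def)
  let ?g = "min 1 \<bar>y - 1\<bar>"
  have cases: "x < - ?g \<or> ?g < x \<or> \<bar>x\<bar> < ?g \<and> 1 < y \<or> \<bar>x\<bar> < ?g \<and> y < 1"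
    using z xy y by (auto simp: boundary_after_def)
  have outer: "\<kappa> (-9, 9) = \<kappa>' (-9, 9)" "\<kappa> (0, 9) = \<kappa>' (0, 9)" "\<kappa> (9, 9) = \<kappa>' (9, 9)"
    by (rule agree; simp add: big_square_def boundary_after_def half_plane_def)+
  have bottom: "\<mu> (0, 1/2) = t (\<mu> (9, 9)) (\<mu> (0, 9)) (\<mu> (-9, 9))"
    if "\<mu> \<in> pcol half_plane boundary_after boundary_crossings" for \<mu>
  proof -
    have in_A: "\<mu> (-9, 9) \<in> A" "\<mu> (0, 9) \<in> A" "\<mu> (9, 9) \<in> A" "\<mu> (0, 1/2) \<in> A"
      using pcol_mem[OF that] by (auto simp: boundary_after_def half_plane_def)
    then show ?thesis
      using rotate[OF rotate[OF boundary_corner[OF that]]] by blast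
  qed
  have "\<kappa> (0, 1/2) = \<kappa>' (0, 1/2)"
    unfolding bottom[OF \<kappa>(1)] bottom[OF \<kappa>(2)] using outer by simp
  with cases outer show ?thesis
    using boundary_after_regions[OF \<kappa>(1) y, of x] boundary_after_regions[OF \<kappa>(2) y, of x] xy by auto
qed

end

section \<open>Move (III)\<close>

text \<open>Half-size 1/2 gives the diamond \<open>\<bar>x\<bar> + \<bar>y\<bar> < 1\<close>, which
  stops just short of the third strand. Half-size 1/4 keeps the other two diamonds off both axes and
  within \<open>\<bar>x\<bar> < 1\<close>, where all strands are straight.\<close>

definition R3_before_crossings :: "(plane \<times> plane \<times> plane) set" where
  "R3_before_crossings = {diagonal_crossing 0 0 (1/2), diagonal_crossing (1/2) (1/2) (1/4), diagonal_crossing (-1/2) (1/2) (1/4)}"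

definition R3_after_crossings :: "(plane \<times> plane \<times> plane) set" where
  "R3_after_crossings = {diagonal_crossing 0 0 (1/2), diagonal_crossing (1/2) (-1/2) (1/4), diagonal_crossing (-1/2) (-1/2) (1/4)}"

text \<open>The picture is the union of the graphs of \<open>x\<close>, \<open>- x\<close> and
  \<open>g\<close>. At a point on just one of them the other two form a closed set avoiding
  it.\<close>

lemma smooth_three_graphs:
  assumes g: "continuous_on UNIV g" and P: "P = {(x, y). \<bar>y\<bar> = \<bar>x\<bar> \<or> y = g x}"
    and z: "(x, y) \<in> P" and off: "\<not> (y = x \<and> y = - x)" "\<not> (y = x \<and> y = g x)" "\<not> (y = - x \<and> y = g x)"
  shows "smooth_at UNIV P (x, y)"
proof -
  let ?G = "\<lambda>f :: real \<Rightarrow> real. {(x, y). y = f x}"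
  have c: "continuous_on UNIV (\<lambda>x :: real. x)" "continuous_on UNIV (\<lambda>x :: real. - x)"
    by (intro continuous_intros)+
  have cl: "closed (?G (\<lambda>x. x))" "closed (?G (\<lambda>x. - x))" "closed (?G g)"
    using graph_closed[OF c(1)] graph_closed[OF c(2)] graph_closed[OF g] .
  have *: "P = ?G (\<lambda>x. x) \<union> (?G (\<lambda>x. - x) \<union> ?G g)" "P = ?G (\<lambda>x. - x) \<union> (?G (\<lambda>x. x) \<union> ?G g)"
    "P = ?G g \<union> (?G (\<lambda>x. x) \<union> ?G (\<lambda>x. - x))"
    unfolding P abs_eq_iff by auto
  consider "y = x" | "y = - x" | "y = g x"
    using z P abs_eq_iff by auto
  then show ?thesis
  proof cases
    case 1
    then show ?thesis
      using off by (intro smooth_graph_off[OF c(1) closed_Un[OF cl(2,3)] *(1)]) auto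
  next
    case 2
    then show ?thesis
      using off by (intro smooth_graph_off[OF c(2) closed_Un[OF cl(1,3)] *(2)]) auto
  next
    case 3
    then show ?thesis
      using off by (intro smooth_graph_off[OF g closed_Un[OF cl(1,2)] *(3)]) auto
  qed
qed

text \<open>Move (III) is always transported from this picture to \<open>R3_after\<close>, the
  converse coming from \<open>R3_mirror\<close>, so this picture only occurs as a source and its
  boxes suffice.\<close>

lemma R3_before_boxes:
  assumes "c \<in> R3_before_crossings"
  shows "crossing_box UNIV R3_before c"
proof -
  have "crossing_box UNIV R3_before (diagonal_crossing 0 0 (1/2))"
    by (rule diagonal_crossing_box) (auto simp: R3_before_def)
  moreover have "crossing_box UNIV R3_before (diagonal_crossing (1/2) (1/2) (1/4))"
  proof (rule diagonal_crossing_box)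
    fix a b :: real assume ab: "\<bar>a\<bar> + \<bar>b\<bar> < 2 * (1/4)"
    then have "\<bar>1/2 + a\<bar> = 1/2 + a" "\<bar>1/2 + b\<bar> = 1/2 + b" "max 0 (1 - (1/2 + a)) = 1/2 - a"
      by linarith+
    then show "(1/2 + a, 1/2 + b) \<in> UNIV \<and> ((1/2 + a, 1/2 + b) \<in> R3_before \<longleftrightarrow> \<bar>a\<bar> = \<bar>b\<bar>)"
      by (auto simp: R3_before_def abs_eq_iff)
  qed simp
  moreover have "crossing_box UNIV R3_before (diagonal_crossing (-1/2) (1/2) (1/4))"
  proof (rule diagonal_crossing_box)
    fix a b :: real assume ab: "\<bar>a\<bar> + \<bar>b\<bar> < 2 * (1/4)"
    then have "\<bar>-1/2 + a\<bar> = 1/2 - a" "\<bar>1/2 + b\<bar> = 1/2 + b" "max 0 (1 - (1/2 - a)) = 1/2 + a"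
      by linarith+
    then show "(-1/2 + a, 1/2 + b) \<in> UNIV \<and> ((-1/2 + a, 1/2 + b) \<in> R3_before \<longleftrightarrow> \<bar>a\<bar> = \<bar>b\<bar>)"
      by (auto simp: R3_before_def abs_eq_iff)
  qed simp
  ultimately show ?thesis
    using assms by (auto simp: R3_before_crossings_def)
qed

lemma R3_after_picture: "picture UNIV R3_after R3_after_crossings"
proof -
  let ?h = "\<lambda>x :: real. - max 0 (1 - \<bar>x\<bar>)"
  have h: "continuous_on UNIV ?h" by (intro continuous_intros)
  have P: "R3_after = {(x, y). \<bar>y\<bar> = \<bar>x\<bar> \<or> y = ?h x}"
    by (simp add: R3_after_def)
  have "crossing_box UNIV R3_after (diagonal_crossing 0 0 (1/2))"
    by (rule diagonal_crossing_box) (auto simp: R3_after_def)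
  moreover have "crossing_box UNIV R3_after (diagonal_crossing (1/2) (-1/2) (1/4))"
  proof (rule diagonal_crossing_box)
    fix a b :: real assume ab: "\<bar>a\<bar> + \<bar>b\<bar> < 2 * (1/4)"
    then have "\<bar>1/2 + a\<bar> = 1/2 + a" "\<bar>-1/2 + b\<bar> = 1/2 - b" "max 0 (1 - (1/2 + a)) = 1/2 - a"
      by linarith+
    then show "(1/2 + a, -1/2 + b) \<in> UNIV \<and> ((1/2 + a, -1/2 + b) \<in> R3_after \<longleftrightarrow> \<bar>a\<bar> = \<bar>b\<bar>)"
      by (auto simp: R3_after_def abs_eq_iff)
  qed simp
  moreover have "crossing_box UNIV R3_after (diagonal_crossing (-1/2) (-1/2) (1/4))"
  proof (rule diagonal_crossing_box)
    fix a b :: real assume ab: "\<bar>a\<bar> + \<bar>b\<bar> < 2 * (1/4)"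
    then have "\<bar>-1/2 + a\<bar> = 1/2 - a" "\<bar>-1/2 + b\<bar> = 1/2 - b" "max 0 (1 - (1/2 - a)) = 1/2 + a"
      by linarith+
    then show "(-1/2 + a, -1/2 + b) \<in> UNIV \<and> ((-1/2 + a, -1/2 + b) \<in> R3_after \<longleftrightarrow> \<bar>a\<bar> = \<bar>b\<bar>)"
      by (auto simp: R3_after_def abs_eq_iff)
  qed simp
  moreover have smooth: "smooth_at UNIV R3_after (x, y)"
    if xy: "(x, y) \<in> R3_after" "(x, y) \<noteq> (0, 0)" "(x, y) \<noteq> (1/2, -1/2)" "(x, y) \<noteq> (-1/2, -1/2)" for x y
  proof (rule smooth_three_graphs[OF h P xy(1)])
    show "\<not> (y = x \<and> y = - x)" using xy(2) by auto
    show "\<not> (y = x \<and> y = ?h x)"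
    proof
      assume "y = x \<and> y = ?h x"
      then have "y = x" "x = ?h x" by auto
      moreover have "x = 0 \<or> x = -1/2" using \<open>x = ?h x\<close> by linarith
      ultimately show False using xy by auto
    qed
    show "\<not> (y = - x \<and> y = ?h x)"
    proof
      assume "y = - x \<and> y = ?h x"
      then have "y = - x" "- x = ?h x" by auto
      moreover have "x = 0 \<or> x = 1/2" using \<open>- x = ?h x\<close> by linarith
      ultimately show False using xy by auto
    qed
  qed
  moreover have "smooth_at UNIV R3_after z \<or> z \<in> {(0, 0), (1/2, -1/2), (-1/2, -1/2)}" if "z \<in> R3_after" for z
    using that smooth by (cases z) blast
  moreover have "fst ` R3_after_crossings = {(0, 0), (1/2, -1/2), (-1/2, -1/2)}"
    by (simp add: R3_after_crossings_def diagonal_crossing_def)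
  ultimately show ?thesis
    unfolding picture_def by (metis R3_after_crossings_def empty_iff insert_iff)
qed

context kt_ternary
begin

lemma R3_before_regions:
  assumes \<kappa>: "\<kappa> \<in> pcol UNIV R3_before C"
  shows "\<bar>x\<bar> < y \<Longrightarrow> max 0 (1 - \<bar>x\<bar>) < y \<Longrightarrow> \<kappa> (x, y) = \<kappa> (0, 9)"
    and "y < - \<bar>x\<bar> \<Longrightarrow> \<kappa> (x, y) = \<kappa> (0, -9)"
    and "max 0 (1 - \<bar>x\<bar>) < y \<Longrightarrow> y < - x \<Longrightarrow> \<kappa> (x, y) = \<kappa> (-9, 1)"
    and "x < y \<Longrightarrow> y < - x \<Longrightarrow> y < max 0 (1 - \<bar>x\<bar>) \<Longrightarrow> \<kappa> (x, y) = \<kappa> (-9, -1)"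
    and "max 0 (1 - \<bar>x\<bar>) < y \<Longrightarrow> y < x \<Longrightarrow> \<kappa> (x, y) = \<kappa> (9, 1)"
    and "- x < y \<Longrightarrow> y < x \<Longrightarrow> y < max 0 (1 - \<bar>x\<bar>) \<Longrightarrow> \<kappa> (x, y) = \<kappa> (9, -1)"
    and "\<bar>x\<bar> < y \<Longrightarrow> y < max 0 (1 - \<bar>x\<bar>) \<Longrightarrow> \<kappa> (x, y) = \<kappa> (0, 1/2)"
proof -
  have notin: "(a, b) \<notin> R3_before" if "\<bar>b\<bar> \<noteq> \<bar>a\<bar>" "b \<noteq> max 0 (1 - \<bar>a\<bar>)" for a b
    using that by (simp add: R3_before_def)
  have vert: "\<kappa> (a, b) = \<kappa> (a, b')"
    if "\<And>s. b \<le> s \<and> s \<le> b' \<or> b' \<le> s \<and> s \<le> b \<Longrightarrow> \<bar>s\<bar> \<noteq> \<bar>a\<bar> \<and> s \<noteq> max 0 (1 - \<bar>a\<bar>)" for a b b'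
    using that notin by (intro pcol_vertical[OF \<kappa>]) auto
  have hori: "\<kappa> (a, b) = \<kappa> (a', b)"
    if "\<And>s. a \<le> s \<and> s \<le> a' \<or> a' \<le> s \<and> s \<le> a \<Longrightarrow> \<bar>b\<bar> \<noteq> \<bar>s\<bar> \<and> b \<noteq> max 0 (1 - \<bar>s\<bar>)" for a b a'
    using that notin by (intro pcol_horizontal[OF \<kappa>]) auto
  show "\<kappa> (x, y) = \<kappa> (0, 9)" if "\<bar>x\<bar> < y" "max 0 (1 - \<bar>x\<bar>) < y"
  proof -
    have "\<kappa> (x, y) = \<kappa> (x, y + 9)" by (rule vert) (use that in linarith)
    also have "\<dots> = \<kappa> (0, y + 9)" by (rule hori) (use that in linarith)
    also have "\<dots> = \<kappa> (0, 9)" by (rule vert) (use that in linarith)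
    finally show ?thesis .
  qed
  show "\<kappa> (x, y) = \<kappa> (0, -9)" if "y < - \<bar>x\<bar>"
  proof -
    have "\<kappa> (x, y) = \<kappa> (x, y - 9)" by (rule vert) (use that in linarith)
    also have "\<dots> = \<kappa> (0, y - 9)" by (rule hori) (use that in linarith)
    also have "\<dots> = \<kappa> (0, -9)" by (rule vert) (use that in linarith)
    finally show ?thesis .
  qed
  show "\<kappa> (x, y) = \<kappa> (-9, 1)" if "max 0 (1 - \<bar>x\<bar>) < y" "y < - x"
  proof -
    have "\<kappa> (x, y) = \<kappa> (x - 9, y)" by (rule hori) (use that in linarith)
    also have "\<dots> = \<kappa> (x - 9, 1)" by (rule vert) (use that in linarith)
    also have "\<dots> = \<kappa> (-9, 1)" by (rule hori) (use that in linarith)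
    finally show ?thesis .
  qed
  show "\<kappa> (x, y) = \<kappa> (-9, -1)" if "x < y" "y < - x" "y < max 0 (1 - \<bar>x\<bar>)"
  proof -
    \<comment> \<open>The height \<open>x / 2\<close> is negative and lies inside the left wedge, so
      going left from there meets neither the diagonals nor the third strand. The right wedge is
      treated symmetrically with \<open>- x / 2\<close>.\<close>
    have "\<kappa> (x, y) = \<kappa> (x, x / 2)" by (rule vert) (use that in linarith)
    also have "\<dots> = \<kappa> (x - 9, x / 2)" by (rule hori) (use that in linarith)
    also have "\<dots> = \<kappa> (x - 9, -1)" by (rule vert) (use that in linarith)
    also have "\<dots> = \<kappa> (-9, -1)" by (rule hori) (use that in linarith)
    finally show ?thesis .
  qed
  show "\<kappa> (x, y) = \<kappa> (9, 1)" if "max 0 (1 - \<bar>x\<bar>) < y" "y < x"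
  proof -
    have "\<kappa> (x, y) = \<kappa> (x + 9, y)" by (rule hori) (use that in linarith)
    also have "\<dots> = \<kappa> (x + 9, 1)" by (rule vert) (use that in linarith)
    also have "\<dots> = \<kappa> (9, 1)" by (rule hori) (use that in linarith)
    finally show ?thesis .
  qed
  show "\<kappa> (x, y) = \<kappa> (9, -1)" if "- x < y" "y < x" "y < max 0 (1 - \<bar>x\<bar>)"
  proof -
    have "\<kappa> (x, y) = \<kappa> (x, - x / 2)" by (rule vert) (use that in linarith)
    also have "\<dots> = \<kappa> (x + 9, - x / 2)" by (rule hori) (use that in linarith)
    also have "\<dots> = \<kappa> (x + 9, -1)" by (rule vert) (use that in linarith)
    also have "\<dots> = \<kappa> (9, -1)" by (rule hori) (use that in linarith)
    finally show ?thesis .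
  qed
  show "\<kappa> (x, y) = \<kappa> (0, 1/2)" if "\<bar>x\<bar> < y" "y < max 0 (1 - \<bar>x\<bar>)"
  proof -
    have "\<kappa> (x, y) = \<kappa> (0, y)" by (rule hori) (use that in linarith)
    also have "\<dots> = \<kappa> (0, 1/2)" by (rule vert) (use that in linarith)
    finally show ?thesis .
  qed
qed

lemma R3_corners:
  assumes \<kappa>: "\<kappa> \<in> pcol UNIV R3_before R3_before_crossings"
  shows "\<kappa> (0, 1/2) = t (\<kappa> (-9, -1)) (\<kappa> (0, -9)) (\<kappa> (9, -1))"
    and "\<kappa> (0, 9) = t (\<kappa> (0, 1/2)) (\<kappa> (9, -1)) (\<kappa> (9, 1))"
    and "\<kappa> (0, 9) = t (\<kappa> (-9, 1)) (\<kappa> (-9, -1)) (\<kappa> (0, 1/2))"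
proof -
  note reg = R3_before_regions[OF \<kappa>]
  show "\<kappa> (0, 1/2) = t (\<kappa> (-9, -1)) (\<kappa> (0, -9)) (\<kappa> (9, -1))"
    using pcol_diagonal[OF \<kappa>, of 0 0 "1/2"] reg(4)[of "-1/2" 0] reg(2)[of "-1/2" 0] reg(6)[of "1/2" 0]
    by (simp add: R3_before_crossings_def)
  show "\<kappa> (0, 9) = t (\<kappa> (0, 1/2)) (\<kappa> (9, -1)) (\<kappa> (9, 1))"
    using pcol_diagonal[OF \<kappa>, of "1/2" "1/2" "1/4"] reg(1)[of "1/2" "3/4"] reg(7)[of "1/4" "1/2"]
      reg(6)[of "1/2" "1/4"] reg(5)[of "3/4" "1/2"]
    by (simp add: R3_before_crossings_def)
  show "\<kappa> (0, 9) = t (\<kappa> (-9, 1)) (\<kappa> (-9, -1)) (\<kappa> (0, 1/2))"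
    using pcol_diagonal[OF \<kappa>, of "-1/2" "1/2" "1/4"] reg(1)[of "-1/2" "3/4"] reg(7)[of "-1/4" "1/2"]
      reg(4)[of "-1/2" "1/4"] reg(3)[of "-3/4" "1/2"]
    by (simp add: R3_before_crossings_def)
qed

text \<open>The six outer colors are kept and only the triangle is recolored. The three new
  crossings each demand a color for it, and \<open>triangle\<close> shows that the demands
  coincide.\<close>

lemma R3_extend:
  assumes \<kappa>: "\<kappa> \<in> pcol UNIV R3_before R3_before_crossings"
  shows "\<exists>\<kappa>'\<in>pcol UNIV R3_after R3_after_crossings. \<forall>z\<in>UNIV - big_square - R3_after. \<kappa>' z = \<kappa> z"
proof -
  define b l u a v r x where colors: "b = \<kappa> (0, -9)" "l = \<kappa> (-9, -1)" "u = \<kappa> (-9, 1)" "a = \<kappa> (0, 9)"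
    "v = \<kappa> (9, 1)" "r = \<kappa> (9, -1)" "x = \<kappa> (0, 1/2)"
  have in_A: "b \<in> A" "l \<in> A" "u \<in> A" "a \<in> A" "v \<in> A" "r \<in> A" "x \<in> A"
    unfolding colors by (rule pcol_mem[OF \<kappa>]; simp add: R3_before_def)+
  have x: "x = t l b r" "a = t x r v" "a = t u l x"
    unfolding colors by (rule R3_corners[OF \<kappa>])+
  \<comment> \<open>The upper two crossings are solved for the color of the old triangle, the form
    in which \<open>triangle\<close> takes them.\<close>
  have "x = t a v r"
    using trans[OF rotate[OF x(2)] reverse[of r v a]] in_A by blast
  moreover have "x = t a u l"
    using rotate[OF rotate[OF rotate[OF x(3)]]] in_A by blast
  ultimately have tri: "t u l b = t v r b" "t u l b = t u a v"
    using triangle[OF in_A(1-6) x(1)] by blast+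
  define y where "y = t u l b"
  have y: "y = t u l b" "y = t v r b" "y = t u a v"
    using tri by (simp_all add: y_def)
  have yA: "y \<in> A" using in_A by (simp add: y_def)
  have eqs: "t u y v = a" "t y b r = v" "t l b y = u"
  proof -
    show "t l b y = u" using rotate[OF y(1), symmetric] in_A by blast
    have "v = t r b y" using rotate[OF y(2)] in_A by blast
    then show "t y b r = v" using trans[OF _ reverse[of r b y], of v, symmetric] in_A yA by blast
    have "a = t v y u" using rotate[OF rotate[OF y(3)]] in_A yA by blast
    then show "t u y v = a" using trans[OF _ reverse[of v y u], of a, symmetric] in_A yA by blast
  qed
  let ?h = "\<lambda>z :: plane. - max 0 (1 - \<bar>fst z\<bar>)"
  \<comment> \<open>The diagonals are tested before the moved strand. The top wedge has no third
    test because the moved strand stays at heights at most 0.\<close>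
  define \<kappa>' where "\<kappa>' = (\<lambda>z. if fst z < snd z
    then (if - fst z < snd z then a else if ?h z < snd z then u else l)
    else (if - fst z < snd z then (if ?h z < snd z then v else r) else if ?h z < snd z then y else b))"
  have "\<kappa>' \<in> pcol UNIV R3_after R3_after_crossings"
  proof (rule pcolI)
    have third: "locally_constant (top_of_set (UNIV - R3_after)) (\<lambda>z. if ?h z < snd z then c else d)" for c d :: 'b
    proof (rule locally_constant_if[where V = "\<lambda>z. snd z < ?h z"])
      show "(\<not> ?h z < snd z) = (snd z < ?h z)" if "z \<notin> R3_after" for z
        using that by (cases z) (auto simp: R3_after_def)
    qed (intro open_Collect_less continuous_intros locally_constant_const)+
    have second: "locally_constant (top_of_set (UNIV - R3_after)) (\<lambda>z. if - fst z < snd z then f z else g z)"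
      if "locally_constant (top_of_set (UNIV - R3_after)) f" "locally_constant (top_of_set (UNIV - R3_after)) g" for f g :: "plane \<Rightarrow> 'b"
    proof (rule locally_constant_if[where V = "\<lambda>z. snd z < - fst z"])
      show "(\<not> - fst z < snd z) = (snd z < - fst z)" if "z \<notin> R3_after" for z
        using that by (cases z) (auto simp: R3_after_def)
    qed (intro open_Collect_less continuous_intros that)+
    show "locally_constant (top_of_set (UNIV - R3_after)) \<kappa>'"
      unfolding \<kappa>'_def
    proof (rule locally_constant_if[where V = "\<lambda>z. snd z < fst z"])
      show "(\<not> fst z < snd z) = (snd z < fst z)" if "z \<notin> R3_after" for z
        using that by (cases z) (auto simp: R3_after_def)
    qed (intro open_Collect_less continuous_intros second third locally_constant_const)+
    have corners: "\<kappa>' (0, 1/2) = t (\<kappa>' (-1/2, 0)) (\<kappa>' (0, -1/2)) (\<kappa>' (1/2, 0))"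
      "\<kappa>' (1/2, -1/4) = t (\<kappa>' (1/4, -1/2)) (\<kappa>' (1/2, -3/4)) (\<kappa>' (3/4, -1/2))"
      "\<kappa>' (-1/2, -1/4) = t (\<kappa>' (-3/4, -1/2)) (\<kappa>' (-1/2, -3/4)) (\<kappa>' (-1/4, -1/2))"
      by (simp_all add: \<kappa>'_def eqs)
    show "corner_equation t (\<kappa>' \<circ> squash_box z w w')" if "(z, w, w') \<in> R3_after_crossings" for z w w'
      using that corner_equation_diagonal[of z w w' 0 0 "1/2" t \<kappa>']
        corner_equation_diagonal[of z w w' "1/2" "-1/2" "1/4" t \<kappa>']
        corner_equation_diagonal[of z w w' "-1/2" "-1/2" "1/4" t \<kappa>'] corners
      unfolding R3_after_crossings_def by auto
  qed (use in_A yA in \<open>auto simp: \<kappa>'_def\<close>)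
  moreover have "\<kappa>' (p, q) = \<kappa> (p, q)" if "(p, q) \<notin> big_square" "(p, q) \<notin> R3_after" for p q
  proof -
    have off: "4 < \<bar>p\<bar> \<or> 4 < \<bar>q\<bar>" using that by (auto simp: big_square_def)
    have nin: "\<bar>q\<bar> \<noteq> \<bar>p\<bar>" "q \<noteq> - max 0 (1 - \<bar>p\<bar>)" using that by (auto simp: R3_after_def)
    have "q \<noteq> 0" if "4 < \<bar>p\<bar>"
      using nin(2) that by simp
    then have "\<bar>p\<bar> < q \<and> 4 < q \<or> q < - \<bar>p\<bar> \<and> q < -4 \<or> 0 < q \<and> q < - p \<and> p < -4 \<or> q < 0 \<and> p < q \<and> p < -4 \<or>
        0 < q \<and> q < p \<and> 4 < p \<or> q < 0 \<and> - p < q \<and> 4 < p"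
      using off nin(1) by (cases "0 \<le> p"; cases "0 \<le> q") auto
    then consider (top) "\<bar>p\<bar> < q" "4 < q" | (bottom) "q < - \<bar>p\<bar>" "q < -4"
      | (left_up) "0 < q" "q < - p" "p < -4" | (left_down) "q < 0" "p < q" "p < -4"
      | (right_up) "0 < q" "q < p" "4 < p" | (right_down) "q < 0" "- p < q" "4 < p"
      by blast
    then show ?thesis
    proof cases
      case top
      then have "\<kappa> (p, q) = a" unfolding colors by (intro R3_before_regions(1)[OF \<kappa>]) auto
      then show ?thesis using top by (auto simp: \<kappa>'_def)
    next
      case bottom
      then have "\<kappa> (p, q) = b" unfolding colors by (intro R3_before_regions(2)[OF \<kappa>]) auto
      then show ?thesis using bottom by (auto simp: \<kappa>'_def)
    next
      case left_up
      then have "\<kappa> (p, q) = u" unfolding colors by (intro R3_before_regions(3)[OF \<kappa>]) auto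
      then show ?thesis using left_up by (auto simp: \<kappa>'_def)
    next
      case left_down
      then have "\<kappa> (p, q) = l" unfolding colors by (intro R3_before_regions(4)[OF \<kappa>]) auto
      then show ?thesis using left_down by (auto simp: \<kappa>'_def)
    next
      case right_up
      then have "\<kappa> (p, q) = v" unfolding colors by (intro R3_before_regions(5)[OF \<kappa>]) auto
      then show ?thesis using right_up by (auto simp: \<kappa>'_def)
    next
      case right_down
      then have "\<kappa> (p, q) = r" unfolding colors by (intro R3_before_regions(6)[OF \<kappa>]) auto
      then show ?thesis using right_down by (auto simp: \<kappa>'_def)
    qed
  qed
  ultimately show ?thesis
    by (intro bexI[of _ \<kappa>']) auto
qed

text \<open>Six regions have sample points outside the square; the triangle is the only bounded one,
  and the crossing of the diagonals fixes its color.\<close>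

lemma R3_unique:
  assumes \<kappa>: "\<kappa> \<in> pcol UNIV R3_before R3_before_crossings" "\<kappa>' \<in> pcol UNIV R3_before R3_before_crossings"
    and agree: "\<And>z. z \<in> UNIV - big_square - R3_before \<Longrightarrow> \<kappa> z = \<kappa>' z" and z: "z \<in> UNIV - R3_before"
  shows "\<kappa> z = \<kappa>' z"
proof -
  obtain x y where xy: "z = (x, y)" by (cases z)
  let ?g = "max 0 (1 - \<bar>x\<bar>)"
  have outer: "\<kappa> (0, 9) = \<kappa>' (0, 9)" "\<kappa> (0, -9) = \<kappa>' (0, -9)" "\<kappa> (-9, 1) = \<kappa>' (-9, 1)"
    "\<kappa> (-9, -1) = \<kappa>' (-9, -1)" "\<kappa> (9, 1) = \<kappa>' (9, 1)" "\<kappa> (9, -1) = \<kappa>' (9, -1)"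
    by (rule agree; simp add: big_square_def R3_before_def)+
  then have inner: "\<kappa> (0, 1/2) = \<kappa>' (0, 1/2)"
    unfolding R3_corners(1)[OF \<kappa>(1)] R3_corners(1)[OF \<kappa>(2)] by simp
  have nin: "\<bar>y\<bar> \<noteq> \<bar>x\<bar>" "y \<noteq> ?g" using z xy by (auto simp: R3_before_def)
  have "y < ?g" if "y < 0"
    using that by simp
  then have "\<bar>x\<bar> < y \<and> ?g < y \<or> y < - \<bar>x\<bar> \<or> ?g < y \<and> y < - x \<or> x < y \<and> y < - x \<and> y < ?g \<or>
      ?g < y \<and> y < x \<or> - x < y \<and> y < x \<and> y < ?g \<or> \<bar>x\<bar> < y \<and> y < ?g"
    using nin by (cases "0 \<le> x"; cases "0 \<le> y") (auto simp: linorder_neq_iff simp del: max_less_iff_conj)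
  then consider "\<bar>x\<bar> < y" "?g < y" | "y < - \<bar>x\<bar>" | "?g < y" "y < - x" | "x < y" "y < - x" "y < ?g"
    | "?g < y" "y < x" | "- x < y" "y < x" "y < ?g" | "\<bar>x\<bar> < y" "y < ?g"
    by blast
  then show ?thesis
    unfolding xy using outer inner R3_before_regions[OF \<kappa>(1), where x = x and y = y]
      R3_before_regions[OF \<kappa>(2), where x = x and y = y]
    by cases metis+
qed

end

section \<open>Invariance\<close>

lemma local_move_sym: "local_move X P Q F D D' \<Longrightarrow> local_move X Q P F D' D"
  unfolding local_move_def by (elim ex_forward) simp

text \<open>Reflecting the chart in the horizontal axis interchanges the two pictures of move (III).\<close>

lemma R3_mirror:
  assumes "local_move UNIV R3_before R3_after F D D'"
  shows "local_move UNIV R3_before R3_after F D' D"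
proof -
  obtain e where e: "open_embedding UNIV F e" "{z. e z \<in> D} = R3_before" "{z. e z \<in> D'} = R3_after"
    and off: "D - range e = D' - range e"
    using assms unfolding local_move_def by auto
  let ?m = "\<lambda>z :: plane. (fst z, - snd z)"
  have flip: "?m z \<in> R3_before \<longleftrightarrow> z \<in> R3_after" "?m z \<in> R3_after \<longleftrightarrow> z \<in> R3_before" for z
    by (cases z; auto simp: R3_before_def R3_after_def)+
  have "surj ?m"
    by (rule surjI[of _ ?m]) simp
  then have ran: "range (e \<circ> ?m) = range e"
    by (metis image_comp)
  have "open_embedding UNIV F (e \<circ> ?m)"
    by (rule open_embedding_compose[OF e(1)]) (auto intro!: continuous_intros injI simp: prod_eq_iff)
  moreover have "{z. (e \<circ> ?m) z \<in> D'} = R3_before" "{z. (e \<circ> ?m) z \<in> D} = R3_after"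
  proof -
    have "e z \<in> D \<longleftrightarrow> z \<in> R3_before" "e z \<in> D' \<longleftrightarrow> z \<in> R3_after" for z
      using e(2,3) by blast+
    then show "{z. (e \<circ> ?m) z \<in> D'} = R3_before" "{z. (e \<circ> ?m) z \<in> D} = R3_after"
      by (simp_all only: comp_apply flip Collect_mem_eq)
  qed
  ultimately show ?thesis
    unfolding local_move_def using off ran by (intro exI[of _ "e \<circ> ?m"]) simp
qed

context kt_ternary
begin

text \<open>Instance of \<open>local_picture\<close> with \<open>K\<close> the part of the square in
  \<open>X\<close>. Closedness of \<open>X\<close> keeps it compact also when the half-plane cuts
  the square.\<close>

lemma local_move_lepoll:
  assumes F: "Hausdorff_space F" "closedin F D" "closedin F D'" and move: "local_move X P Q F D D'"
    and X: "closed X" and PQ: "P - big_square = Q - big_square"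
    and C: "\<And>c. c \<in> C \<Longrightarrow> crossing_box X P c" and pic: "picture X Q C'"
    and ex: "\<And>\<kappa>. \<kappa> \<in> pcol X P C \<Longrightarrow> \<exists>\<kappa>'\<in>pcol X Q C'. \<forall>z\<in>X - big_square - Q. \<kappa>' z = \<kappa> z"
    and uniq: "\<And>\<kappa> \<kappa>' z. \<kappa> \<in> pcol X P C \<Longrightarrow> \<kappa>' \<in> pcol X P C \<Longrightarrow>
      (\<And>z. z \<in> X - big_square - P \<Longrightarrow> \<kappa> z = \<kappa>' z) \<Longrightarrow> z \<in> X - P \<Longrightarrow> \<kappa> z = \<kappa>' z"
  shows "point_colorings F A t D \<lesssim> point_colorings F A t D'"
proof -
  obtain e where e: "open_embedding X F e" "{z \<in> X. e z \<in> D} = P" "{z \<in> X. e z \<in> D'} = Q"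
    and off: "D - e ` X = D' - e ` X"
    using move unfolding local_move_def by auto
  have PX: "P \<subseteq> X" "Q \<subseteq> X" using e by auto
  have "compact (big_square \<inter> X)"
    using compact_big_square X by (rule compact_Int_closed)
  moreover have "P - big_square \<inter> X = Q - big_square \<inter> X"
    using PQ PX by blast
  ultimately interpret local_picture A t F D D' X "big_square \<inter> X" P Q e
    using F e off by unfold_locales auto
  have eq: "X - big_square \<inter> X - R = X - big_square - R" for R by blast
  show ?thesis
    by (rule lepoll[OF C pic, unfolded eq]) (use ex uniq in auto)
qed

lemma local_move_eqpoll:
  assumes F: "Hausdorff_space F" "closedin F D" "closedin F D'" and move: "local_move X P Q F D D'"
    and X: "closed X" and PQ: "P - big_square = Q - big_square"
    and pic: "picture X P C" "picture X Q C'"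
    and ex: "\<And>\<kappa>. \<kappa> \<in> pcol X P C \<Longrightarrow> \<exists>\<kappa>'\<in>pcol X Q C'. \<forall>z\<in>X - big_square - Q. \<kappa>' z = \<kappa> z"
      "\<And>\<kappa>. \<kappa> \<in> pcol X Q C' \<Longrightarrow> \<exists>\<kappa>'\<in>pcol X P C. \<forall>z\<in>X - big_square - P. \<kappa>' z = \<kappa> z"
    and uniq: "\<And>\<kappa> \<kappa>' z. \<kappa> \<in> pcol X P C \<Longrightarrow> \<kappa>' \<in> pcol X P C \<Longrightarrow>
      (\<And>z. z \<in> X - big_square - P \<Longrightarrow> \<kappa> z = \<kappa>' z) \<Longrightarrow> z \<in> X - P \<Longrightarrow> \<kappa> z = \<kappa>' z"
      "\<And>\<kappa> \<kappa>' z. \<kappa> \<in> pcol X Q C' \<Longrightarrow> \<kappa>' \<in> pcol X Q C' \<Longrightarrow>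
      (\<And>z. z \<in> X - big_square - Q \<Longrightarrow> \<kappa> z = \<kappa>' z) \<Longrightarrow> z \<in> X - Q \<Longrightarrow> \<kappa> z = \<kappa>' z"
  shows "point_colorings F A t D \<approx> point_colorings F A t D'"
proof (rule lepoll_antisym)
  have box: "\<And>c. c \<in> C \<Longrightarrow> crossing_box X P c" "\<And>c. c \<in> C' \<Longrightarrow> crossing_box X Q c"
    using pic by (auto simp: picture_def)
  show "point_colorings F A t D \<lesssim> point_colorings F A t D'"
    by (rule local_move_lepoll[where C = C, OF F move X PQ _ pic(2)]) (fact box(1) ex(1) uniq(1))+
  show "point_colorings F A t D' \<lesssim> point_colorings F A t D"
    by (rule local_move_lepoll[where C = C', OF F(1,3,2) local_move_sym[OF move] X PQ[symmetric] _ pic(1)])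
      (fact box(2) ex(2) uniq(2))+
qed

lemma R1_eqpoll:
  assumes "Hausdorff_space F" "closedin F D" "closedin F D'" "local_move UNIV R1_before R1_after F D D'"
  shows "point_colorings F A t D \<approx> point_colorings F A t D'"
proof (rule local_move_eqpoll[OF assms closed_UNIV _ R1_before_picture R1_after_picture])
  show "R1_before - big_square = R1_after - big_square"
    by (auto simp: R1_before_def R1_after_def big_square_def)
qed (fact R1_extend R1_restrict R1_before_unique R1_after_unique)+

lemma R2_eqpoll:
  assumes "Hausdorff_space F" "closedin F D" "closedin F D'" "local_move UNIV R2_before R2_after F D D'"
  shows "point_colorings F A t D \<approx> point_colorings F A t D'"
proof (rule local_move_eqpoll[OF assms closed_UNIV _ R2_before_picture R2_after_picture])
  show "R2_before - big_square = R2_after - big_square"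
    by (auto simp: R2_before_def R2_after_def big_square_def)
qed (fact R2_extend R2_restrict R2_before_unique R2_after_unique)+

text \<open>One injection suffices for both directions, since by \<open>R3_mirror\<close> the
  inverse move is again a move from \<open>R3_before\<close> to \<open>R3_after\<close>.\<close>

lemma R3_eqpoll:
  assumes F: "Hausdorff_space F" "closedin F D" "closedin F D'" and move: "local_move UNIV R3_before R3_after F D D'"
  shows "point_colorings F A t D \<approx> point_colorings F A t D'"
proof -
  have off: "R3_before - big_square = R3_after - big_square"
    by (auto simp: R3_before_def R3_after_def big_square_def)
  have "point_colorings F A t D1 \<lesssim> point_colorings F A t D2"
    if "closedin F D1" "closedin F D2" "local_move UNIV R3_before R3_after F D1 D2" for D1 D2
    by (rule local_move_lepoll[where C = R3_before_crossings, OF F(1) that closed_UNIV off _ R3_after_picture])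
      (fact R3_before_boxes R3_extend R3_unique)+
  from this[OF F(2,3) move] this[OF F(3,2) R3_mirror[OF move]] show ?thesis
    by (rule lepoll_antisym)
qed

lemma boundary_eqpoll:
  assumes "Hausdorff_space F" "closedin F D" "closedin F D'"
    "local_move half_plane boundary_before boundary_after F D D'"
  shows "point_colorings F A t D \<approx> point_colorings F A t D'"
proof (rule local_move_eqpoll[OF assms _ _ boundary_before_picture boundary_after_picture])
  show "closed half_plane"
    unfolding half_plane_def case_prod_unfold by (intro closed_Collect_le continuous_intros)
  show "boundary_before - big_square = boundary_after - big_square"
    by (auto simp: boundary_before_def boundary_after_def big_square_def)
qed (fact boundary_extend boundary_restrict boundary_before_unique boundary_after_unique)+

end

section \<open>Isotopies and the equivalence relation\<close>

lemma homeomorphic_crossing_chart: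
  assumes h: "homeomorphic_map F F h" and D: "D \<subseteq> topspace F" and e: "crossing_chart F D e"
  shows "crossing_chart F (h ` D) (h \<circ> e)"
proof -
  note oe = crossing_chart_embedding[OF e]
  have "embedding_map F F h"
    using surjective_embedding_map[of F F h] h by blast
  then have "embedding_map euclidean F (h \<circ> e)"
    using oe embedding_map_compose by (auto simp: open_embedding_def)
  moreover have "openin F (h ` range e)"
    using homeomorphic_imp_open_map[OF h] open_embedding_openin[OF oe] by (simp add: open_map_def)
  ultimately have "open_embedding UNIV F (h \<circ> e)"
    by (simp add: open_embedding_def image_comp)
  moreover have "(h \<circ> e) z \<in> h ` D \<longleftrightarrow> e z \<in> D" for z
    using homeomorphic_imp_injective_map[OF h] open_embedding_topspace[OF oe, of z] D
    by (auto dest: inj_onD)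
  ultimately show ?thesis
    using e by (simp add: crossing_chart_def)
qed

lemma homeomorphic_lepoll:
  assumes h: "homeomorphic_map F F h" and D: "D \<subseteq> topspace F"
  shows "point_colorings F A t (h ` D) \<lesssim> point_colorings F A t D"
proof -
  let ?Y = "topspace F - D" and ?Y' = "topspace F - h ` D"
  have inj: "inj_on h (topspace F)" and im: "h ` topspace F = topspace F"
    using h homeomorphic_imp_injective_map homeomorphic_imp_surjective_map by blast+
  have Y': "h ` ?Y = ?Y'"
    using inj_on_image_set_diff[OF inj, of "topspace F" D] D im by simp
  let ?f = "\<lambda>k. \<lambda>p\<in>?Y. k (h p)"
  have "inj_on ?f (point_colorings F A t (h ` D))"
  proof (rule inj_onI)
    fix k k' assume k: "k \<in> point_colorings F A t (h ` D)" "k' \<in> point_colorings F A t (h ` D)" and eq: "?f k = ?f k'"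
    show "k = k'"
    proof (rule PiE_ext[of k ?Y' "\<lambda>_. A" k'])
      fix q assume "q \<in> ?Y'"
      then obtain p where "p \<in> ?Y" "q = h p" using Y' by blast
      then show "k q = k' q" using fun_cong[OF eq, of p] by simp
    qed (use k in \<open>simp_all add: point_colorings_def\<close>)
  qed
  moreover have "?f k \<in> point_colorings F A t D" if k: "k \<in> point_colorings F A t (h ` D)" for k
  proof -
    have "?f k \<in> ?Y \<rightarrow>\<^sub>E A"
      using point_coloring_mem[OF k] Y' by auto
    moreover have "locally_constant (subtopology F ?Y) (?f k)"
      unfolding locally_constant_def
    proof
      fix p assume "p \<in> topspace (subtopology F ?Y)"
      then have p: "p \<in> ?Y" by simp
      have hm: "continuous_map (subtopology F ?Y) (subtopology F ?Y') h"
        using homeomorphic_imp_continuous_map[OF h] Y'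
        by (auto simp: continuous_map_in_subtopology continuous_map_from_subtopology)
      have "locally_constant (subtopology F ?Y') k"
        using k by (simp add: point_colorings_def)
      moreover have "h p \<in> topspace (subtopology F ?Y')"
        using p Y' by auto
      ultimately obtain U where U: "openin (subtopology F ?Y') U" "h p \<in> U" "k constant_on U"
        unfolding locally_constant_def by blast
      let ?V = "{q \<in> topspace (subtopology F ?Y). h q \<in> U}"
      have "openin (subtopology F ?Y) ?V"
        by (rule openin_continuous_map_preimage[OF hm U(1)])
      moreover have "?f k constant_on ?V"
        using U(3) unfolding constant_on_def by auto
      ultimately show "\<exists>V. openin (subtopology F ?Y) V \<and> p \<in> V \<and> ?f k constant_on V"
        using p U(2) by (intro exI[of _ ?V]) simp
    qed
    moreover have "corner_equation t (?f k \<circ> e)" if e: "crossing_chart F D e" for e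
    proof -
      have "corner_equation t (k \<circ> (h \<circ> e))"
        using k homeomorphic_crossing_chart[OF h D e] by (simp add: point_colorings_def)
      then show ?thesis
        using crossing_chart_complement[OF e] by (simp add: corner_equation_def)
    qed
    ultimately show ?thesis
      by (simp add: point_colorings_def)
  qed
  ultimately show ?thesis
    unfolding lepoll_def by blast
qed

text \<open>The end map of an isotopy is a self-homeomorphism of \<open>F\<close>; composing
  colorings with it and with its inverse gives the two injections.\<close>

lemma isotopic_eqpoll:
  assumes "isotopic_in F D D'" and D: "D \<subseteq> topspace F"
  shows "point_colorings F A t D \<approx> point_colorings F A t D'"
proof -
  obtain h where "homotopic_with (homeomorphic_map F F) F F id h" and D': "D' = h ` D"
    using assms(1) by (auto simp: isotopic_in_def)
  then have h: "homeomorphic_map F F h"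
    using homotopic_with_imp_property by blast
  then obtain g where g: "homeomorphic_maps F F h g"
    using homeomorphic_map_maps by blast
  then have gm: "homeomorphic_map F F g"
    using homeomorphic_maps_map by blast
  have "g ` h ` D = D"
    using g D by (force simp: homeomorphic_maps_def image_comp)
  moreover have "h ` D \<subseteq> topspace F"
    using homeomorphic_imp_surjective_map[OF h] D by blast
  ultimately show ?thesis
    using homeomorphic_lepoll[OF h D, of A t] homeomorphic_lepoll[OF gm, of "h ` D" A t]
    unfolding D' by (simp add: lepoll_antisym)
qed

lemma (in kt_ternary) diagram_step_eqpoll:
  assumes F: "compact_surface F" and step: "diagram_step F D D'"
  shows "point_colorings F A t D \<approx> point_colorings F A t D'"
proof -
  have D: "closedin F D" "closedin F D'"
    using step diagram_closedin[OF F] by (auto simp: diagram_step_def)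
  have H: "Hausdorff_space F"
    using F by (simp add: compact_surface_def)
  from step consider "isotopic_in F D D'" | "local_move UNIV R1_before R1_after F D D'"
    | "local_move UNIV R2_before R2_after F D D'" | "local_move UNIV R3_before R3_after F D D'"
    | "local_move half_plane boundary_before boundary_after F D D'"
    unfolding diagram_step_def by blast
  then show ?thesis
  proof cases
    case 1
    then show ?thesis using isotopic_eqpoll closedin_subset[OF D(1)] by blast
  next
    case 2
    then show ?thesis by (rule R1_eqpoll[OF H D])
  next
    case 3
    then show ?thesis by (rule R2_eqpoll[OF H D])
  next
    case 4
    then show ?thesis by (rule R3_eqpoll[OF H D])
  next
    case 5
    then show ?thesis by (rule boundary_eqpoll[OF H D])
  qed
qed

theorem theorem6p8:
  fixes F :: "'a topology"
    and A :: "'b set" and t :: "'b \<Rightarrow> 'b \<Rightarrow> 'b \<Rightarrow> 'b"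
    and D D' :: "'a set"
  assumes "compact_surface F"
    and "knot_theoretic_ternary_group A t"
    and "diagram F D" and "diagram F D'"
    and "same_flat_link F D D'"
  shows "colorings F A t D \<approx> colorings F A t D'"
proof -
  interpret kt_ternary A t
    by unfold_locales (fact assms(2))
  have "equivclp (diagram_step F) D D'"
    using assms(5) by (simp add: same_flat_link_def)
  then have "point_colorings F A t D \<approx> point_colorings F A t D'"
  proof (induction rule: equivclp_induct)
    case base
    show ?case by simp
  next
    case (step D1 D2)
    \<comment> \<open>The equivalence closure allows the step between \<open>D1\<close> and
      \<open>D2\<close> in either direction, hence the symmetry.\<close>
    then have "point_colorings F A t D1 \<approx> point_colorings F A t D2"
      using diagram_step_eqpoll[OF assms(1)] eqpoll_sym by blast
    with step.IH show ?case
      by (rule eqpoll_trans)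
  qed
  moreover have "colorings F A t E \<approx> point_colorings F A t E" if "diagram F E" for E
    by (rule colorings_eqpoll[OF compact_surface_locally_connected diagram_closedin]) (use assms(1) that in auto)
  ultimately show ?thesis
    using assms(3,4) by (meson eqpoll_sym eqpoll_trans)
qed

end
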